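(* Let $\alpha\in[0,\tfrac12)$ be fixed and, for each $n$, let $\mu_n\vdash n$ be a partition of $n$ with at most $n^\alpha$ parts. Let $(\sigma,\tau)$ be chosen uniformly at random from $\mathcal{K}_{\mu_n}\times S_n$. Then, as $n\to\infty$: (1) The probability that $S(\sigma,\tau)$ is a holonomy torus is asymptotically $\frac1e$; more precisely, for any $\epsilon>0$ such that $\alpha+\epsilon<\tfrac12$, $$\left|\Pr(S(\sigma,\tau)\text{ is a holonomy torus})-\frac1e\right|=O\left(\frac1{n^{1-2\alpha-2\epsilon}}\right).$$ (2) The probability that $S(\sigma,\tau)$ is a visibility STS is asymptotically $1$; more precisely, $$\Pr(S(\sigma,\tau)\text{ is a visibility STS})=1-O\left(\frac{n^2}{2^{n/2}}\right).$$
   Context: $S_n$ is the symmetric group on $\{1,\dots,n\}$; $\mathcal{K}_{\mu_n}$ is the conjugacy class of $S_n$ of permutations with cycle type $\mu_n$. For $\sigma,\tau\in S_n$, $S(\sigma,\tau)$ is the (labelled, not necessarily connected) square-tiled surface (STS) built from $n$ axis-parallel unit squares in the plane labelled $1,\dots,n$, where the right side of square $j$ is glued by translation to the left side of square $\sigma(j)$ and the top side of square $j$ to the bottom side of square $\tau(j)$. Vertices have total angle $2\pi\ell$ with $\ell\ge1$ an integer; those with $\ell>1$ are cone points. On a component without cone points, one vertex is marked and plays the role of a cone point. A saddle connection is a straight segment on the surface joining cone points (possibly the same one) with no cone point in its interior; its holonomy vector is the vector in $\mathbb{R}^2$ recording its Euclidean $x$- and $y$-displacement. $\mathrm{Hol}(S)\subseteq\mathbb{Z}^2$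 is the set of all holonomy vectors of saddle connections of $S$ (for a disconnected surface, the union over its components). For the square torus $\mathbb{T}=\mathbb{C}/\mathbb{Z}[i]$ with the origin marked, $\mathrm{Hol}(\mathbb{T})=\{(p,q)\in\mathbb{Z}^2:\gcd(p,q)=1\}$. An STS $S$ is a holonomy torus if $\mathrm{Hol}(S)=\mathrm{Hol}(\mathbb{T})$, and a visibility STS if $\mathrm{Hol}(S)\supseteq\mathrm{Hol}(\mathbb{T})$. *)

theory Defs
  imports "HOL-Probability.Probability" "HOL-Combinatorics.Combinatorics"
    "HOL-Library.Landau_Symbols"
begin

section \<open>Square-tiled surfaces\<close>

text \<open>
  The point \<open>(j, x, y)\<close> is the point with coordinates \<open>(x, y)\<close> in the \<open>j\<close>-th of \<open>n\<close> disjoint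
  copies of the closed unit square. In the surface \<open>S(\<sigma>, \<tau>)\<close> the labels are \<open>1, \<dots>, n\<close> and
  \<open>\<sigma>, \<tau>\<close> permute them.
\<close>

type_synonym square_pt = "nat \<times> real \<times> real"

definition squares :: "nat \<Rightarrow> square_pt set" where
  "squares n = {1..n} \<times> {0..1} \<times> {0..1}"

inductive glued :: "nat \<Rightarrow> (nat \<Rightarrow> nat) \<Rightarrow> (nat \<Rightarrow> nat) \<Rightarrow> square_pt \<Rightarrow> square_pt \<Rightarrow> bool"
  for n \<sigma> \<tau> where
  right_left: "j \<in> {1..n} \<Longrightarrow> y \<in> {0..1} \<Longrightarrow> glued n \<sigma> \<tau> (j, 1, y) (\<sigma> j, 0, y)"
| top_bottom: "j \<in> {1..n} \<Longrightarrow> x \<in> {0..1} \<Longrightarrow> glued n \<sigma> \<tau> (j, x, 1) (\<tau> j, x, 0)"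

text \<open>Points of the surface are the equivalence classes of points of the squares.\<close>

definition surf_pt :: "nat \<Rightarrow> (nat \<Rightarrow> nat) \<Rightarrow> (nat \<Rightarrow> nat) \<Rightarrow> square_pt \<Rightarrow> square_pt set" where
  "surf_pt n \<sigma> \<tau> p = {q. equivclp (glued n \<sigma> \<tau>) p q}"

definition surface :: "nat \<Rightarrow> (nat \<Rightarrow> nat) \<Rightarrow> (nat \<Rightarrow> nat) \<Rightarrow> square_pt set set" where
  "surface n \<sigma> \<tau> = surf_pt n \<sigma> \<tau> ` squares n"

definition sts :: "nat \<Rightarrow> (nat \<Rightarrow> nat) \<Rightarrow> (nat \<Rightarrow> nat) \<Rightarrow> square_pt set topology" where
  "sts n \<sigma> \<tau> = topology (\<lambda>U. U \<subseteq> surface n \<sigma> \<tau> \<and>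
     openin (top_of_set (squares n)) {p \<in> squares n. surf_pt n \<sigma> \<tau> p \<in> U})"

lemma openin_sts:
  "openin (sts n \<sigma> \<tau>) U \<longleftrightarrow> U \<subseteq> surface n \<sigma> \<tau> \<and>
     openin (top_of_set (squares n)) {p \<in> squares n. surf_pt n \<sigma> \<tau> p \<in> U}"
proof -
  let ?L = "\<lambda>U. U \<subseteq> surface n \<sigma> \<tau> \<and>
     openin (top_of_set (squares n)) {p \<in> squares n. surf_pt n \<sigma> \<tau> p \<in> U}"
  have "istopology ?L"
    unfolding istopology_def
  proof (intro conjI allI impI)
    fix S T assume S: "?L S" and T: "?L T"
    then show "S \<inter> T \<subseteq> surface n \<sigma> \<tau>" by blast
    have "{p \<in> squares n. surf_pt n \<sigma> \<tau> p \<in> S \<inter> T} =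
        {p \<in> squares n. surf_pt n \<sigma> \<tau> p \<in> S} \<inter> {p \<in> squares n. surf_pt n \<sigma> \<tau> p \<in> T}"
      by blast
    then show "openin (top_of_set (squares n)) {p \<in> squares n. surf_pt n \<sigma> \<tau> p \<in> S \<inter> T}"
      using S T by (simp only: openin_Int)
  next
    fix \<K> assume K: "\<forall>K\<in>\<K>. ?L K"
    show "\<Union>\<K> \<subseteq> surface n \<sigma> \<tau>" using K by blast
    have "{p \<in> squares n. surf_pt n \<sigma> \<tau> p \<in> \<Union>\<K>} =
        (\<Union>K\<in>\<K>. {p \<in> squares n. surf_pt n \<sigma> \<tau> p \<in> K})"
      by blast
    moreover have "openin (top_of_set (squares n)) (\<Union>K\<in>\<K>. {p \<in> squares n. surf_pt n \<sigma> \<tau> p \<in> K})"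
      using K by (intro openin_Union) auto
    ultimately show "openin (top_of_set (squares n)) {p \<in> squares n. surf_pt n \<sigma> \<tau> p \<in> \<Union>\<K>}"
      by simp
  qed
  then show ?thesis unfolding sts_def by (simp only: topology_inverse')
qed

lemma topspace_sts: "topspace (sts n \<sigma> \<tau>) = surface n \<sigma> \<tau>"
proof
  show "topspace (sts n \<sigma> \<tau>) \<subseteq> surface n \<sigma> \<tau>"
    using openin_sts[of n \<sigma> \<tau> "topspace (sts n \<sigma> \<tau>)"] by simp
  have "{p \<in> squares n. surf_pt n \<sigma> \<tau> p \<in> surface n \<sigma> \<tau>} = squares n"
    by (auto simp: surface_def)
  then have "openin (sts n \<sigma> \<tau>) (surface n \<sigma> \<tau>)"
    by (simp add: openin_sts)
  then show "surface n \<sigma> \<tau> \<subseteq> topspace (sts n \<sigma> \<tau>)"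
    by (rule openin_subset)
qed

lemma quotient_map_sts: "quotient_map (top_of_set (squares n)) (sts n \<sigma> \<tau>) (surf_pt n \<sigma> \<tau>)"
proof -
  have "surf_pt n \<sigma> \<tau> ` squares n = surface n \<sigma> \<tau>"
    by (simp only: surface_def)
  then show ?thesis
    by (simp add: quotient_map_def topspace_sts openin_sts)
qed

section \<open>Vertices, cone points and marked vertices\<close>

definition corners :: "nat \<Rightarrow> square_pt set" where
  "corners n = {1..n} \<times> {0, 1} \<times> {0, 1}"

definition vertices :: "nat \<Rightarrow> (nat \<Rightarrow> nat) \<Rightarrow> (nat \<Rightarrow> nat) \<Rightarrow> square_pt set set" where
  "vertices n \<sigma> \<tau> = surf_pt n \<sigma> \<tau> ` corners n"

text \<open>Every square corner glued into a vertex contributes a right angle.\<close>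

definition total_angle :: "nat \<Rightarrow> square_pt set \<Rightarrow> real" where
  "total_angle n v = real (card (v \<inter> corners n)) * (pi / 2)"

definition cone_points :: "nat \<Rightarrow> (nat \<Rightarrow> nat) \<Rightarrow> (nat \<Rightarrow> nat) \<Rightarrow> square_pt set set" where
  "cone_points n \<sigma> \<tau> = {v \<in> vertices n \<sigma> \<tau>. total_angle n v > 2 * pi}"

text \<open>
  \<open>marking n \<sigma> \<tau> M\<close>: the set \<open>M\<close> of marked vertices consists of exactly one vertex on each
  component without cone points.
\<close>

definition marking ::
    "nat \<Rightarrow> (nat \<Rightarrow> nat) \<Rightarrow> (nat \<Rightarrow> nat) \<Rightarrow> square_pt set set \<Rightarrow> bool" where
  "marking n \<sigma> \<tau> M \<longleftrightarrow> M \<subseteq> vertices n \<sigma> \<tau> \<and>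
     (\<forall>C \<in> connected_components_of (sts n \<sigma> \<tau>).
        if C \<inter> cone_points n \<sigma> \<tau> = {} then card (M \<inter> C) = 1 else M \<inter> C = {})"

section \<open>Saddle connections and holonomy\<close>

text \<open>
  A path on the surface is straight with velocity \<open>v\<close> if immediately after and immediately before
  each time it runs inside one closed square as a Euclidean segment with velocity \<open>v\<close>; the squares
  before and after may differ. At a point of total angle \<open>2 * pi\<close> there is only one way of
  continuing with velocity \<open>v\<close>, so away from cone points these are the constant speed geodesics.
  Parametrised by \<open>[0, 1]\<close>, such a path has displacement \<open>v\<close>.
\<close>

definition straight_path ::
    "nat \<Rightarrow> (nat \<Rightarrow> nat) \<Rightarrow> (nat \<Rightarrow> nat) \<Rightarrow> real \<times> real \<Rightarrow> (real \<Rightarrow> square_pt set) \<Rightarrow> bool" where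
  "straight_path n \<sigma> \<tau> v \<gamma> \<longleftrightarrow>
     (\<forall>t \<in> {0..<1}. \<exists>e>0. \<exists>j\<in>{1..n}. \<exists>p. \<forall>s \<in> {t..t+e}.
        p + (s - t) *\<^sub>R v \<in> {0..1} \<times> {0..1} \<and> \<gamma> s = surf_pt n \<sigma> \<tau> (j, p + (s - t) *\<^sub>R v)) \<and>
     (\<forall>t \<in> {0<..1}. \<exists>e>0. \<exists>j\<in>{1..n}. \<exists>p. \<forall>s \<in> {t-e..t}.
        p + (s - t) *\<^sub>R v \<in> {0..1} \<times> {0..1} \<and> \<gamma> s = surf_pt n \<sigma> \<tau> (j, p + (s - t) *\<^sub>R v))"

definition saddle_connection ::
    "nat \<Rightarrow> (nat \<Rightarrow> nat) \<Rightarrow> (nat \<Rightarrow> nat) \<Rightarrow> square_pt set set \<Rightarrow> real \<times> real \<Rightarrow>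
       (real \<Rightarrow> square_pt set) \<Rightarrow> bool" where
  "saddle_connection n \<sigma> \<tau> M v \<gamma> \<longleftrightarrow> v \<noteq> 0 \<and> straight_path n \<sigma> \<tau> v \<gamma> \<and>
     \<gamma> 0 \<in> cone_points n \<sigma> \<tau> \<union> M \<and> \<gamma> 1 \<in> cone_points n \<sigma> \<tau> \<union> M \<and>
     (\<forall>t \<in> {0<..<1}. \<gamma> t \<notin> cone_points n \<sigma> \<tau> \<union> M)"

definition Hol :: "nat \<Rightarrow> (nat \<Rightarrow> nat) \<Rightarrow> (nat \<Rightarrow> nat) \<Rightarrow> square_pt set set \<Rightarrow> (real \<times> real) set" where
  "Hol n \<sigma> \<tau> M = {v. \<exists>\<gamma>. saddle_connection n \<sigma> \<tau> M v \<gamma>}"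

text \<open>
  The square torus is the surface with a single square; its only vertex is the image of the origin.
\<close>

definition Hol_torus :: "(real \<times> real) set" where
  "Hol_torus = Hol 1 id id {surf_pt 1 id id (1, 0, 0)}"

definition holonomy_torus ::
    "nat \<Rightarrow> (nat \<Rightarrow> nat) \<Rightarrow> (nat \<Rightarrow> nat) \<Rightarrow> square_pt set set \<Rightarrow> bool" where
  "holonomy_torus n \<sigma> \<tau> M \<longleftrightarrow> Hol n \<sigma> \<tau> M = Hol_torus"

definition visibility_sts ::
    "nat \<Rightarrow> (nat \<Rightarrow> nat) \<Rightarrow> (nat \<Rightarrow> nat) \<Rightarrow> square_pt set set \<Rightarrow> bool" where
  "visibility_sts n \<sigma> \<tau> M \<longleftrightarrow> Hol n \<sigma> \<tau> M \<supseteq> Hol_torus"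

section \<open>Partitions, conjugacy classes and the random pair\<close>

definition is_partition :: "nat multiset \<Rightarrow> nat \<Rightarrow> bool" where
  "is_partition \<mu> n \<longleftrightarrow> 0 \<notin># \<mu> \<and> sum_mset \<mu> = n"

definition sym_perms :: "nat \<Rightarrow> (nat \<Rightarrow> nat) set" where
  "sym_perms n = {\<sigma>. \<sigma> permutes {1..n}}"

text \<open>Fixed points count as cycles of length 1.\<close>

definition cycle_type :: "nat \<Rightarrow> (nat \<Rightarrow> nat) \<Rightarrow> nat multiset" where
  "cycle_type n \<sigma> = image_mset card (mset_set (orbit \<sigma> ` {1..n}))"

definition conj_class :: "nat \<Rightarrow> nat multiset \<Rightarrow> (nat \<Rightarrow> nat) set" where
  "conj_class n \<mu> = {\<sigma> \<in> sym_perms n. cycle_type n \<sigma> = \<mu>}"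

definition random_pair :: "nat \<Rightarrow> nat multiset \<Rightarrow> ((nat \<Rightarrow> nat) \<times> (nat \<Rightarrow> nat)) pmf" where
  "random_pair n \<mu> = pmf_of_set (conj_class n \<mu> \<times> sym_perms n)"

definition prob_holonomy_torus ::
    "nat \<Rightarrow> nat multiset \<Rightarrow> ((nat \<Rightarrow> nat) \<Rightarrow> (nat \<Rightarrow> nat) \<Rightarrow> square_pt set set) \<Rightarrow> real" where
  "prob_holonomy_torus n \<mu> M =
     measure_pmf.prob (random_pair n \<mu>) {(\<sigma>, \<tau>). holonomy_torus n \<sigma> \<tau> (M \<sigma> \<tau>)}"

definition prob_visibility ::
    "nat \<Rightarrow> nat multiset \<Rightarrow> ((nat \<Rightarrow> nat) \<Rightarrow> (nat \<Rightarrow> nat) \<Rightarrow> square_pt set set) \<Rightarrow> real" where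
  "prob_visibility n \<mu> M =
     measure_pmf.prob (random_pair n \<mu>) {(\<sigma>, \<tau>). visibility_sts n \<sigma> \<tau> (M \<sigma> \<tau>)}"

end

theory Submission
  imports Defs "HOL-Real_Asymp.Real_Asymp"
begin

text \<open>
  Let \<open>X\<close> be the number of squares \<open>k\<close> with \<open>\<tau> (\<sigma> k) = \<sigma> (\<tau> k)\<close>. Walking around the upper right
  corner of square \<open>k\<close> one returns to the start after four squares if \<open>k\<close> is counted by \<open>X\<close>, and
  only later otherwise. So \<open>X\<close> is the number of vertices that are not cone points. Call a vertex
  special if it is a cone point or marked.

  Geometry. Forgetting the labels of the squares maps the surface to the torus, and the image of a
  straight path with velocity \<open>v\<close> that leaves a vertex is the line \<open>t \<mapsto> t v\<close>. Such a path is
  therefore at a vertex exactly when \<open>t v\<close> is integral (\<open>straight_path_vertex_iff\<close>). For each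
  primitive \<open>v\<close> there are \<open>n\<close> segments with displacement \<open>v\<close>, one for each square, and both the
  starting and the final corners form a permutation of the squares (\<open>primitive_path\<close>). If \<open>2 X < n\<close>
  then at least one of the segments has special endpoints, for every primitive \<open>v\<close>, and the surface
  is a visibility STS. If every vertex is special, the holonomy vectors are the primitive vectors,
  as for the square torus. Conversely, suppose that some vertex is not special. Its component
  contains a special vertex, so some row or column of squares contains both kinds, and following its
  edges from a special vertex through others to the next special one gives a saddle connection
  with holonomy \<open>(k, 0)\<close> or \<open>(0, k)\<close> and \<open>k \<ge> 2\<close>. Hence the surface is a holonomy torus if and
  only if all vertices are special. This holds if \<open>X = 0\<close>; if it holds although \<open>X > 0\<close>, then some
  component is a torus with a single vertex, that is, a single square \<open>j\<close> with
  \<open>\<sigma> j = j = \<tau> j\<close>, which has probability at most \<open>f / n\<close> when \<open>\<sigma>\<close> has \<open>f\<close> fixed points.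

  Probability. Fix \<open>\<sigma>\<close> with \<open>c\<close> cycles and let \<open>\<tau>\<close> be uniform. The claim about holonomy tori is that
  \<open>X\<close> is approximately Poisson with mean 1. The proof is the Stein-Chen method with a size bias
  coupling: composing \<open>\<tau>\<close> with one transposition makes it commute with \<open>\<sigma>\<close> at a given \<open>k\<close>, turns the
  uniform law into the uniform law conditioned on commuting at \<open>k\<close> (\<open>sum_make_commute\<close>), and
  increases \<open>X\<close> by exactly one outside few exceptional events (\<open>size_bias_estimate\<close>). Solving
  Stein's equation for the indicator of \<open>0\<close> gives
  \<open>\<bar>P(X = 0) - 1/e\<bar> = O(c\<^sup>2 / n) = O(n powr (2 * \<alpha> - 1))\<close> (\<open>prob_no_commuting_estimate\<close>). For the
  visibility statement, a \<open>\<tau>\<close> that commutes with \<open>\<sigma>\<close> at all points of \<open>A\<close> is determined by its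
  values outside \<open>\<sigma> ` A\<close> and at one point of each cycle; so there are at most \<open>n ^ (n - card A + c)\<close>
  of them, and the union over all \<open>A\<close> with at least \<open>n / 2\<close> elements is negligible against \<open>n!\<close>
  (\<open>card_many_commuting\<close>). Both bounds are uniform in \<open>\<sigma>\<close> and so survive averaging over the
  conjugacy class.
\<close>


section \<open>Counting permutations that commute at a point\<close>

text \<open>
  Relative to one such permutation, the others differ by a permutation of the complement of \<open>A\<close>.
\<close>
lemma card_permutes_prescribed:
  assumes fin: "finite S" and "A \<subseteq> S"
  shows "card {\<tau>. \<tau> permutes S \<and> (\<forall>x\<in>A. \<tau> x = h x)} \<le> fact (card S - card A)"
proof (cases "{\<tau>. \<tau> permutes S \<and> (\<forall>x\<in>A. \<tau> x = h x)} = {}")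
  case True
  then show ?thesis by (simp only: card.empty le0)
next
  case False
  then obtain \<tau>\<^sub>0 where t0: "\<tau>\<^sub>0 permutes S" "\<forall>x\<in>A. \<tau>\<^sub>0 x = h x" by blast
  let ?P = "{\<tau>. \<tau> permutes S \<and> (\<forall>x\<in>A. \<tau> x = h x)}"
  have "inj_on (\<lambda>\<tau>. inv \<tau>\<^sub>0 \<circ> \<tau>) ?P"
  proof (rule inj_onI)
    fix \<tau> \<tau>' assume "inv \<tau>\<^sub>0 \<circ> \<tau> = inv \<tau>\<^sub>0 \<circ> \<tau>'"
    then have "\<tau>\<^sub>0 \<circ> (inv \<tau>\<^sub>0 \<circ> \<tau>) = \<tau>\<^sub>0 \<circ> (inv \<tau>\<^sub>0 \<circ> \<tau>')" by simp
    then show "\<tau> = \<tau>'" by (simp add: o_assoc permutes_inv_o(1)[OF t0(1)])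
  qed
  moreover have "(\<lambda>\<tau>. inv \<tau>\<^sub>0 \<circ> \<tau>) ` ?P \<subseteq> {\<pi>. \<pi> permutes (S - A)}"
  proof clarsimp
    fix \<tau> assume t: "\<tau> permutes S" "\<forall>x\<in>A. \<tau> x = h x"
    show "inv \<tau>\<^sub>0 \<circ> \<tau> permutes (S - A)"
    proof (rule permutes_superset)
      show "inv \<tau>\<^sub>0 \<circ> \<tau> permutes S" using t t0 by (simp add: permutes_compose permutes_inv)
    next
      fix x assume "x \<in> S - (S - A)"
      then have "\<tau> x = \<tau>\<^sub>0 x" using t t0 by auto
      then show "(inv \<tau>\<^sub>0 \<circ> \<tau>) x = x" using permutes_inverses(2)[OF t0(1)] by simp
    qed
  qed
  moreover have "finite {\<pi>. \<pi> permutes (S - A)}" using fin by (simp add: finite_permutations)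
  ultimately have "card ?P \<le> card {\<pi>. \<pi> permutes (S - A)}" by (rule card_inj_on_le)
  also have "\<dots> = fact (card (S - A))" using fin by (simp add: card_permutations)
  also have "card (S - A) = card S - card A" using assms by (simp add: card_Diff_subset finite_subset)
  finally show ?thesis .
qed

locale finite_perm =
  fixes S :: "'a set" and \<sigma> :: "'a \<Rightarrow> 'a"
  assumes finite_S: "finite S" and \<sigma>: "\<sigma> permutes S"
begin

abbreviation perms :: "('a \<Rightarrow> 'a) set" where
  "perms \<equiv> {\<tau>. \<tau> permutes S}"

definition commutes_at :: "('a \<Rightarrow> 'a) \<Rightarrow> 'a \<Rightarrow> bool" where
  "commutes_at \<tau> k \<longleftrightarrow> \<tau> (\<sigma> k) = \<sigma> (\<tau> k)"

definition commuting :: "('a \<Rightarrow> 'a) \<Rightarrow> 'a set" where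
  "commuting \<tau> = {k \<in> S. commutes_at \<tau> k}"

definition num_commuting :: "('a \<Rightarrow> 'a) \<Rightarrow> nat" where
  "num_commuting \<tau> = card (commuting \<tau>)"

text \<open>
  Short cycles are what spoils independence: a \<open>\<tau>\<close> commuting with \<open>\<sigma>\<close> at a fixed point, or at both
  points of a 2-cycle, must map it into the fixed points, or into \<open>Fix2\<close>.
\<close>
definition Fix :: "'a set" where
  "Fix = {k \<in> S. \<sigma> k = k}"

definition Fix2 :: "'a set" where
  "Fix2 = {k \<in> S. \<sigma> (\<sigma> k) = k}"

lemma finite_perms: "finite perms"
  using finite_S by (rule finite_permutations)

lemma card_perms: "card perms = fact (card S)"
  using finite_S by (simp add: card_permutations)

lemma finite_sets [simp]: "finite Fix" "finite Fix2" "finite (commuting \<tau>)" "finite S"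
  using finite_S by (auto simp: Fix_def Fix2_def commuting_def)

lemma in_S [simp]: "\<sigma> k \<in> S \<longleftrightarrow> k \<in> S"
  using \<sigma> by (rule permutes_in_image)

lemma \<sigma>_eq [simp]: "\<sigma> a = \<sigma> b \<longleftrightarrow> a = b"
  using permutes_inj[OF \<sigma>] by (auto dest: injD)

lemma Fix_sub: "Fix \<subseteq> Fix2" "Fix2 \<subseteq> S" by (auto simp: Fix_def Fix2_def)

lemma sum_if_one_zero: "finite T \<Longrightarrow> (\<Sum>\<tau>\<in>T. if P \<tau> then 1 else (0::real)) = real (card {\<tau>\<in>T. P \<tau>})"
  by (simp add: sum.If_cases Int_def)

lemma sum_num_commuting_swap:
  "(\<Sum>\<tau>\<in>perms. real (num_commuting \<tau>) * g \<tau>) = (\<Sum>k\<in>S. \<Sum>\<tau>\<in>{\<tau>\<in>perms. commutes_at \<tau> k}. g \<tau>)"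
proof -
  have "(\<Sum>\<tau>\<in>perms. real (num_commuting \<tau>) * g \<tau>) = (\<Sum>\<tau>\<in>perms. \<Sum>k\<in>S. if commutes_at \<tau> k then g \<tau> else 0)"
    by (intro sum.cong refl) (simp add: num_commuting_def commuting_def sum.If_cases Int_def)
  also have "\<dots> = (\<Sum>k\<in>S. \<Sum>\<tau>\<in>perms. if commutes_at \<tau> k then g \<tau> else 0)"
    by (rule sum.swap)
  also have "\<dots> = (\<Sum>k\<in>S. \<Sum>\<tau>\<in>{\<tau>\<in>perms. commutes_at \<tau> k}. g \<tau>)"
    by (intro sum.cong refl sum.inter_filter[symmetric] finite_perms)
  finally show ?thesis .
qed

lemma card_image_in:
  assumes "k \<in> S" "T \<subseteq> S"
  shows "card {\<tau>\<in>perms. \<tau> k \<in> T} \<le> card T * fact (card S - 1)"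
proof -
  have fT: "finite T" using assms finite_S finite_subset by blast
  have "{\<tau>\<in>perms. \<tau> k \<in> T} = (\<Union>y\<in>T. {\<tau>. \<tau> permutes S \<and> (\<forall>x\<in>{k}. \<tau> x = y)})" by auto
  also have "card \<dots> \<le> (\<Sum>y\<in>T. card {\<tau>. \<tau> permutes S \<and> (\<forall>x\<in>{k}. \<tau> x = y)})"
    by (rule card_UN_le[OF fT])
  also have "\<dots> \<le> (\<Sum>y\<in>T. fact (card S - card {k}))"
    by (intro sum_mono card_permutes_prescribed finite_S) (use assms in auto)
  finally show ?thesis by simp
qed

text \<open>
  In this and the next three lemmas, commuting at \<open>k\<close> makes \<open>\<tau> k\<close> determine \<open>\<tau> (\<sigma> k)\<close>, and commuting
  also at \<open>\<sigma> k\<close> determines \<open>\<tau> (\<sigma> (\<sigma> k))\<close>. Each distinct point with a determined value saves a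
  factor of order \<open>n\<close>, unless the cycle of \<open>k\<close> is too short for new points to appear; then \<open>\<tau> k\<close> is
  confined to cycles of the same kind.
\<close>
lemma card_commutes_at_Fix:
  assumes "k \<in> Fix"
  shows "card {\<tau>\<in>perms. commutes_at \<tau> k} \<le> card Fix * fact (card S - 1)"
proof -
  have "k \<in> S" using assms by (auto simp: Fix_def)
  have "{\<tau>\<in>perms. commutes_at \<tau> k} = {\<tau>\<in>perms. \<tau> k \<in> Fix}"
    using assms by (auto simp: Fix_def commutes_at_def permutes_in_image)
  then show ?thesis using card_image_in[OF \<open>k \<in> S\<close>, of Fix] Fix_sub by auto
qed

lemma card_commutes_at_nonFix:
  assumes "k \<in> S - Fix"
  shows "card {\<tau>\<in>perms. commutes_at \<tau> k} \<le> card S * fact (card S - 2)"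
proof -
  have k: "k \<in> S" "\<sigma> k \<noteq> k" using assms by (auto simp: Fix_def)
  have "{\<tau>\<in>perms. commutes_at \<tau> k} \<subseteq> (\<Union>y\<in>S. {\<tau>. \<tau> permutes S \<and> (\<forall>x\<in>{k, \<sigma> k}. \<tau> x = (if x = k then y else \<sigma> y))})"
    using k by (auto simp: commutes_at_def permutes_in_image)
  moreover have "finite (\<Union>y\<in>S. {\<tau>. \<tau> permutes S \<and> (\<forall>x\<in>{k, \<sigma> k}. \<tau> x = (if x = k then y else \<sigma> y))})"
    by (rule finite_subset[OF _ finite_perms]) auto
  ultimately have "card {\<tau>\<in>perms. commutes_at \<tau> k} \<le> card (\<Union>y\<in>S. {\<tau>. \<tau> permutes S \<and> (\<forall>x\<in>{k, \<sigma> k}. \<tau> x = (if x = k then y else \<sigma> y))})"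
    by (rule card_mono[rotated])
  also have "\<dots> \<le> (\<Sum>y\<in>S. card {\<tau>. \<tau> permutes S \<and> (\<forall>x\<in>{k, \<sigma> k}. \<tau> x = (if x = k then y else \<sigma> y))})"
    by (rule card_UN_le) simp
  also have "\<dots> \<le> (\<Sum>y\<in>S. fact (card S - card {k, \<sigma> k}))"
    by (intro sum_mono card_permutes_prescribed finite_S) (use k in auto)
  also have "card {k, \<sigma> k} = 2" using k by auto
  finally show ?thesis by simp
qed

lemma card_commutes_at_two_nonFix2:
  assumes "k \<in> S - Fix2"
  shows "card {\<tau>\<in>perms. commutes_at \<tau> k \<and> commutes_at \<tau> (\<sigma> k)} \<le> card S * fact (card S - 3)"
proof -
  have k: "k \<in> S" "\<sigma> k \<noteq> k" "\<sigma> (\<sigma> k) \<noteq> k" "\<sigma> k \<in> S" "\<sigma> (\<sigma> k) \<in> S"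
    using assms by (auto simp: Fix2_def)
  let ?h = "\<lambda>y x. if x = k then y else if x = \<sigma> k then \<sigma> y else \<sigma> (\<sigma> y)"
  let ?U = "\<lambda>y. {\<tau>. \<tau> permutes S \<and> (\<forall>x\<in>{k, \<sigma> k, \<sigma> (\<sigma> k)}. \<tau> x = ?h y x)}"
  have "{\<tau>\<in>perms. commutes_at \<tau> k \<and> commutes_at \<tau> (\<sigma> k)} \<subseteq> (\<Union>y\<in>S. ?U y)"
    using k by (auto simp: commutes_at_def permutes_in_image)
  moreover have "finite (\<Union>y\<in>S. ?U y)"
    by (rule finite_subset[OF _ finite_perms]) auto
  ultimately have "card {\<tau>\<in>perms. commutes_at \<tau> k \<and> commutes_at \<tau> (\<sigma> k)} \<le> card (\<Union>y\<in>S. ?U y)"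
    by (rule card_mono[rotated])
  also have "\<dots> \<le> (\<Sum>y\<in>S. card (?U y))"
    by (rule card_UN_le) simp
  also have "\<dots> \<le> (\<Sum>y\<in>S. fact (card S - card {k, \<sigma> k, \<sigma> (\<sigma> k)}))"
    by (intro sum_mono card_permutes_prescribed finite_S) (use k in auto)
  also have "card {k, \<sigma> k, \<sigma> (\<sigma> k)} = 3" using k by auto
  finally show ?thesis by simp
qed

lemma card_commutes_at_two_Fix2:
  assumes "k \<in> Fix2 - Fix"
  shows "card {\<tau>\<in>perms. commutes_at \<tau> k \<and> commutes_at \<tau> (\<sigma> k)} \<le> card Fix2 * fact (card S - 2)"
proof -
  have k: "k \<in> S" "\<sigma> k \<noteq> k" "\<sigma> (\<sigma> k) = k" "\<sigma> k \<in> S"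
    using assms by (auto simp: Fix2_def Fix_def)
  let ?h = "\<lambda>y x. if x = k then y else \<sigma> y"
  let ?U = "\<lambda>y. {\<tau>. \<tau> permutes S \<and> (\<forall>x\<in>{k, \<sigma> k}. \<tau> x = ?h y x)}"
  have "{\<tau>\<in>perms. commutes_at \<tau> k \<and> commutes_at \<tau> (\<sigma> k)} \<subseteq> (\<Union>y\<in>Fix2. ?U y)"
    using k by (auto simp: commutes_at_def Fix2_def permutes_in_image)
  moreover have "finite (\<Union>y\<in>Fix2. ?U y)"
    by (rule finite_subset[OF _ finite_perms]) auto
  ultimately have "card {\<tau>\<in>perms. commutes_at \<tau> k \<and> commutes_at \<tau> (\<sigma> k)} \<le> card (\<Union>y\<in>Fix2. ?U y)"
    by (rule card_mono[rotated])
  also have "\<dots> \<le> (\<Sum>y\<in>Fix2. card (?U y))"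
    by (rule card_UN_le) simp
  also have "\<dots> \<le> (\<Sum>y\<in>Fix2. fact (card S - card {k, \<sigma> k}))"
    by (intro sum_mono card_permutes_prescribed finite_S) (use k in auto)
  also have "card {k, \<sigma> k} = 2" using k by auto
  finally show ?thesis by simp
qed

section \<open>The size bias coupling\<close>

definition make_commute :: "'a \<Rightarrow> ('a \<Rightarrow> 'a) \<Rightarrow> ('a \<Rightarrow> 'a)" where
  "make_commute k \<tau> = Transposition.transpose (\<tau> (\<sigma> k)) (\<sigma> (\<tau> k)) \<circ> \<tau>"

lemma perm_inj: "\<tau> permutes S \<Longrightarrow> \<tau> a = \<tau> b \<longleftrightarrow> a = b"
  using permutes_inj by (auto dest: injD)

lemma make_commute_permutes: "\<tau> permutes S \<Longrightarrow> k \<in> S \<Longrightarrow> make_commute k \<tau> permutes S"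
  unfolding make_commute_def by (intro permutes_compose permutes_swap_id) (auto simp: permutes_in_image)

text \<open>
  The map \<open>\<tau> \<mapsto> (make_commute k \<tau>, \<tau> (\<sigma> k))\<close> is a bijection from the permutations with \<open>\<tau> k \<notin> Fix\<close>
  onto the pairs of a permutation that commutes at \<open>k\<close> and a value \<open>a \<noteq> \<tau> k\<close>: the forgotten
  value \<open>a\<close> is all that is needed to undo the transposition. In particular \<open>make_commute k\<close> is
  \<open>(n - 1)\<close>-to-one, and turns the uniform law into the law conditioned on commuting at \<open>k\<close>.
\<close>
lemma sum_make_commute:
  assumes k: "k \<in> S - Fix"
  shows "(\<Sum>\<tau>\<in>{\<tau>\<in>perms. \<tau> k \<notin> Fix}. H (make_commute k \<tau>) (\<tau> (\<sigma> k)))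
       = (\<Sum>\<tau>\<in>{\<tau>\<in>perms. commutes_at \<tau> k}. \<Sum>a\<in>S - {\<tau> k}. H \<tau> (a :: 'a) :: real)"
proof -
  have kS: "k \<in> S" "\<sigma> k \<noteq> k" "k \<noteq> \<sigma> k" using k by (auto simp: Fix_def)
  have "(\<Sum>\<tau>\<in>{\<tau>\<in>perms. commutes_at \<tau> k}. \<Sum>a\<in>S - {\<tau> k}. H \<tau> a) =
    (\<Sum>(\<tau>, a)\<in>Sigma {\<tau>\<in>perms. commutes_at \<tau> k} (\<lambda>\<tau>. S - {\<tau> k}). H \<tau> a)"
    by (rule sum.Sigma) (auto intro: finite_subset[OF _ finite_perms])
  also have "\<dots> = (\<Sum>\<tau>\<in>{\<tau>\<in>perms. \<tau> k \<notin> Fix}. H (make_commute k \<tau>) (\<tau> (\<sigma> k)))"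
  proof (rule sum.reindex_bij_witness[where i = "\<lambda>\<tau>. (make_commute k \<tau>, \<tau> (\<sigma> k))"
        and j = "\<lambda>(\<tau>, a). Transposition.transpose a (\<tau> (\<sigma> k)) \<circ> \<tau>"])
    fix x assume "x \<in> Sigma {\<tau>\<in>perms. commutes_at \<tau> k} (\<lambda>\<tau>. S - {\<tau> k})"
    then obtain \<tau> a where x: "x = (\<tau>, a)" and t: "\<tau> permutes S" "commutes_at \<tau> k" "a \<in> S" "a \<noteq> \<tau> k" by auto
    let ?t = "Transposition.transpose a (\<tau> (\<sigma> k)) \<circ> \<tau>"
    have 1: "?t k = \<tau> k" using t kS by (simp add: Transposition.transpose_def perm_inj)
    have 2: "?t (\<sigma> k) = a" by simp
    have 3: "\<sigma> (\<tau> k) = \<tau> (\<sigma> k)" using t by (simp add: commutes_at_def)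
    have 4: "make_commute k ?t = \<tau>"
      unfolding make_commute_def using 1 2 3
      by (simp add: fun_eq_iff transpose_involutory)
    show "(case x of (\<tau>, a) \<Rightarrow> Transposition.transpose a (\<tau> (\<sigma> k)) \<circ> \<tau>) \<in> {\<tau> \<in> perms. \<tau> k \<notin> Fix}"
      using t kS 1 3 x perm_inj[OF t(1)]
      by (auto intro!: permutes_compose permutes_swap_id simp: permutes_in_image Fix_def)
    show "(make_commute k (case x of (\<tau>, a) \<Rightarrow> Transposition.transpose a (\<tau> (\<sigma> k)) \<circ> \<tau>),
             (case x of (\<tau>, a) \<Rightarrow> Transposition.transpose a (\<tau> (\<sigma> k)) \<circ> \<tau>) (\<sigma> k)) = x"
      using 4 x by simp
    show "H (make_commute k (case x of (\<tau>, a) \<Rightarrow> Transposition.transpose a (\<tau> (\<sigma> k)) \<circ> \<tau>))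
          ((case x of (\<tau>, a) \<Rightarrow> Transposition.transpose a (\<tau> (\<sigma> k)) \<circ> \<tau>) (\<sigma> k)) = (case x of (\<tau>, a) \<Rightarrow> H \<tau> a)"
      using 4 x by simp
  next
    fix \<tau> assume "\<tau> \<in> {\<tau> \<in> perms. \<tau> k \<notin> Fix}"
    then have t: "\<tau> permutes S" "\<sigma> (\<tau> k) \<noteq> \<tau> k" using kS by (auto simp: Fix_def permutes_in_image)
    have fk: "make_commute k \<tau> k = \<tau> k"
      using t kS by (auto simp: make_commute_def Transposition.transpose_def perm_inj)
    have fsk: "make_commute k \<tau> (\<sigma> k) = \<sigma> (\<tau> k)" by (simp add: make_commute_def)
    show "(case (make_commute k \<tau>, \<tau> (\<sigma> k)) of (\<tau>, a) \<Rightarrow> Transposition.transpose a (\<tau> (\<sigma> k)) \<circ> \<tau>) = \<tau>"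
      using fsk by (simp add: make_commute_def fun_eq_iff transpose_involutory)
    show "(make_commute k \<tau>, \<tau> (\<sigma> k)) \<in> Sigma {\<tau>\<in>perms. commutes_at \<tau> k} (\<lambda>\<tau>. S - {\<tau> k})"
      using t kS fk fsk by (auto simp: commutes_at_def make_commute_permutes permutes_in_image perm_inj)
  qed
  finally show ?thesis by simp
qed

text \<open>
  The transposition changes \<open>\<tau>\<close> at the two points \<open>\<sigma> k\<close> and \<open>partner k \<tau>\<close> only. As commuting at \<open>x\<close>
  depends on the values at \<open>x\<close> and \<open>\<sigma> x\<close>, it can change at four points only.
\<close>
definition partner :: "'a \<Rightarrow> ('a \<Rightarrow> 'a) \<Rightarrow> 'a" where
  "partner k \<tau> = inv \<tau> (\<sigma> (\<tau> k))"

lemma tau_partner: "\<tau> permutes S \<Longrightarrow> \<tau> (partner k \<tau>) = \<sigma> (\<tau> k)"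
  by (simp add: partner_def permutes_inverses)

lemma sigma_inv: "\<sigma> (inv \<sigma> x) = x" "inv \<sigma> (\<sigma> x) = x"
  by (simp_all add: permutes_inverses[OF \<sigma>])

lemma commutes_at_make_commute_iff:
  assumes "\<tau> permutes S" "x \<notin> {k, \<sigma> k, partner k \<tau>, inv \<sigma> (partner k \<tau>)}"
  shows "commutes_at (make_commute k \<tau>) x \<longleftrightarrow> commutes_at \<tau> x"
proof -
  have *: "make_commute k \<tau> y = \<tau> y" if "y \<noteq> \<sigma> k" "y \<noteq> partner k \<tau>" for y
    using that assms(1) tau_partner[OF assms(1), of k]
    by (auto simp: make_commute_def Transposition.transpose_def perm_inj)
       (metis perm_inj)
  have "\<sigma> x \<noteq> \<sigma> k" "\<sigma> x \<noteq> partner k \<tau>"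
    using assms sigma_inv(2) by (auto, metis)
  with assms * show ?thesis by (simp add: commutes_at_def)
qed

lemma num_commuting_make_commute_le:
  assumes "\<tau> permutes S"
  shows "num_commuting (make_commute k \<tau>) \<le> num_commuting \<tau> + 4"
proof -
  let ?Z = "{k, \<sigma> k, partner k \<tau>, inv \<sigma> (partner k \<tau>)}"
  have "commuting (make_commute k \<tau>) \<subseteq> commuting \<tau> \<union> ?Z"
    using commutes_at_make_commute_iff[OF assms, of _ k] by (auto simp: commuting_def)
  then have "num_commuting (make_commute k \<tau>) \<le> card (commuting \<tau> \<union> ?Z)"
    unfolding num_commuting_def by (rule card_mono[rotated]) simp
  also have "\<dots> \<le> card (commuting \<tau>) + card ?Z" by (rule card_Un_le)
  also have "card ?Z \<le> 4" by (simp add: card_insert_if)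
  finally show ?thesis by (simp add: num_commuting_def)
qed

lemma make_commute_at:
  assumes "\<tau> permutes S" "k \<in> S - Fix" "\<tau> k \<notin> Fix"
  shows "make_commute k \<tau> k = \<tau> k" "make_commute k \<tau> (\<sigma> k) = \<sigma> (\<tau> k)" "commutes_at (make_commute k \<tau>) k"
    "make_commute k \<tau> (partner k \<tau>) = \<tau> (\<sigma> k)"
proof -
  have "k \<noteq> \<sigma> k" "\<sigma> (\<tau> k) \<noteq> \<tau> k" using assms by (auto simp: Fix_def permutes_in_image)
  then show 1: "make_commute k \<tau> k = \<tau> k"
    using assms by (auto simp: make_commute_def Transposition.transpose_def perm_inj)
  show 2: "make_commute k \<tau> (\<sigma> k) = \<sigma> (\<tau> k)" by (simp add: make_commute_def)
  show "commutes_at (make_commute k \<tau>) k" using 1 2 by (simp add: commutes_at_def)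
  show "make_commute k \<tau> (partner k \<tau>) = \<tau> (\<sigma> k)"
    using assms tau_partner[of \<tau> k] by (simp add: make_commute_def)
qed

text \<open>
  If none of the four affected points was commuting before and none except \<open>k\<close> is afterwards, the
  coupling adds exactly the point \<open>k\<close>.
\<close>
lemma num_commuting_make_commute_Suc_aux:
  assumes "\<tau> permutes S" "k \<in> S - Fix" "\<tau> k \<notin> Fix"
    and "\<not> commutes_at \<tau> k" "\<not> commutes_at \<tau> (\<sigma> k)" "\<not> commutes_at \<tau> (partner k \<tau>)" "\<not> commutes_at \<tau> (inv \<sigma> (partner k \<tau>))"
    and "\<not> commutes_at (make_commute k \<tau>) (\<sigma> k)" "\<not> commutes_at (make_commute k \<tau>) (partner k \<tau>)"
        "\<not> commutes_at (make_commute k \<tau>) (inv \<sigma> (partner k \<tau>))"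
  shows "num_commuting (make_commute k \<tau>) = num_commuting \<tau> + 1"
proof -
  have "commutes_at (make_commute k \<tau>) x \<longleftrightarrow> x = k \<or> commutes_at \<tau> x" for x
    using commutes_at_make_commute_iff[of \<tau> x k] assms make_commute_at(3)[of \<tau> k] by blast
  then have "commuting (make_commute k \<tau>) = insert k (commuting \<tau>)"
    using assms(2) by (auto simp: commuting_def)
  moreover have "k \<notin> commuting \<tau>" using assms by (simp add: commuting_def)
  ultimately show ?thesis by (simp add: num_commuting_def)
qed

end

section \<open>The exceptional events of the coupling\<close>

text \<open>
  The bounds on short cycles hold when \<open>\<sigma>\<close> has at most \<open>sqrt n\<close> cycles. They keep the mean of
  \<open>num_commuting\<close> and its second factorial moment bounded by absolute constants.
\<close>
locale few_fixed_points = finite_perm +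
  assumes card_S: "card S \<ge> 3"
    and card_Fix: "(card Fix)\<^sup>2 \<le> card S"
    and card_Fix2: "(card Fix2)\<^sup>2 \<le> 4 * card S"
begin

abbreviation n where "n \<equiv> card S"

lemma S_nonempty: "S \<noteq> {}"
proof
  assume "S = {}"
  with card_S show False by simp
qed

lemma fact_n:
  "fact (n - Suc 0) = (fact n :: real) / n"
  "fact (n - 2) = (fact n :: real) / (n * (n - 1))"
  "fact (n - 3) = (fact n :: real) / (n * (n - 1) * (n - 2))"
proof -
  have pos: "0 < n" "0 < n - 1" "0 < n - 2" using card_S by linarith+
  have 1: "(fact n :: real) = n * fact (n - Suc 0)"
    using fact_reduce[OF pos(1), where 'a = real] by simp
  have 2: "(fact (n - Suc 0) :: real) = (n - 1) * fact (n - 2)"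
    using fact_reduce[OF pos(2), where 'a = real] by (simp add: numeral_2_eq_2)
  have 3: "(fact (n - 2) :: real) = (n - 2) * fact (n - 3)"
    using fact_reduce[OF pos(3), where 'a = real] by (simp add: numeral_2_eq_2 numeral_3_eq_3)
  show "fact (n - Suc 0) = (fact n :: real) / n"
    using card_S S_nonempty by (subst 1) auto
  show "fact (n - 2) = (fact n :: real) / (n * (n - 1))"
    using pos S_nonempty by (simp add: 1 2)
  show "fact (n - 3) = (fact n :: real) / (n * (n - 1) * (n - 2))"
    using pos S_nonempty by (simp add: 1 2 3)
qed

lemma card_Fix_le: "real (card Fix) * real (card Fix) \<le> n" "real (card Fix2) * real (card Fix2) \<le> 4 * n"
  using card_Fix card_Fix2 by (simp_all add: power2_eq_square flip: of_nat_mult of_nat_le_iff)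

lemma sum_num_commuting_le: "(\<Sum>\<tau>\<in>perms. real (num_commuting \<tau>)) \<le> 3 * fact n"
proof -
  have "(\<Sum>\<tau>\<in>perms. real (num_commuting \<tau>)) = (\<Sum>k\<in>S. real (card {\<tau>\<in>perms. commutes_at \<tau> k}))"
    using sum_num_commuting_swap[of "\<lambda>_. 1"] by simp
  also have "\<dots> = (\<Sum>k\<in>Fix. real (card {\<tau>\<in>perms. commutes_at \<tau> k})) + (\<Sum>k\<in>S-Fix. real (card {\<tau>\<in>perms. commutes_at \<tau> k}))"
    using Fix_sub by (subst sum.subset_diff[of Fix S]) auto
  also have "\<dots> \<le> (\<Sum>k\<in>Fix. card Fix * fact (n - 1)) + (\<Sum>k\<in>S-Fix. n * fact (n - 2))"
    unfolding of_nat_add of_nat_sum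
    by (intro add_mono sum_mono of_nat_mono card_commutes_at_Fix card_commutes_at_nonFix)
  also have "\<dots> \<le> real (card Fix) * real (card Fix) * fact (n - 1) + real n * (real n * fact (n - 2))"
    using card_mono[of S "S - Fix"] by (auto intro!: mult_right_mono)
  also have "\<dots> \<le> real n * fact (n - 1) + real n * (real n * fact (n - 2))"
    by (intro add_mono mult_right_mono card_Fix_le) auto
  also have "\<dots> = fact n * (1 + n / (n - 1))"
    using card_S S_nonempty by (simp add: fact_n field_simps)
  also have "\<dots> \<le> fact n * 3"
    using card_S by (intro mult_left_mono) (auto simp: field_simps)
  finally show ?thesis by simp
qed

text \<open>
  A bound for the second factorial moment. It follows from the coupling itself: conditioning on one
  commuting point \<open>k\<close> amounts to replacing \<open>\<tau>\<close> by \<open>make_commute k \<tau>\<close>, which adds at most four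
  commuting points.
\<close>
lemma sum_excess_le:
  "(\<Sum>k\<in>S-Fix. \<Sum>\<tau>\<in>{\<tau>\<in>perms. commutes_at \<tau> k}. real (num_commuting \<tau> - 1)) \<le> 12 * fact n"
proof -
  have "(n - 1) * (\<Sum>k\<in>S-Fix. \<Sum>\<tau>\<in>{\<tau>\<in>perms. commutes_at \<tau> k}. real (num_commuting \<tau> - 1))
      = (\<Sum>k\<in>S-Fix. \<Sum>\<tau>\<in>{\<tau>\<in>perms. commutes_at \<tau> k}. \<Sum>a\<in>S - {\<tau> k}. real (num_commuting \<tau> - 1))"
    by (auto simp: sum_distrib_left permutes_in_image intro!: sum.cong)
  also have "\<dots> = (\<Sum>k\<in>S-Fix. \<Sum>\<tau>\<in>{\<tau>\<in>perms. \<tau> k \<notin> Fix}. real (num_commuting (make_commute k \<tau>) - 1))"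
    by (intro sum.cong refl sum_make_commute[symmetric])
  also have "\<dots> \<le> (\<Sum>k\<in>S-Fix. \<Sum>\<tau>\<in>{\<tau>\<in>perms. \<tau> k \<notin> Fix}. real (num_commuting \<tau>) + 3)"
  proof (intro sum_mono)
    fix k \<tau> assume "\<tau> \<in> {\<tau>\<in>perms. \<tau> k \<notin> Fix}"
    then show "real (num_commuting (make_commute k \<tau>) - 1) \<le> real (num_commuting \<tau>) + 3"
      using num_commuting_make_commute_le[of \<tau> k] by auto
  qed
  also have "\<dots> \<le> (\<Sum>k\<in>S. \<Sum>\<tau>\<in>perms. real (num_commuting \<tau>) + 3)"
    by (rule order_trans[OF sum_mono sum_mono2])
       (auto intro!: sum_mono2 sum_nonneg finite_perms)
  also have "\<dots> = real n * ((\<Sum>\<tau>\<in>perms. real (num_commuting \<tau>)) + 3 * fact n)"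
    by (simp add: sum.distrib card_perms)
  also have "\<dots> \<le> real n * (3 * fact n + 3 * fact n)"
    by (intro mult_left_mono add_mono sum_num_commuting_le) auto
  also have "\<dots> \<le> (n - 1) * (12 * fact n)"
    using card_S by (simp add: field_simps)
  finally show ?thesis using card_S by (simp only: of_nat_mult) (simp add: mult_le_cancel_left)
qed

lemma sum_commutes_at_two_le:
  "(n - 1) * (\<Sum>k\<in>S-Fix. real (card {\<tau>\<in>perms. commutes_at \<tau> k \<and> commutes_at \<tau> (\<sigma> k)})) \<le> 7 * fact n"
proof -
  let ?c = "\<lambda>k. card {\<tau>\<in>perms. commutes_at \<tau> k \<and> commutes_at \<tau> (\<sigma> k)}"
  have eq: "S - Fix = (S - Fix2) \<union> (Fix2 - Fix)" using Fix_sub by auto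
  have "(\<Sum>k\<in>S-Fix. real (?c k)) = (\<Sum>k\<in>S-Fix2. real (?c k)) + (\<Sum>k\<in>Fix2-Fix. real (?c k))"
    unfolding eq by (rule sum.union_disjoint) auto
  also have "\<dots> \<le> (\<Sum>k\<in>S-Fix2. n * fact (n - 3)) + (\<Sum>k\<in>Fix2-Fix. card Fix2 * fact (n - 2))"
    unfolding of_nat_add of_nat_sum
    by (intro add_mono sum_mono of_nat_mono card_commutes_at_two_nonFix2 card_commutes_at_two_Fix2)
  also have "\<dots> \<le> real n * (real n * fact (n - 3)) + real (card Fix2) * (real (card Fix2) * fact (n - 2))"
    using card_mono[of S "S - Fix2"] card_mono[of Fix2 "Fix2 - Fix"]
    by (auto intro!: mult_right_mono add_mono)
  also have "\<dots> = real n * (real n * fact (n - 3)) + real (card Fix2) * real (card Fix2) * fact (n - 2)"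
    by (simp add: mult.assoc)
  also have "\<dots> \<le> real n * (real n * fact (n - 3)) + 4 * real n * fact (n - 2)"
    by (intro add_mono mult_right_mono order_trans[OF card_Fix_le(2)]) auto
  finally have "(n - 1) * (\<Sum>k\<in>S-Fix. real (?c k))
      \<le> (n - 1) * (real n * (real n * fact (n - 3)) + 4 * real n * fact (n - 2))"
    by (intro mult_left_mono) auto
  also have "\<dots> = fact n * (n / (n - 2) + 4)"
  proof -
    have "(x - 1) * (x * (x * (F / (x * (x - 1) * (x - 2)))) + 4 * x * (F / (x * (x - 1)))) = F * (x / (x - 2) + 4)"
      if "x \<ge> 3" for x F :: real
    proof -
      have "x \<noteq> 0" "x - 1 \<noteq> 0" "x - 2 \<noteq> 0" using that by auto
      then show ?thesis by (simp add: divide_simps) (simp add: algebra_simps)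
    qed
    from this[of "real n" "fact n"] show ?thesis using card_S by (simp add: fact_n of_nat_diff)
  qed
  also have "\<dots> \<le> fact n * 7"
    using card_S by (intro mult_left_mono) (auto simp: field_simps)
  finally show ?thesis by simp
qed

lemma card_le_card_Collect_inj:
  assumes "inj_on f S" "f ` S \<subseteq> S" "finite B" "\<And>k. k \<in> B \<Longrightarrow> k \<in> S \<and> P (f k)"
  shows "card B \<le> card {k \<in> S. P k}"
proof -
  have "card B = card (f ` B)"
    using assms(1,4) by (intro card_image[symmetric]) (auto simp: inj_on_def)
  also have "\<dots> \<le> card {k \<in> S. P k}"
    using assms by (intro card_mono) auto
  finally show ?thesis .
qed

lemma partner_in: "\<tau> permutes S \<Longrightarrow> k \<in> S \<Longrightarrow> partner k \<tau> \<in> S"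
  by (simp add: partner_def permutes_in_image permutes_inv)

lemma sigma_inv_in: "inv \<sigma> x \<in> S \<longleftrightarrow> x \<in> S"
  by (simp add: permutes_in_image[OF permutes_inv[OF \<sigma>]])

text \<open>
  Each of the four conditions says that \<open>\<tau>\<close> commutes at the image of \<open>k\<close> under a bijection, so that
  each holds for \<open>num_commuting \<tau>\<close> many \<open>k\<close>.
\<close>
definition bad_before where
  "bad_before k \<tau> \<longleftrightarrow> commutes_at \<tau> k \<or> commutes_at \<tau> (\<sigma> k) \<or> commutes_at \<tau> (partner k \<tau>) \<or> commutes_at \<tau> (inv \<sigma> (partner k \<tau>))"

lemma inj_partner: "\<tau> permutes S \<Longrightarrow> partner a \<tau> = partner b \<tau> \<longleftrightarrow> a = b"
  by (metis tau_partner perm_inj \<sigma>_eq)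

lemma card_bad_before:
  assumes t: "\<tau> permutes S"
  shows "card {k\<in>S. bad_before k \<tau>} \<le> 4 * num_commuting \<tau>"
proof -
  have 1: "card {k\<in>S. commutes_at \<tau> (\<sigma> k)} \<le> num_commuting \<tau>"
    unfolding num_commuting_def commuting_def
    by (rule card_le_card_Collect_inj[where f = \<sigma>]) (auto simp: inj_on_def)
  have 2: "card {k\<in>S. commutes_at \<tau> (partner k \<tau>)} \<le> num_commuting \<tau>"
    unfolding num_commuting_def commuting_def
    by (rule card_le_card_Collect_inj[where f = "\<lambda>k. partner k \<tau>"]) (auto simp: inj_on_def partner_in inj_partner t)
  have 3: "card {k\<in>S. commutes_at \<tau> (inv \<sigma> (partner k \<tau>))} \<le> num_commuting \<tau>"
    unfolding num_commuting_def commuting_def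
  proof (rule card_le_card_Collect_inj[where f = "\<lambda>k. inv \<sigma> (partner k \<tau>)"])
    show "inj_on (\<lambda>k. inv \<sigma> (partner k \<tau>)) S"
      by (rule inj_onI) (metis sigma_inv(1) inj_partner[OF t])
  qed (auto simp: partner_in sigma_inv_in t)
  let ?A = "{k\<in>S. commutes_at \<tau> k}" and ?B = "{k\<in>S. commutes_at \<tau> (\<sigma> k)}"
    and ?C = "{k\<in>S. commutes_at \<tau> (partner k \<tau>)}" and ?D = "{k\<in>S. commutes_at \<tau> (inv \<sigma> (partner k \<tau>))}"
  have e: "{k\<in>S. bad_before k \<tau>} = (?A \<union> ?B) \<union> (?C \<union> ?D)"
    by (auto simp: bad_before_def)
  have "card ((?A \<union> ?B) \<union> (?C \<union> ?D)) \<le> (card ?A + card ?B) + (card ?C + card ?D)"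
    by (intro order_trans[OF card_Un_le] add_mono card_Un_le)
  moreover have "card ?A \<le> num_commuting \<tau>" by (simp add: num_commuting_def commuting_def)
  ultimately show ?thesis unfolding e using 1 2 3 by linarith
qed

text \<open>
  The undesired commuting points after the coupling, in terms of the coupled permutation \<open>\<tau>\<close> and the
  forgotten value \<open>a\<close>; then \<open>inv \<tau> a\<close> is the partner. The condition \<open>a \<noteq> \<tau> (\<sigma> k)\<close> says that the
  transposition was not trivial; in the trivial case \<open>bad_before\<close> holds already.
\<close>
definition bad_after where
  "bad_after k \<tau> a \<longleftrightarrow> commutes_at \<tau> (\<sigma> k) \<or>
     (a \<noteq> \<tau> (\<sigma> k) \<and> (commutes_at \<tau> (inv \<tau> a) \<or> commutes_at \<tau> (inv \<sigma> (inv \<tau> a))))"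

lemma num_commuting_make_commute_Suc:
  assumes "\<tau> permutes S" "k \<in> S - Fix" "\<tau> k \<notin> Fix"
    and "\<not> bad_before k \<tau>" "\<not> bad_after k (make_commute k \<tau>) (\<tau> (\<sigma> k))"
  shows "num_commuting (make_commute k \<tau>) = num_commuting \<tau> + 1"
proof -
  have kS: "k \<in> S" using assms by auto
  have f: "make_commute k \<tau> permutes S" by (rule make_commute_permutes) (use assms kS in auto)
  have "inv (make_commute k \<tau>) (\<tau> (\<sigma> k)) = partner k \<tau>"
    using make_commute_at(4)[OF assms(1-3)] permutes_inv_eq[OF f] by auto
  moreover have "\<tau> (\<sigma> k) \<noteq> make_commute k \<tau> (\<sigma> k)"
    using assms(4) make_commute_at(2)[OF assms(1-3)] by (auto simp: bad_before_def commutes_at_def)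
  ultimately show ?thesis
    using assms by (intro num_commuting_make_commute_Suc_aux) (auto simp: bad_before_def bad_after_def)
qed

text \<open>
  As \<open>a\<close> varies, \<open>inv \<tau> a\<close> and its preimage under \<open>\<sigma>\<close> run through distinct points different from \<open>k\<close>, so
  each of the last two conditions picks a commuting point of \<open>\<tau>\<close> other than \<open>k\<close>.
\<close>
lemma card_bad_after:
  assumes t: "\<tau> permutes S" and k: "k \<in> S" and c: "commutes_at \<tau> k"
  shows "card {a\<in>S - {\<tau> k}. bad_after k \<tau> a} \<le> (if commutes_at \<tau> (\<sigma> k) then n - 1 else 0) + 2 * (num_commuting \<tau> - 1)"
proof (cases "commutes_at \<tau> (\<sigma> k)")
  case True
  have "card {a\<in>S - {\<tau> k}. bad_after k \<tau> a} \<le> card (S - {\<tau> k})"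
    by (intro card_mono) auto
  also have "\<dots> = n - 1" using t k by (simp add: permutes_in_image)
  finally show ?thesis using True by simp
next
  case False
  let ?E = "commuting \<tau> - {k}"
  let ?A = "{a\<in>S - {\<tau> k}. a \<noteq> \<tau> (\<sigma> k) \<and> commutes_at \<tau> (inv \<tau> a)}"
  let ?B = "{a\<in>S - {\<tau> k}. a \<noteq> \<tau> (\<sigma> k) \<and> commutes_at \<tau> (inv \<sigma> (inv \<tau> a))}"
  note ti = permutes_inverses[OF t]
  have ti': "inv \<tau> x \<in> S \<longleftrightarrow> x \<in> S" for x using permutes_in_image[OF permutes_inv[OF t]] .
  have cE: "card ?E = num_commuting \<tau> - 1"
    using k c by (simp add: num_commuting_def commuting_def)
  have "card ?A \<le> card ?E"
  proof (rule card_inj_on_le)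
    show "inj_on (inv \<tau>) ?A" by (rule inj_onI) (metis ti(1))
    show "inv \<tau> ` ?A \<subseteq> ?E" using ti' ti by (auto simp: commuting_def)
  qed simp
  moreover have "card ?B \<le> card ?E"
  proof (rule card_inj_on_le)
    show "inj_on (\<lambda>a. inv \<sigma> (inv \<tau> a)) ?B" by (rule inj_onI) (metis ti(1) sigma_inv(1))
    have "a = \<tau> (\<sigma> k)" if "inv \<sigma> (inv \<tau> a) = k" for a using that by (metis ti(1) sigma_inv(1))
    then show "(\<lambda>a. inv \<sigma> (inv \<tau> a)) ` ?B \<subseteq> ?E" using ti' sigma_inv_in by (auto simp: commuting_def)
  qed simp
  moreover have "{a\<in>S - {\<tau> k}. bad_after k \<tau> a} = ?A \<union> ?B"
    using False by (auto simp: bad_after_def)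
  moreover have "card (?A \<union> ?B) \<le> card ?A + card ?B" by (rule card_Un_le)
  ultimately show ?thesis using False cE by simp
qed

lemma sum_bad_after_le:
  "(\<Sum>k\<in>S-Fix. \<Sum>\<tau>\<in>{\<tau>\<in>perms. \<tau> k \<notin> Fix}. of_bool (bad_after k (make_commute k \<tau>) (\<tau> (\<sigma> k)))) \<le> (31 * fact n :: real)"
proof -
  have "(\<Sum>k\<in>S-Fix. \<Sum>\<tau>\<in>{\<tau>\<in>perms. \<tau> k \<notin> Fix}. of_bool (bad_after k (make_commute k \<tau>) (\<tau> (\<sigma> k))))
     = (\<Sum>k\<in>S-Fix. \<Sum>\<tau>\<in>{\<tau>\<in>perms. commutes_at \<tau> k}. \<Sum>a\<in>S - {\<tau> k}. of_bool (bad_after k \<tau> a) :: real)"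
  proof (rule sum.cong[OF refl])
    fix k assume "k \<in> S - Fix"
    then show "(\<Sum>\<tau>\<in>{\<tau>\<in>perms. \<tau> k \<notin> Fix}. of_bool (bad_after k (make_commute k \<tau>) (\<tau> (\<sigma> k))))
      = (\<Sum>\<tau>\<in>{\<tau>\<in>perms. commutes_at \<tau> k}. \<Sum>a\<in>S - {\<tau> k}. of_bool (bad_after k \<tau> a) :: real)"
      by (rule sum_make_commute[where H = "\<lambda>t a. of_bool (bad_after k t a)"])
  qed
  also have "\<dots> = (\<Sum>k\<in>S-Fix. \<Sum>\<tau>\<in>{\<tau>\<in>perms. commutes_at \<tau> k}. real (card {a\<in>S - {\<tau> k}. bad_after k \<tau> a}))"
    by (intro sum.cong refl) (simp add: of_bool_def sum_if_one_zero)
  also have "\<dots> \<le> (\<Sum>k\<in>S-Fix. \<Sum>\<tau>\<in>{\<tau>\<in>perms. commutes_at \<tau> k}.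
      real (n - 1) * of_bool (commutes_at \<tau> (\<sigma> k)) + 2 * real (num_commuting \<tau> - 1))"
  proof (intro sum_mono)
    fix k \<tau> assume "k \<in> S - Fix" "\<tau> \<in> {\<tau>\<in>perms. commutes_at \<tau> k}"
    then have "card {a\<in>S - {\<tau> k}. bad_after k \<tau> a} \<le> (if commutes_at \<tau> (\<sigma> k) then n - 1 else 0) + 2 * (num_commuting \<tau> - 1)"
      by (intro card_bad_after) auto
    then have "real (card {a\<in>S - {\<tau> k}. bad_after k \<tau> a})
        \<le> real ((if commutes_at \<tau> (\<sigma> k) then n - 1 else 0) + 2 * (num_commuting \<tau> - 1))"
      by (simp only: of_nat_le_iff)
    then show "real (card {a\<in>S - {\<tau> k}. bad_after k \<tau> a})
        \<le> real (n - 1) * of_bool (commutes_at \<tau> (\<sigma> k)) + 2 * real (num_commuting \<tau> - 1)"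
      by (auto split: if_splits)
  qed
  also have "\<dots> = (n - 1) * (\<Sum>k\<in>S-Fix. real (card {\<tau>\<in>perms. commutes_at \<tau> k \<and> commutes_at \<tau> (\<sigma> k)}))
      + 2 * (\<Sum>k\<in>S-Fix. \<Sum>\<tau>\<in>{\<tau>\<in>perms. commutes_at \<tau> k}. real (num_commuting \<tau> - 1))"
    by (simp add: sum.distrib sum_distrib_left[symmetric] of_bool_def sum_if_one_zero finite_perms conj_assoc)
  also have "\<dots> \<le> 7 * fact n + 2 * (12 * fact n)"
    by (intro add_mono mult_left_mono sum_commutes_at_two_le sum_excess_le) auto
  finally show ?thesis by simp
qed

text \<open>
  Replacing \<open>make_commute k \<tau>\<close> by \<open>num_commuting \<tau> + 1\<close> inside \<open>g\<close>, and all pairs \<open>(k, \<tau>)\<close> for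
  those that avoid fixed points, costs at most one for each pair at which the coupling is
  unavailable or exceptional.
\<close>
lemma size_bias_estimate:
  fixes g :: "nat \<Rightarrow> real"
  assumes g: "\<And>j. 0 \<le> g j" "\<And>j. g j \<le> 1"
  shows "\<bar>(\<Sum>k\<in>S-Fix. \<Sum>\<tau>\<in>{\<tau>\<in>perms. \<tau> k \<notin> Fix}. g (num_commuting (make_commute k \<tau>)))
       - n * (\<Sum>\<tau>\<in>perms. g (num_commuting \<tau> + 1))\<bar> \<le> real (2 * card Fix + 43) * fact n"
proof -
  let ?out = "\<lambda>k \<tau>. k \<in> Fix \<or> \<tau> k \<in> Fix"
  let ?h = "\<lambda>k \<tau>. if ?out k \<tau> then 0 else g (num_commuting (make_commute k \<tau>))"
  let ?bb = "\<lambda>k \<tau>. of_bool (bad_before k \<tau>) :: real"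
  let ?ba = "\<lambda>k \<tau>. if ?out k \<tau> then 0 else of_bool (bad_after k (make_commute k \<tau>) (\<tau> (\<sigma> k))) :: real"
  have restr: "(\<Sum>k\<in>S-Fix. \<Sum>\<tau>\<in>{\<tau>\<in>perms. \<tau> k \<notin> Fix}. H k \<tau>)
      = (\<Sum>k\<in>S. \<Sum>\<tau>\<in>perms. if ?out k \<tau> then 0 else H k \<tau>)" for H :: "'a \<Rightarrow> ('a \<Rightarrow> 'a) \<Rightarrow> real"
  proof -
    have "(\<Sum>k\<in>S. \<Sum>\<tau>\<in>perms. if ?out k \<tau> then 0 else H k \<tau>)
        = (\<Sum>k\<in>S-Fix. \<Sum>\<tau>\<in>perms. if ?out k \<tau> then 0 else H k \<tau>)"
      by (rule sum.mono_neutral_right) auto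
    also have "\<dots> = (\<Sum>k\<in>S-Fix. \<Sum>\<tau>\<in>{\<tau>\<in>perms. \<tau> k \<notin> Fix}. H k \<tau>)"
    proof (rule sum.cong[OF refl])
      fix k assume "k \<in> S - Fix"
      then have "(\<Sum>\<tau>\<in>perms. if ?out k \<tau> then 0 else H k \<tau>) = (\<Sum>\<tau>\<in>perms. if \<tau> k \<notin> Fix then H k \<tau> else 0)"
        by (intro sum.cong) auto
      also have "\<dots> = (\<Sum>\<tau>\<in>{\<tau>\<in>perms. \<tau> k \<notin> Fix}. H k \<tau>)"
        by (rule sum.inter_filter[OF finite_perms, symmetric])
      finally show "(\<Sum>\<tau>\<in>perms. if ?out k \<tau> then 0 else H k \<tau>) = (\<Sum>\<tau>\<in>{\<tau>\<in>perms. \<tau> k \<notin> Fix}. H k \<tau>)" .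
    qed
    finally show ?thesis by simp
  qed
  have eq: "(\<Sum>k\<in>S-Fix. \<Sum>\<tau>\<in>{\<tau>\<in>perms. \<tau> k \<notin> Fix}. g (num_commuting (make_commute k \<tau>)))
       - n * (\<Sum>\<tau>\<in>perms. g (num_commuting \<tau> + 1))
     = (\<Sum>k\<in>S. \<Sum>\<tau>\<in>perms. ?h k \<tau> - g (num_commuting \<tau> + 1))"
    unfolding restr by (simp add: sum_subtractf)
  have "\<bar>(\<Sum>k\<in>S. \<Sum>\<tau>\<in>perms. ?h k \<tau> - g (num_commuting \<tau> + 1))\<bar> \<le> (\<Sum>k\<in>S. \<Sum>\<tau>\<in>perms. \<bar>?h k \<tau> - g (num_commuting \<tau> + 1)\<bar>)"
    by (rule order_trans[OF sum_abs sum_mono[OF sum_abs]])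
  also have "\<dots> \<le> (\<Sum>k\<in>S. \<Sum>\<tau>\<in>perms. of_bool (k \<in> Fix) + of_bool (\<tau> k \<in> Fix) + ?bb k \<tau> + ?ba k \<tau>)"
  proof (intro sum_mono)
    fix k \<tau> assume kt: "k \<in> S" "\<tau> \<in> perms"
    have b: "\<bar>g i - g j\<bar> \<le> 1" for i j using g(1)[of i] g(1)[of j] g(2)[of i] g(2)[of j] by linarith
    show "\<bar>?h k \<tau> - g (num_commuting \<tau> + 1)\<bar> \<le> of_bool (k \<in> Fix) + of_bool (\<tau> k \<in> Fix) + ?bb k \<tau> + ?ba k \<tau>"
    proof (cases "?out k \<tau>")
      case True
      then show ?thesis using g[of "num_commuting \<tau> + 1"] by auto
    next
      case False
      then show ?thesis
        using num_commuting_make_commute_Suc[of \<tau> k] kt b[of "num_commuting (make_commute k \<tau>)" "num_commuting \<tau> + 1"]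
        by (cases "bad_before k \<tau>"; cases "bad_after k (make_commute k \<tau>) (\<tau> (\<sigma> k))") auto
    qed
  qed
  also have "\<dots> = (\<Sum>k\<in>S. \<Sum>\<tau>\<in>perms. of_bool (k \<in> Fix)) + (\<Sum>k\<in>S. \<Sum>\<tau>\<in>perms. of_bool (\<tau> k \<in> Fix))
      + (\<Sum>k\<in>S. \<Sum>\<tau>\<in>perms. ?bb k \<tau>) + (\<Sum>k\<in>S. \<Sum>\<tau>\<in>perms. ?ba k \<tau>)"
    by (simp add: sum.distrib)
  also have "\<dots> \<le> real (card Fix) * fact n + real (card Fix) * fact n + 12 * fact n + 31 * fact n"
  proof (intro add_mono)
    show "(\<Sum>k\<in>S. \<Sum>\<tau>\<in>perms. of_bool (k \<in> Fix)) \<le> real (card Fix) * fact n"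
    proof -
      have "S \<inter> Fix = Fix" using Fix_sub by auto
      then have "real (card Fix) * fact n = (\<Sum>k\<in>S. if k \<in> Fix then fact n else 0)"
        by (simp add: sum.If_cases)
      also have "\<dots> = (\<Sum>k\<in>S. \<Sum>\<tau>\<in>perms. of_bool (k \<in> Fix))"
        by (intro sum.cong refl) (simp add: card_perms)
      finally show ?thesis by simp
    qed
    have "(\<Sum>k\<in>S. \<Sum>\<tau>\<in>perms. of_bool (\<tau> k \<in> Fix)) = (\<Sum>k\<in>S. real (card {\<tau>\<in>perms. \<tau> k \<in> Fix}))"
      by (simp add: of_bool_def sum_if_one_zero finite_perms)
    also have "\<dots> \<le> (\<Sum>k\<in>S. card Fix * fact (n - 1))"
      unfolding of_nat_sum using Fix_sub by (intro sum_mono of_nat_mono card_image_in) auto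
    also have "\<dots> = real (card Fix) * fact n" using card_S S_nonempty by (simp add: fact_n)
    finally show "(\<Sum>k\<in>S. \<Sum>\<tau>\<in>perms. of_bool (\<tau> k \<in> Fix)) \<le> real (card Fix) * fact n" .
    have "(\<Sum>k\<in>S. \<Sum>\<tau>\<in>perms. ?bb k \<tau>) = (\<Sum>\<tau>\<in>perms. real (card {k\<in>S. bad_before k \<tau>}))"
      by (subst sum.swap) (simp add: of_bool_def sum_if_one_zero)
    also have "\<dots> \<le> (\<Sum>\<tau>\<in>perms. 4 * real (num_commuting \<tau>))"
      using card_bad_before by (intro sum_mono) (fastforce simp flip: of_nat_le_iff)
    also have "\<dots> \<le> 4 * (3 * fact n)"
      unfolding sum_distrib_left[symmetric] by (intro mult_left_mono sum_num_commuting_le) auto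
    finally show "(\<Sum>k\<in>S. \<Sum>\<tau>\<in>perms. ?bb k \<tau>) \<le> 12 * fact n" by simp
    show "(\<Sum>k\<in>S. \<Sum>\<tau>\<in>perms. ?ba k \<tau>) \<le> 31 * fact n"
      using sum_bad_after_le unfolding restr .
  qed
  finally show ?thesis unfolding eq by (simp add: algebra_simps)
qed

end

section \<open>Poisson approximation by Stein's method\<close>

text \<open>
  The bounded solution of Stein's equation for the Poisson law with mean 1 and the indicator of
  \<open>{0}\<close>.
\<close>
definition stein :: "nat \<Rightarrow> real" where
  "stein j = (if j = 0 then 0 else fact (j - 1) * (\<Sum>i. 1 / fact (i + j)) / exp 1)"

lemma summable_inv_fact: "summable (\<lambda>i. 1 / fact (i + j) :: real)"
proof -
  have "summable (\<lambda>i. 1 / fact i :: real)"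
    using summable_exp[of "1::real"] by (simp add: field_simps)
  then show ?thesis by (subst summable_iff_shift)
qed

lemma suminf_inv_fact: "(\<Sum>i. 1 / fact i) = exp (1::real)"
  by (simp add: exp_def field_simps)

lemma suminf_inv_fact_Suc:
  "(\<Sum>i. 1 / fact (i + j)) = 1 / fact j + (\<Sum>i. 1 / fact (i + Suc j) :: real)"
  using suminf_split_head[OF summable_inv_fact[of j]] by simp

lemma stein_equation:
  "stein (j + 1) - j * stein j = of_bool (j = 0) - 1 / exp 1"
proof (cases j)
  case 0
  have "(\<Sum>i. 1 / fact (Suc i)) = exp 1 - (1::real)"
    using suminf_inv_fact_Suc[of 0] suminf_inv_fact by simp
  then show ?thesis using 0 by (simp add: stein_def diff_divide_distrib)
next
  case (Suc m)
  have "stein (j + 1) = fact j * (\<Sum>i. 1 / fact (i + Suc j)) / exp 1"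
    by (simp add: stein_def)
  moreover have "j * stein j = fact j * (\<Sum>i. 1 / fact (i + j)) / exp 1"
    using Suc by (simp add: stein_def)
  moreover have "fact j * (\<Sum>i. 1 / fact (i + j)) = 1 + fact j * (\<Sum>i. 1 / fact (i + Suc j) :: real)"
    by (subst suminf_inv_fact_Suc) (simp add: distrib_left)
  ultimately show ?thesis using Suc by (simp add: diff_divide_distrib[symmetric] add_divide_distrib)
qed

text \<open>
  The bound comes from \<open>m! * i! \<le> (m + i)!\<close>, which dominates the series termwise by that of \<open>exp 1\<close>.
\<close>
lemma stein_bounds: "0 \<le> stein j" "stein j \<le> 1"
proof -
  show "0 \<le> stein j"
    by (auto simp: stein_def intro!: divide_nonneg_nonneg mult_nonneg_nonneg suminf_nonneg summable_inv_fact)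
  show "stein j \<le> 1"
  proof (cases j)
    case 0 then show ?thesis by (simp add: stein_def)
  next
    case (Suc m)
    have "fact m * (\<Sum>i. 1 / fact (i + j)) = (\<Sum>i. fact m * (1 / fact (i + j)) :: real)"
      by (rule suminf_mult[OF summable_inv_fact, symmetric])
    also have "\<dots> \<le> (\<Sum>i. 1 / fact i)"
    proof (rule suminf_le)
      fix i
      have "(fact m * fact i :: nat) \<le> fact (m + i)"
        using dvd_imp_le[OF fact_fact_dvd_fact[of m i]] by simp
      also have "\<dots> \<le> fact (i + j)" using Suc by (intro fact_mono) auto
      finally have "real (fact m * fact i) \<le> real (fact (i + j))" by (simp only: of_nat_le_iff)
      then show "fact m * (1 / fact (i + j)) \<le> (1 / fact i :: real)"
        by (simp add: field_simps)
    qed (use summable_inv_fact[of 0] summable_mult[OF summable_inv_fact] in auto)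
    also have "\<dots> = exp 1" by (rule suminf_inv_fact)
    finally show ?thesis using Suc by (simp add: stein_def)
  qed
qed

context few_fixed_points begin

text \<open>
  Summing Stein's equation at \<open>num_commuting \<tau>\<close> over \<open>\<tau>\<close> expresses the deviation from \<open>1 / exp 1\<close>
  as the difference of the two sides of the size bias identity. The fixed points of \<open>\<sigma>\<close>, to which
  the coupling does not apply, contribute the term \<open>(card Fix)\<^sup>2 / n\<close>.
\<close>
theorem prob_no_commuting_estimate:
  "\<bar>real (card {\<tau>\<in>perms. num_commuting \<tau> = 0}) / fact n - 1 / exp 1\<bar>
     \<le> (2 * card Fix + 44) / (n - 1) + (card Fix)\<^sup>2 / n"
proof -
  let ?F = "fact n :: real"
  define Z where "Z = (\<Sum>k\<in>S-Fix. \<Sum>\<tau>\<in>{\<tau>\<in>perms. \<tau> k \<notin> Fix}. stein (num_commuting (make_commute k \<tau>)))"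
  define G where "G = (\<Sum>\<tau>\<in>perms. stein (num_commuting \<tau> + 1))"
  define A where "A = (\<Sum>k\<in>Fix. \<Sum>\<tau>\<in>{\<tau>\<in>perms. commutes_at \<tau> k}. stein (num_commuting \<tau>))"
  define B where "B = (\<Sum>k\<in>S-Fix. \<Sum>\<tau>\<in>{\<tau>\<in>perms. commutes_at \<tau> k}. stein (num_commuting \<tau>))"
  have n1: "real (n - 1) > 0" using card_S by simp
  have "(\<Sum>\<tau>\<in>perms. stein (num_commuting \<tau> + 1) - num_commuting \<tau> * stein (num_commuting \<tau>))
      = real (card {\<tau>\<in>perms. num_commuting \<tau> = 0}) - ?F / exp 1"
    unfolding stein_equation by (simp add: sum_subtractf of_bool_def sum_if_one_zero finite_perms card_perms)
  moreover have "(\<Sum>\<tau>\<in>perms. num_commuting \<tau> * stein (num_commuting \<tau>)) = A + B"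
    unfolding sum_num_commuting_swap A_def B_def using Fix_sub by (subst sum.subset_diff[of Fix S]) auto
  ultimately have main: "real (card {\<tau>\<in>perms. num_commuting \<tau> = 0}) - ?F / exp 1 = G - A - B"
    by (simp add: sum_subtractf G_def)
  have ZB: "(n - 1) * B = Z"
  proof -
    have "(n - 1) * B = (\<Sum>k\<in>S-Fix. \<Sum>\<tau>\<in>{\<tau>\<in>perms. commutes_at \<tau> k}. \<Sum>a\<in>S - {\<tau> k}. stein (num_commuting \<tau>))"
      unfolding B_def by (auto simp: sum_distrib_left permutes_in_image intro!: sum.cong)
    also have "\<dots> = Z" unfolding Z_def by (intro sum.cong refl sum_make_commute[symmetric])
    finally show ?thesis .
  qed
  have G: "0 \<le> G" "G \<le> ?F"
    unfolding G_def using stein_bounds sum_bounded_above[of perms "\<lambda>\<tau>. stein (num_commuting \<tau> + 1)" 1]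
    by (auto intro!: sum_nonneg simp: card_perms)
  have "\<bar>Z - n * G\<bar> \<le> (2 * card Fix + 43) * ?F"
    unfolding Z_def G_def by (rule size_bias_estimate) (rule stein_bounds)+
  moreover have "real n * G = (n - 1) * G + G"
    using card_S by (simp add: of_nat_diff algebra_simps)
  ultimately have "\<bar>(n - 1) * (B - G)\<bar> \<le> (2 * card Fix + 43) * ?F + ?F"
    using G ZB by (simp add: right_diff_distrib)
  then have "(n - 1) * \<bar>B - G\<bar> \<le> (2 * card Fix + 44) * ?F"
    using n1 by (simp only: abs_mult) (simp add: distrib_right)
  then have BG: "\<bar>B - G\<bar> \<le> (2 * card Fix + 44) / (n - 1) * ?F"
    using n1 by (simp add: field_simps)
  have "0 \<le> A" unfolding A_def by (intro sum_nonneg stein_bounds)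
  have "A \<le> (\<Sum>k\<in>Fix. real (card {\<tau>\<in>perms. commutes_at \<tau> k}))"
    unfolding A_def using stein_bounds(2) by (intro sum_mono order_trans[OF sum_bounded_above[where K = 1]]) auto
  also have "\<dots> \<le> (\<Sum>k\<in>Fix. card Fix * fact (n - 1))"
    unfolding of_nat_sum by (intro sum_mono of_nat_mono card_commutes_at_Fix)
  also have "\<dots> = (card Fix)\<^sup>2 / n * ?F" by (simp add: fact_n power2_eq_square)
  finally have A: "A \<le> (card Fix)\<^sup>2 / n * ?F" .
  have "\<bar>G - A - B\<bar> \<le> ((2 * card Fix + 44) / (n - 1) + (card Fix)\<^sup>2 / n) * ?F"
  proof -
    have "\<bar>G - A - B\<bar> \<le> \<bar>B - G\<bar> + A" using \<open>0 \<le> A\<close> by linarith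
    also have "\<dots> \<le> (2 * card Fix + 44) / (n - 1) * ?F + (card Fix)\<^sup>2 / n * ?F"
      by (intro add_mono BG A)
    finally show ?thesis by (simp only: distrib_right)
  qed
  moreover have "real (card {\<tau>\<in>perms. num_commuting \<tau> = 0}) / ?F - 1 / exp 1 = (G - A - B) / ?F"
    unfolding main[symmetric] by (simp add: diff_divide_distrib)
  ultimately show ?thesis
    by (simp add: pos_divide_le_eq)
qed

end

context finite_perm begin

section \<open>Permutations that commute at many points\<close>

lemma orbit_sub: "k \<in> S \<Longrightarrow> x \<in> orbit \<sigma> k \<Longrightarrow> x \<in> S"
  using permutes_orbit_subset[OF \<sigma>] by auto

definition reps :: "'a set" where
  "reps = (\<lambda>C. SOME x. x \<in> C) ` (orbit \<sigma> ` S)"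

lemma card_reps: "card reps \<le> card (orbit \<sigma> ` S)"
  unfolding reps_def by (rule card_image_le) simp

lemma permutation_sigma: "permutation \<sigma>"
  using \<sigma> finite_S permutation_permutes by blast

lemma self_in_orbit: "x \<in> orbit \<sigma> x"
  by (rule permutation_self_in_orbit[OF permutation_sigma])

lemma reps_cover: 
  assumes "x \<in> S" shows "\<exists>r\<in>reps. x \<in> orbit \<sigma> r"
proof -
  define r where "r = (SOME y. y \<in> orbit \<sigma> x)"
  have "r \<in> orbit \<sigma> x" unfolding r_def using self_in_orbit by (rule someI)
  then have "x \<in> orbit \<sigma> r" using permutation_sigma orbit_swap self_in_orbit by metis
  moreover have "r \<in> reps" using assms by (auto simp: reps_def r_def)
  ultimately show ?thesis by blast
qed

lemma reps_sub: "reps \<subseteq> S"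
proof
  fix r assume "r \<in> reps"
  then obtain x where "x \<in> S" "r = (SOME y. y \<in> orbit \<sigma> x)" by (auto simp: reps_def)
  then have "r \<in> orbit \<sigma> x" using self_in_orbit by (metis someI)
  then show "r \<in> S" using \<open>x \<in> S\<close> orbit_sub by blast
qed

text \<open>
  Follow a cycle from its representative: at each step either \<open>\<tau> (\<sigma> y) = \<sigma> (\<tau> y)\<close> determines the next
  value, or the next point is outside \<open>\<sigma> ` A\<close>.
\<close>
lemma perm_determined:
  assumes "\<tau> permutes S" "\<tau>' permutes S" "A \<subseteq> S" "\<forall>k\<in>A. commutes_at \<tau> k" "\<forall>k\<in>A. commutes_at \<tau>' k"
    and eq: "\<And>x. x \<in> reps \<union> (S - \<sigma> ` A) \<Longrightarrow> \<tau> x = \<tau>' x"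
  shows "\<tau> = \<tau>'"
proof
  have step: "\<tau> (\<sigma> y) = \<tau>' (\<sigma> y)" if "y \<in> S" "\<tau> y = \<tau>' y" for y
  proof (cases "y \<in> A")
    case True
    then show ?thesis using assms(4,5) that by (auto simp: commutes_at_def)
  next
    case False
    then have "\<sigma> y \<in> S - \<sigma> ` A" using that by auto
    then show ?thesis using eq by auto
  qed
  have orb: "y \<in> S \<and> \<tau> y = \<tau>' y" if "r \<in> reps" "y \<in> orbit \<sigma> r" for y r
    using that(2)
  proof induction
    case base
    then show ?case using step[of r] eq[of r] that(1) reps_sub by auto
  next
    case (step y)
    then show ?case using \<open>\<And>y. y \<in> S \<Longrightarrow> \<tau> y = \<tau>' y \<Longrightarrow> \<tau> (\<sigma> y) = \<tau>' (\<sigma> y)\<close> by auto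
  qed
  fix x show "\<tau> x = \<tau>' x"
  proof (cases "x \<in> S")
    case True
    then show ?thesis using reps_cover orb by blast
  next
    case False
    then show ?thesis using assms(1,2) by (simp add: permutes_def)
  qed
qed

lemma card_commuting_on:
  assumes "A \<subseteq> S"
  shows "card {\<tau>\<in>perms. \<forall>k\<in>A. commutes_at \<tau> k} \<le> card S ^ (card S - card A + card (orbit \<sigma> ` S))"
proof (cases "S = {}")
  case True
  then have "{\<tau>\<in>perms. \<forall>k\<in>A. commutes_at \<tau> k} \<subseteq> {id}" by (auto simp: permutes_empty)
  from card_mono[OF _ this] show ?thesis using True by simp
next
  case False
  let ?T = "reps \<union> (S - \<sigma> ` A)"
  have T: "?T \<subseteq> S" "finite ?T" using reps_sub by (auto intro: finite_subset[OF reps_sub])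
  have "card {\<tau>\<in>perms. \<forall>k\<in>A. commutes_at \<tau> k} \<le> card (?T \<rightarrow>\<^sub>E S)"
  proof (rule card_inj_on_le)
    show "inj_on (\<lambda>\<tau>. restrict \<tau> ?T) {\<tau>\<in>perms. \<forall>k\<in>A. commutes_at \<tau> k}"
    proof (rule inj_onI)
      fix \<tau> \<tau>' assume t: "\<tau> \<in> {\<tau>\<in>perms. \<forall>k\<in>A. commutes_at \<tau> k}" "\<tau>' \<in> {\<tau>\<in>perms. \<forall>k\<in>A. commutes_at \<tau> k}"
        and e: "restrict \<tau> ?T = restrict \<tau>' ?T"
      show "\<tau> = \<tau>'"
      proof (rule perm_determined[of _ _ A])
        fix x assume "x \<in> ?T"
        then show "\<tau> x = \<tau>' x" using fun_cong[OF e, of x] by simp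
      qed (use t assms in auto)
    qed
    show "(\<lambda>\<tau>. restrict \<tau> ?T) ` {\<tau>\<in>perms. \<forall>k\<in>A. commutes_at \<tau> k} \<subseteq> ?T \<rightarrow>\<^sub>E S"
    proof (rule image_subsetI)
      fix \<tau> assume "\<tau> \<in> {\<tau>\<in>perms. \<forall>k\<in>A. commutes_at \<tau> k}"
      then show "restrict \<tau> ?T \<in> ?T \<rightarrow>\<^sub>E S"
        unfolding restrict_PiE_iff using T(1) by (auto simp: permutes_in_image)
    qed
    show "finite (?T \<rightarrow>\<^sub>E S)" using T by (simp add: finite_PiE)
  qed
  also have "\<dots> = card S ^ card ?T" using T by (simp add: card_PiE)
  also have "\<dots> \<le> card S ^ (card S - card A + card (orbit \<sigma> ` S))"
  proof (rule power_increasing)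
    have "card (\<sigma> ` A) = card A" by (rule card_image) (auto simp: inj_on_def)
    then have "card (S - \<sigma> ` A) = card S - card A"
      using assms by (subst card_Diff_subset) (auto intro: finite_imageI finite_subset[OF assms finite_S])
    then show "card ?T \<le> card S - card A + card (orbit \<sigma> ` S)"
      using card_Un_le[of reps "S - \<sigma> ` A"] card_reps by linarith
    show "1 \<le> card S" using False by (simp add: Suc_le_eq card_gt_0_iff)
  qed
  finally show ?thesis .
qed

theorem card_many_commuting:
  assumes "S \<noteq> {}"
  shows "real (card {\<tau>\<in>perms. card S \<le> 2 * num_commuting \<tau>})
    \<le> 2 ^ card S * real (card S) powr (card S / 2 + card (orbit \<sigma> ` S))"
proof -
  let ?c = "card (orbit \<sigma> ` S)" and ?n = "card S"
  let ?P = "{A. A \<subseteq> S \<and> ?n \<le> 2 * card A}"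
  have n1: "1 \<le> ?n" using assms by (simp add: Suc_le_eq card_gt_0_iff)
  have fP: "finite ?P" by (rule finite_subset[of _ "Pow S"]) auto
  have "{\<tau>\<in>perms. ?n \<le> 2 * num_commuting \<tau>} \<subseteq> (\<Union>A\<in>?P. {\<tau>\<in>perms. \<forall>k\<in>A. commutes_at \<tau> k})"
  proof
    fix \<tau> assume "\<tau> \<in> {\<tau>\<in>perms. ?n \<le> 2 * num_commuting \<tau>}"
    then show "\<tau> \<in> (\<Union>A\<in>?P. {\<tau>\<in>perms. \<forall>k\<in>A. commutes_at \<tau> k})"
      by (intro UN_I[of "commuting \<tau>"]) (auto simp: num_commuting_def commuting_def)
  qed
  then have "card {\<tau>\<in>perms. ?n \<le> 2 * num_commuting \<tau>} \<le> card (\<Union>A\<in>?P. {\<tau>\<in>perms. \<forall>k\<in>A. commutes_at \<tau> k})"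
    by (rule card_mono[rotated]) (rule finite_subset[OF _ finite_perms], auto)
  also have "\<dots> \<le> (\<Sum>A\<in>?P. card {\<tau>\<in>perms. \<forall>k\<in>A. commutes_at \<tau> k})"
    by (rule card_UN_le[OF fP])
  finally have "real (card {\<tau>\<in>perms. ?n \<le> 2 * num_commuting \<tau>}) \<le> (\<Sum>A\<in>?P. real (card {\<tau>\<in>perms. \<forall>k\<in>A. commutes_at \<tau> k}))"
    by (simp only: of_nat_sum[symmetric] of_nat_le_iff)
  also have "\<dots> \<le> (\<Sum>A\<in>?P. real ?n powr (?n / 2 + ?c))"
  proof (rule sum_mono)
    fix A assume A: "A \<in> ?P"
    then have "real (card {\<tau>\<in>perms. \<forall>k\<in>A. commutes_at \<tau> k}) \<le> real (?n ^ (?n - card A + ?c))"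
      by (simp only: of_nat_le_iff) (rule card_commuting_on, auto)
    also have "\<dots> = real ?n powr real (?n - card A + ?c)"
      using n1 by (subst powr_realpow) auto
    also have "\<dots> \<le> real ?n powr (?n / 2 + ?c)"
      using A n1 by (intro powr_mono) auto
    finally show "real (card {\<tau>\<in>perms. \<forall>k\<in>A. commutes_at \<tau> k}) \<le> real ?n powr (?n / 2 + ?c)" .
  qed
  also have "\<dots> = card ?P * real ?n powr (?n / 2 + ?c)" by simp
  also have "\<dots> \<le> 2 ^ ?n * real ?n powr (?n / 2 + ?c)"
  proof (rule mult_right_mono)
    have "card ?P \<le> card (Pow S)" by (intro card_mono) auto
    then show "real (card ?P) \<le> 2 ^ ?n" by (simp add: card_Pow flip: of_nat_le_iff)
  qed simp
  finally show ?thesis .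
qed

lemma card_Fix2_le: "card Fix2 \<le> 2 * card (orbit \<sigma> ` S)"
proof -
  have o2: "orbit \<sigma> k \<subseteq> {k, \<sigma> k}" if "k \<in> Fix2" for k
  proof
    fix x assume "x \<in> orbit \<sigma> k"
    then show "x \<in> {k, \<sigma> k}" by induction (use that in \<open>auto simp: Fix2_def\<close>)
  qed
  have "Fix2 \<subseteq> (\<Union>C\<in>orbit \<sigma> ` Fix2. C)" using self_in_orbit by auto
  then have "card Fix2 \<le> card (\<Union>C\<in>orbit \<sigma> ` Fix2. C)"
    by (rule card_mono[rotated]) (auto intro: finite_subset[OF o2])
  also have "\<dots> \<le> (\<Sum>C\<in>orbit \<sigma> ` Fix2. card C)" by (rule card_UN_le) simp
  also have "\<dots> \<le> (\<Sum>C\<in>orbit \<sigma> ` Fix2. 2)"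
  proof (rule sum_mono)
    fix C assume "C \<in> orbit \<sigma> ` Fix2"
    then obtain k where "k \<in> Fix2" "C = orbit \<sigma> k" by auto
    then have "card C \<le> card {k, \<sigma> k}" using o2 by (intro card_mono) auto
    also have "\<dots> \<le> 2" by (simp add: card_insert_if)
    finally show "card C \<le> 2" .
  qed
  also have "\<dots> \<le> 2 * card (orbit \<sigma> ` S)"
    using card_mono[of "orbit \<sigma> ` S" "orbit \<sigma> ` Fix2"] Fix_sub by auto
  finally show ?thesis .
qed

lemma card_Fix_le_orbits: "card Fix \<le> card (orbit \<sigma> ` S)"
proof (rule card_inj_on_le[of "orbit \<sigma>"])
  have "orbit \<sigma> k = {k}" if "k \<in> Fix" for k
  proof -
    have "x = k" if "x \<in> orbit \<sigma> k" for x
      using that by induction (use \<open>k \<in> Fix\<close> in \<open>auto simp: Fix_def\<close>)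
    then show ?thesis using self_in_orbit by auto
  qed
  then show "inj_on (orbit \<sigma>) Fix" by (auto simp: inj_on_def)
qed (use Fix_sub in auto)

end

section \<open>Straight paths seen on the square torus\<close>

locale square_tiling =
  fixes n :: nat and \<sigma> \<tau> :: "nat \<Rightarrow> nat"
  assumes \<sigma>: "\<sigma> permutes {1..n}" and \<tau>: "\<tau> permutes {1..n}"
begin

abbreviation pt :: "nat \<Rightarrow> real \<times> real \<Rightarrow> square_pt set" where
  "pt j z \<equiv> surf_pt n \<sigma> \<tau> (j, z)"

lemma perm_in [simp]: "\<sigma> j \<in> {1..n} \<longleftrightarrow> j \<in> {1..n}" "\<tau> j \<in> {1..n} \<longleftrightarrow> j \<in> {1..n}"
  by (rule permutes_in_image[OF \<sigma>], rule permutes_in_image[OF \<tau>])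

lemma surf_pt_eq: "surf_pt n \<sigma> \<tau> p = surf_pt n \<sigma> \<tau> q \<longleftrightarrow> equivclp (glued n \<sigma> \<tau>) p q"
  unfolding surf_pt_def
  by (auto intro: equivclp_trans equivclp_sym)

lemma surf_pt_self: "p \<in> surf_pt n \<sigma> \<tau> p"
  by (simp add: surf_pt_def)

lemma mem_surf_pt: "q \<in> surf_pt n \<sigma> \<tau> p \<longleftrightarrow> surf_pt n \<sigma> \<tau> q = surf_pt n \<sigma> \<tau> p"
  unfolding surf_pt_eq by (auto simp: surf_pt_def intro: equivclp_sym)

lemma glue_right: "j \<in> {1..n} \<Longrightarrow> y \<in> {0..1} \<Longrightarrow> pt j (1, y) = pt (\<sigma> j) (0, y)"
  unfolding surf_pt_eq by (intro r_into_equivclp right_left)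

lemma glue_top: "j \<in> {1..n} \<Longrightarrow> x \<in> {0..1} \<Longrightarrow> pt j (x, 1) = pt (\<tau> j) (x, 0)"
  unfolding surf_pt_eq by (intro r_into_equivclp top_bottom)

lemma surf_pt_invariant:
  assumes "\<And>p q. glued n \<sigma> \<tau> p q \<Longrightarrow> f p = f q" and "surf_pt n \<sigma> \<tau> p = surf_pt n \<sigma> \<tau> q"
  shows "f p = f q"
proof -
  have "equivclp (glued n \<sigma> \<tau>) p q" using assms(2) by (simp add: surf_pt_eq)
  then show ?thesis by induction (auto dest: assms(1))
qed

text \<open>
  Coordinates modulo 1 are unchanged by the gluing. They give the projection of the surface to the
  square torus, and the vertices are the points over the origin.
\<close>
definition torus_coord :: "square_pt \<Rightarrow> real \<times> real" where
  "torus_coord p = (frac (fst (snd p)), frac (snd (snd p)))"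

lemma torus_coord_eq:
  assumes "surf_pt n \<sigma> \<tau> p = surf_pt n \<sigma> \<tau> q"
  shows "torus_coord p = torus_coord q"
  using assms by (rule surf_pt_invariant[rotated]) (auto simp: torus_coord_def elim!: glued.cases)

definition proj :: "square_pt set \<Rightarrow> real \<times> real" where
  "proj c = torus_coord (SOME p. p \<in> c)"

lemma proj_surf_pt: "proj (surf_pt n \<sigma> \<tau> p) = torus_coord p"
proof -
  have "(SOME q. q \<in> surf_pt n \<sigma> \<tau> p) \<in> surf_pt n \<sigma> \<tau> p"
    using surf_pt_self by (rule someI)
  then show ?thesis unfolding proj_def mem_surf_pt by (rule torus_coord_eq)
qed

lemma vertex_iff:
  assumes "p \<in> squares n"
  shows "surf_pt n \<sigma> \<tau> p \<in> vertices n \<sigma> \<tau> \<longleftrightarrow> proj (surf_pt n \<sigma> \<tau> p) = (0, 0)"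
proof
  assume "surf_pt n \<sigma> \<tau> p \<in> vertices n \<sigma> \<tau>"
  then obtain q where "q \<in> corners n" "surf_pt n \<sigma> \<tau> p = surf_pt n \<sigma> \<tau> q"
    by (auto simp: vertices_def)
  then show "proj (surf_pt n \<sigma> \<tau> p) = (0, 0)"
    by (auto simp: proj_surf_pt torus_coord_def corners_def)
next
  assume "proj (surf_pt n \<sigma> \<tau> p) = (0, 0)"
  then have "p \<in> corners n"
    using assms by (auto simp: proj_surf_pt torus_coord_def corners_def squares_def frac_eq_0_iff elim!: Ints_cases)
  then show "surf_pt n \<sigma> \<tau> p \<in> vertices n \<sigma> \<tau>" by (simp add: vertices_def)
qed

text \<open>
  On each piece of the path inside a square, the projection minus \<open>t v\<close> is constant modulo 1; hence
  it is locally constant on the connected interval \<open>{0..1}\<close>.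
\<close>
lemma straight_path_proj:
  assumes "straight_path n \<sigma> \<tau> v \<gamma>" and st: "s \<in> {0..1}" "t \<in> {0..1}"
  shows "frac (fst (proj (\<gamma> t)) - t * fst v) = frac (fst (proj (\<gamma> s)) - s * fst v)"
    "frac (snd (proj (\<gamma> t)) - t * snd v) = frac (snd (proj (\<gamma> s)) - s * snd v)"
proof -
  define D where "D t = (frac (fst (proj (\<gamma> t)) - t * fst v), frac (snd (proj (\<gamma> t)) - t * snd v))" for t
  have frac_frac: "frac (frac x - y) = frac (x - y)" for x y :: real
  proof -
    have e: "frac x - y = (x - y) - of_int \<lfloor>x\<rfloor>" by (simp add: frac_def)
    have "frac ((x - y) - of_int \<lfloor>x\<rfloor>) = frac (x - y)"
      unfolding frac_def floor_diff_of_int of_int_diff by simp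
    then show ?thesis unfolding e .
  qed
  have loc: "D u = D t" if "\<And>s. s \<in> I \<Longrightarrow> \<gamma> s = pt j (p + (s - t) *\<^sub>R v)" "u \<in> I" "t \<in> I" for I t u j p
  proof -
    have "D s = (frac (fst p - t * fst v), frac (snd p - t * snd v))" if "s \<in> I" for s
      using \<open>\<And>s. s \<in> I \<Longrightarrow> \<gamma> s = pt j (p + (s - t) *\<^sub>R v)\<close>[OF that]
      by (simp add: D_def proj_surf_pt torus_coord_def frac_frac algebra_simps)
    then show ?thesis using that by simp
  qed
  have "D s = D t"
  proof (rule connected_equivalence_relation[of "{0..1::real}"])
    fix t :: real assume t: "t \<in> {0..1}"
    have R: "\<exists>e>0. \<forall>s\<in>{t..t+e} \<inter> {0..1}. D s = D t"
    proof (cases "t = 1")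
      case True then show ?thesis by (intro exI[of _ 1]) auto
    next
      case False
      then have "t \<in> {0..<1}" using t by auto
      then obtain e j p where ep: "e > 0" "\<forall>s\<in>{t..t+e}. \<gamma> s = pt j (p + (s - t) *\<^sub>R v)"
        using assms(1) unfolding straight_path_def by meson
      have "D s = D t" if "s \<in> {t..t+e}" for s
        by (rule loc[where I = "{t..t+e}" and j = j and p = p]) (use that ep in simp_all)
      then show ?thesis using ep(1) by blast
    qed
    have L: "\<exists>e>0. \<forall>s\<in>{t-e..t} \<inter> {0..1}. D s = D t"
    proof (cases "t = 0")
      case True then show ?thesis by (intro exI[of _ 1]) auto
    next
      case False
      then have "t \<in> {0<..1}" using t by auto
      then obtain e j p where ep: "e > 0" "\<forall>s\<in>{t-e..t}. \<gamma> s = pt j (p + (s - t) *\<^sub>R v)"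
        using assms(1) unfolding straight_path_def by meson
      have "D s = D t" if "s \<in> {t-e..t}" for s
        by (rule loc[where I = "{t-e..t}" and j = j and p = p]) (use that ep in simp_all)
      then show ?thesis using ep(1) by blast
    qed
    from R obtain e1 where e1: "e1 > 0" "\<forall>s\<in>{t..t+e1} \<inter> {0..1}. D s = D t" by blast
    from L obtain e2 where e2: "e2 > 0" "\<forall>s\<in>{t-e2..t} \<inter> {0..1}. D s = D t" by blast
    show "\<exists>T. openin (top_of_set {0..1}) T \<and> t \<in> T \<and> (\<forall>x\<in>T. D t = D x)"
    proof (intro exI conjI ballI)
      show "openin (top_of_set {0..1}) ({0..1} \<inter> {t-e2<..<t+e1})" by (intro openin_open_Int) auto
      show "t \<in> {0..1} \<inter> {t-e2<..<t+e1}" using t e1(1) e2(1) by simp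
      fix x assume "x \<in> {0..1} \<inter> {t-e2<..<t+e1}"
      then have "x \<in> {t..t+e1} \<inter> {0..1} \<or> x \<in> {t-e2..t} \<inter> {0..1}" by auto
      then show "D t = D x" using e1(2) e2(2) by metis
    qed
  qed (use st in auto)
  then show "frac (fst (proj (\<gamma> t)) - t * fst v) = frac (fst (proj (\<gamma> s)) - s * fst v)"
    "frac (snd (proj (\<gamma> t)) - t * snd v) = frac (snd (proj (\<gamma> s)) - s * snd v)"
    by (simp_all add: D_def)
qed

lemma straight_path_in:
  assumes "straight_path n \<sigma> \<tau> v \<gamma>" "t \<in> {0..1}"
  obtains p where "p \<in> squares n" "\<gamma> t = surf_pt n \<sigma> \<tau> p"
proof (cases "t = 1")
  case False
  then have "t \<in> {0..<1}" using assms by auto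
  then obtain e j p where "e > 0" "j \<in> {1..n}" "\<forall>s\<in>{t..t+e}. p + (s - t) *\<^sub>R v \<in> {0..1} \<times> {0..1} \<and> \<gamma> s = pt j (p + (s - t) *\<^sub>R v)"
    using assms(1) unfolding straight_path_def by meson
  then have "p \<in> {0..1} \<times> {0..1}" "\<gamma> t = pt j p" by (auto dest!: bspec[of _ _ t])
  then show ?thesis using that[of "(j, p)"] \<open>j \<in> {1..n}\<close> by (auto simp: squares_def)
next
  case True
  then have "t \<in> {0<..1}" using assms by auto
  then obtain e j p where "e > 0" "j \<in> {1..n}" "\<forall>s\<in>{t-e..t}. p + (s - t) *\<^sub>R v \<in> {0..1} \<times> {0..1} \<and> \<gamma> s = pt j (p + (s - t) *\<^sub>R v)"
    using assms(1) unfolding straight_path_def by meson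
  then have "p \<in> {0..1} \<times> {0..1}" "\<gamma> t = pt j p" by (auto dest!: bspec[of _ _ t])
  then show ?thesis using that[of "(j, p)"] \<open>j \<in> {1..n}\<close> by (auto simp: squares_def)
qed

lemma straight_path_vertex_iff:
  assumes "straight_path n \<sigma> \<tau> v \<gamma>" "\<gamma> 0 \<in> vertices n \<sigma> \<tau>" "t \<in> {0..1}"
  shows "\<gamma> t \<in> vertices n \<sigma> \<tau> \<longleftrightarrow> t * fst v \<in> \<int> \<and> t * snd v \<in> \<int>"
proof -
  obtain p where p: "p \<in> squares n" "\<gamma> t = surf_pt n \<sigma> \<tau> p" using straight_path_in[OF assms(1,3)] .
  obtain q where q: "q \<in> squares n" "\<gamma> 0 = surf_pt n \<sigma> \<tau> q" using straight_path_in[OF assms(1), of 0] by auto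
  have "proj (\<gamma> 0) = (0, 0)" using q assms(2) vertex_iff[OF q(1)] by simp
  then have *: "frac (fst (proj (\<gamma> t)) - t * fst v) = 0" "frac (snd (proj (\<gamma> t)) - t * snd v) = 0"
    using straight_path_proj[OF assms(1), of 0 t] assms(3) by simp_all
  have fr: "x = 0 \<longleftrightarrow> y \<in> \<int>" if "frac (x - y) = 0" "0 \<le> x" "x < 1" for x y :: real
  proof -
    have "x - y \<in> \<int>" using that by (simp add: frac_eq_0_iff)
    moreover have "x \<in> \<int> \<longleftrightarrow> x = 0" using that by (metis Ints_0 frac_eq frac_eq_0_iff)
    ultimately show ?thesis by (metis Ints_diff Ints_add diff_add_cancel diff_diff_eq2 add_diff_cancel_left' Ints_0)
  qed
  have b: "0 \<le> fst (proj (\<gamma> t))" "fst (proj (\<gamma> t)) < 1" "0 \<le> snd (proj (\<gamma> t))" "snd (proj (\<gamma> t)) < 1"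
    by (simp_all add: p proj_surf_pt torus_coord_def frac_lt_1)
  have "\<gamma> t \<in> vertices n \<sigma> \<tau> \<longleftrightarrow> proj (\<gamma> t) = (0, 0)" using p vertex_iff[OF p(1)] by simp
  also have "\<dots> \<longleftrightarrow> t * fst v \<in> \<int> \<and> t * snd v \<in> \<int>"
    using fr[OF *(1) b(1,2)] fr[OF *(2) b(3,4)] by (auto simp: prod_eq_iff)
  finally show ?thesis .
qed

end

context square_tiling begin

section \<open>Construction of straight paths\<close>

abbreviation box :: "(real \<times> real) set" where
  "box \<equiv> {0..1} \<times> {0..1}"

text \<open>
  Straight paths parametrised by \<open>[0, T]\<close>, to be built up square by square.
\<close>
definition straight_on :: "real \<Rightarrow> real \<times> real \<Rightarrow> (real \<Rightarrow> square_pt set) \<Rightarrow> bool" where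
  "straight_on T v \<gamma> \<longleftrightarrow>
     (\<forall>t\<in>{0..<T}. \<exists>e>0. \<exists>j\<in>{1..n}. \<exists>p. \<forall>s\<in>{t..t+e}. p + (s - t) *\<^sub>R v \<in> box \<and> \<gamma> s = pt j (p + (s - t) *\<^sub>R v)) \<and>
     (\<forall>t\<in>{0<..T}. \<exists>e>0. \<exists>j\<in>{1..n}. \<exists>p. \<forall>s\<in>{t-e..t}. p + (s - t) *\<^sub>R v \<in> box \<and> \<gamma> s = pt j (p + (s - t) *\<^sub>R v))"

lemma straight_on_1: "straight_on 1 v \<gamma> \<longleftrightarrow> straight_path n \<sigma> \<tau> v \<gamma>"
  by (simp add: straight_on_def straight_path_def)

lemma straight_on_extend:
  assumes \<gamma>: "straight_on T v \<gamma>" and T: "0 \<le> T" "T < T'" and j: "j \<in> {1..n}"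
    and box: "\<And>s. s \<in> {T..T'} \<Longrightarrow> p + (s - T) *\<^sub>R v \<in> box" and start: "\<gamma> T = pt j p"
  obtains \<gamma>' where "straight_on T' v \<gamma>'" "\<And>s. s \<le> T \<Longrightarrow> \<gamma>' s = \<gamma> s"
    "\<And>s. s \<in> {T..T'} \<Longrightarrow> \<gamma>' s = pt j (p + (s - T) *\<^sub>R v)"
proof
  let ?g = "\<lambda>s. if s \<le> T then \<gamma> s else pt j (p + (s - T) *\<^sub>R v)"
  show g2: "?g s = pt j (p + (s - T) *\<^sub>R v)" if "s \<in> {T..T'}" for s
    using that start by (cases "s = T") auto
  have seg: "(p + (t - T) *\<^sub>R v) + (s - t) *\<^sub>R v = p + (s - T) *\<^sub>R v" for s t
    by (simp add: algebra_simps flip: scaleR_add_left)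
  show "straight_on T' v ?g"
    unfolding straight_on_def
  proof (intro conjI ballI)
    fix t assume t: "t \<in> {0..<T'}"
    show "\<exists>e>0. \<exists>j\<in>{1..n}. \<exists>p. \<forall>s\<in>{t..t+e}. p + (s - t) *\<^sub>R v \<in> box \<and> ?g s = pt j (p + (s - t) *\<^sub>R v)"
    proof (cases "t < T")
      case True
      then obtain e i r where e: "e > 0" "i \<in> {1..n}"
        "\<forall>s\<in>{t..t+e}. r + (s - t) *\<^sub>R v \<in> box \<and> \<gamma> s = pt i (r + (s - t) *\<^sub>R v)"
        using \<gamma> t unfolding straight_on_def by (meson atLeastLessThan_iff)
      show ?thesis
      proof (rule exI[of _ "min e (T - t)"], intro conjI bexI[of _ i] exI[of _ r] ballI)
        fix s assume "s \<in> {t..t + min e (T - t)}"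
        then have "s \<in> {t..t+e}" "s \<le> T" by auto
        then show "r + (s - t) *\<^sub>R v \<in> box" "?g s = pt i (r + (s - t) *\<^sub>R v)"
          using e(3) by simp_all
      qed (use e True in auto)
    next
      case False
      show ?thesis
      proof (rule exI[of _ "T' - t"], intro conjI bexI[of _ j] exI[of _ "p + (t - T) *\<^sub>R v"] ballI)
        fix s assume "s \<in> {t..t + (T' - t)}"
        then have "s \<in> {T..T'}" using False by auto
        then show "p + (t - T) *\<^sub>R v + (s - t) *\<^sub>R v \<in> box"
          "?g s = pt j (p + (t - T) *\<^sub>R v + (s - t) *\<^sub>R v)"
          unfolding seg by (rule box, rule g2)
      qed (use t j in auto)
    qed
  next
    fix t assume t: "t \<in> {0<..T'}"
    show "\<exists>e>0. \<exists>j\<in>{1..n}. \<exists>p. \<forall>s\<in>{t-e..t}. p + (s - t) *\<^sub>R v \<in> box \<and> ?g s = pt j (p + (s - t) *\<^sub>R v)"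
    proof (cases "t \<le> T")
      case True
      then obtain e i r where e: "e > 0" "i \<in> {1..n}"
        "\<forall>s\<in>{t-e..t}. r + (s - t) *\<^sub>R v \<in> box \<and> \<gamma> s = pt i (r + (s - t) *\<^sub>R v)"
        using \<gamma> t unfolding straight_on_def by (meson greaterThanAtMost_iff)
      show ?thesis
      proof (rule exI[of _ e], intro conjI bexI[of _ i] exI[of _ r] ballI)
        fix s assume "s \<in> {t-e..t}"
        then have "s \<in> {t-e..t}" "s \<le> T" using True by auto
        then show "r + (s - t) *\<^sub>R v \<in> box" "?g s = pt i (r + (s - t) *\<^sub>R v)"
          using e(3) by simp_all
      qed (use e True in auto)
    next
      case False
      show ?thesis
      proof (rule exI[of _ "t - T"], intro conjI bexI[of _ j] exI[of _ "p + (t - T) *\<^sub>R v"] ballI)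
        fix s assume "s \<in> {t - (t - T)..t}"
        then have "s \<in> {T..T'}" using t by auto
        then show "p + (t - T) *\<^sub>R v + (s - t) *\<^sub>R v \<in> box"
          "?g s = pt j (p + (t - T) *\<^sub>R v + (s - t) *\<^sub>R v)"
          unfolding seg by (rule box, rule g2)
      qed (use False j in auto)
    qed
  qed
qed auto

lemma straight_on_0: "straight_on 0 v \<gamma>"
  by (simp add: straight_on_def)

text \<open>
  The path along the bottom edges of the squares \<open>j, \<pi> j, \<pi> (\<pi> j), \<dots>\<close> for \<open>e = (1, 0)\<close> and \<open>\<pi> = \<sigma>\<close>,
  or along left edges for \<open>e = (0, 1)\<close> and \<open>\<pi> = \<tau>\<close>. At each vertex it continues on the edge of the
  next square of the row or column.
\<close>
lemma edge_path:
  assumes e: "e = (1, 0) \<or> e = (0, 1)"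
    and \<pi>: "\<And>j. j \<in> {1..n} \<Longrightarrow> \<pi> j \<in> {1..n} \<and> pt j e = pt (\<pi> j) 0"
    and j: "j \<in> {1..n}" and k: "k \<ge> 1"
  shows "\<exists>\<gamma>. straight_path n \<sigma> \<tau> (real k *\<^sub>R e) \<gamma> \<and> (\<forall>i\<le>k. \<gamma> (i / k) = pt ((\<pi> ^^ i) j) 0)"
proof -
  have in_range: "(\<pi> ^^ i) j \<in> {1..n}" for i by (induction i) (use \<pi> j in auto)
  have "\<exists>\<gamma>. straight_on (m / k) (real k *\<^sub>R e) \<gamma> \<and> (\<forall>i\<le>m. \<gamma> (i / k) = pt ((\<pi> ^^ i) j) 0)" for m :: nat
  proof (induction m)
    case 0
    show ?case by (intro exI[of _ "\<lambda>_. pt j 0"]) (simp add: straight_on_0)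
  next
    case (Suc m)
    then obtain \<gamma> where \<gamma>: "straight_on (m / k) (real k *\<^sub>R e) \<gamma>" "\<forall>i\<le>m. \<gamma> (i / k) = pt ((\<pi> ^^ i) j) 0"
      by blast
    obtain \<gamma>' where \<gamma>': "straight_on (Suc m / k) (real k *\<^sub>R e) \<gamma>'" "\<And>s. s \<le> m / k \<Longrightarrow> \<gamma>' s = \<gamma> s"
      "\<And>s. s \<in> {m / k..Suc m / k} \<Longrightarrow> \<gamma>' s = pt ((\<pi> ^^ m) j) (0 + (s - m / k) *\<^sub>R real k *\<^sub>R e)"
    proof (rule straight_on_extend[OF \<gamma>(1) _ _ in_range])
      show "real m / real k < real (Suc m) / real k" using k by (simp add: divide_strict_right_mono)
      show "0 + (s - real m / real k) *\<^sub>R real k *\<^sub>R e \<in> box" if "s \<in> {m / k..Suc m / k}" for s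
      proof -
        have "real m \<le> s * k" "s * k \<le> real m + 1" using that k by (auto simp: field_simps)
        moreover have "(s - m / k) * k = s * k - real m" using k by (simp add: left_diff_distrib)
        ultimately have "(s - m / k) * k \<in> {0..1}" by simp
        then show ?thesis using e by auto
      qed
    qed (use \<gamma>(2) in auto)
    have "\<gamma>' (i / k) = pt ((\<pi> ^^ i) j) 0" if "i \<le> Suc m" for i
    proof (cases "i = Suc m")
      case True
      have "(Suc m / k - m / k) *\<^sub>R real k *\<^sub>R e = e" using k by (simp add: field_simps)
      then have "\<gamma>' (Suc m / k) = pt ((\<pi> ^^ m) j) e"
        using \<gamma>'(3)[of "Suc m / k"] k by (simp add: divide_right_mono)
      then show ?thesis using \<pi>[OF in_range[of m]] True by simp
    next
      case False
      then show ?thesis using that \<gamma>'(2)[of "i / k"] \<gamma>(2) k by (simp add: divide_right_mono)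
    qed
    then show ?case using \<gamma>'(1) by blast
  qed
  from this[of k] k show ?thesis by (simp add: straight_on_1)
qed

text \<open>
  The line from \<open>(0, 0)\<close> to \<open>(p, q)\<close> crosses a staircase of unit cells \<open>(i, k)\<close> and meets no lattice
  point between its ends, because \<open>p\<close> and \<open>q\<close> are coprime. Each crossing of a vertical or
  horizontal grid line multiplies the label by \<open>\<pi>1\<close> or \<open>\<pi>2\<close>, the same word for every initial label;
  hence the final label is a permutation of the initial one. The pairs \<open>(c, \<epsilon>)\<close> are either
  \<open>(0, 1)\<close> or \<open>(1, -1)\<close>, and reflect the coordinates of the squares so that all four quadrants of
  directions are covered.
\<close>
lemma staircase:
  assumes c: "(c1 = 0 \<and> \<epsilon>1 = 1) \<or> (c1 = 1 \<and> \<epsilon>1 = -1)" "(c2 = 0 \<and> \<epsilon>2 = 1) \<or> (c2 = 1 \<and> \<epsilon>2 = -1)"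
    and \<pi>: "\<pi>1 permutes {1..n}" "\<pi>2 permutes {1..n}"
    and gl1: "\<And>j y. j \<in> {1..n} \<Longrightarrow> y \<in> {0..1} \<Longrightarrow> pt j (c1 + \<epsilon>1, y) = pt (\<pi>1 j) (c1, y)"
    and gl2: "\<And>j x. j \<in> {1..n} \<Longrightarrow> x \<in> {0..1} \<Longrightarrow> pt j (x, c2 + \<epsilon>2) = pt (\<pi>2 j) (x, c2)"
    and pq: "p > 0" "q > 0" "coprime p q"
  shows "\<exists>w. w permutes {1..n} \<and> (\<forall>j\<in>{1..n}. \<exists>\<gamma>. straight_path n \<sigma> \<tau> (\<epsilon>1 * real p, \<epsilon>2 * real q) \<gamma>
      \<and> \<gamma> 0 = pt j (c1, c2) \<and> \<gamma> 1 = pt (w j) (c1 + \<epsilon>1, c2 + \<epsilon>2))"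
proof -
  let ?v = "(\<epsilon>1 * real p, \<epsilon>2 * real q)"
  \<comment> \<open>position at time \<open>t\<close> in cell \<open>(i, k)\<close>, and the time at which the line leaves the cell\<close>
  define Z where "Z i k t = (c1 + \<epsilon>1 * (t * p - real i), c2 + \<epsilon>2 * (t * q - real k))" for i k :: nat and t :: real
  define E where "E i k = min ((i + 1) / p) ((k + 1) / q)" for i k :: nat
  define Q where "Q i k w T \<longleftrightarrow> w permutes {1..n} \<and> (\<forall>j\<in>{1..n}. \<exists>\<gamma>. straight_on T ?v \<gamma> \<and>
      \<gamma> 0 = pt j (c1, c2) \<and> \<gamma> T = pt (w j) (Z i k T))" for i k :: nat and w T
  have Zbox: "Z i k t \<in> box" if "i / p \<le> t" "k / q \<le> t" "t \<le> E i k" for i k t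
    using that c pq by (auto simp: Z_def E_def field_simps)
  have cross: "Q i k w (E i k)" if Q: "Q i k w T" and T: "0 \<le> T" "i / p \<le> T" "k / q \<le> T" "T < E i k" for i k w T
    unfolding Q_def
  proof (intro conjI ballI)
    show "w permutes {1..n}" using Q by (simp add: Q_def)
    fix j assume j: "j \<in> {1..n}"
    then have wj: "w j \<in> {1..n}" using permutes_in_image[of w "{1..n}" j] Q by (simp add: Q_def)
    obtain \<gamma> where \<gamma>: "straight_on T ?v \<gamma>" "\<gamma> 0 = pt j (c1, c2)" "\<gamma> T = pt (w j) (Z i k T)"
      using Q j unfolding Q_def by blast
    have seg: "Z i k T + (s - T) *\<^sub>R ?v = Z i k s" for s
      by (simp add: Z_def algebra_simps)
    obtain \<gamma>' where "straight_on (E i k) ?v \<gamma>'" "\<And>s. s \<le> T \<Longrightarrow> \<gamma>' s = \<gamma> s"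
      "\<And>s. s \<in> {T..E i k} \<Longrightarrow> \<gamma>' s = pt (w j) (Z i k T + (s - T) *\<^sub>R ?v)"
      by (rule straight_on_extend[OF \<gamma>(1) T(1) T(4) wj, of "Z i k T"]) (use \<gamma>(3) seg Zbox T in auto)
    then show "\<exists>\<gamma>. straight_on (E i k) ?v \<gamma> \<and> \<gamma> 0 = pt j (c1, c2) \<and> \<gamma> (E i k) = pt (w j) (Z i k (E i k))"
      using \<gamma>(2) T seg by (intro exI[of _ \<gamma>']) auto
  qed
  \<comment> \<open>the two inequalities say that the line meets the interior of cell \<open>(i, k)\<close>\<close>
  have stairs: "\<exists>i k w. i + k = s \<and> i < p \<and> k < q \<and> i * q < (k + 1) * p \<and> k * p < (i + 1) * q \<and> Q i k w (E i k)"
    if "s \<le> p + q - 2" for s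
    using that
  proof (induction s)
    case 0
    have "Q 0 0 id 0" using straight_on_0 by (auto simp: Q_def Z_def permutes_id)
    then have "Q 0 0 id (E 0 0)" by (rule cross) (use pq in \<open>auto simp: E_def\<close>)
    moreover have "(0::nat) + 0 = 0 \<and> 0 < p \<and> 0 < q \<and> 0 * q < (0 + 1) * p \<and> 0 * p < (0 + 1) * q"
      using pq by simp
    ultimately show ?case by blast
  next
    case (Suc s)
    then obtain i k w where ik: "i + k = s" "i < p" "k < q" "i * q < (k + 1) * p" "k * p < (i + 1) * q"
      and Q: "Q i k w (E i k)" by auto
    have wp: "w permutes {1..n}" using Q by (simp add: Q_def)
    have win: "w j \<in> {1..n} \<longleftrightarrow> j \<in> {1..n}" for j by (rule permutes_in_image[OF wp])
    have E_entry: "i / p \<le> E i k" "k / q \<le> E i k" "0 \<le> E i k"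
      using ik pq by (auto simp: E_def field_simps simp flip: of_nat_mult of_nat_add of_nat_Suc)
    have ZE: "Z i k (E i k) \<in> box" by (rule Zbox) (use E_entry in auto)
    consider "(i + 1) * q < (k + 1) * p" | "(k + 1) * p < (i + 1) * q" | "(i + 1) * q = (k + 1) * p" by linarith
    then show ?case
    proof cases
      case 1
      have Ev: "E i k = (i + 1) / p"
        using 1 pq unfolding E_def
        by (intro min_absorb1) (simp add: field_simps flip: of_nat_mult of_nat_add of_nat_Suc)
      have i1: "i + 1 < p"
      proof -
        have "(k + 1) * p \<le> q * p" using ik(3) by (intro mult_le_mono1) simp
        with 1 have "(i + 1) * q < p * q" by (simp only: mult.commute[of p q])
        then show ?thesis by (simp only: mult_less_cancel2)
      qed
      have "Q (i + 1) k (\<pi>1 \<circ> w) (E i k)"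
        unfolding Q_def
      proof (intro conjI ballI)
        show "\<pi>1 \<circ> w permutes {1..n}" using wp \<pi> by (simp add: permutes_compose)
        fix j assume j: "j \<in> {1..n}"
        then obtain \<gamma> where \<gamma>: "straight_on (E i k) ?v \<gamma>" "\<gamma> 0 = pt j (c1, c2)" "\<gamma> (E i k) = pt (w j) (Z i k (E i k))"
          using Q unfolding Q_def by blast
        have "Z i k (E i k) = (c1 + \<epsilon>1, snd (Z i k (E i k)))" "Z (i + 1) k (E i k) = (c1, snd (Z i k (E i k)))"
          using pq by (auto simp: Z_def Ev)
        moreover have "snd (Z i k (E i k)) \<in> {0..1}" using ZE by (auto simp: mem_Times_iff)
        ultimately have "\<gamma> (E i k) = pt ((\<pi>1 \<circ> w) j) (Z (i + 1) k (E i k))"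
          using \<gamma>(3) gl1[of "w j" "snd (Z i k (E i k))"] win j by simp
        then show "\<exists>\<gamma>. straight_on (E i k) ?v \<gamma> \<and> \<gamma> 0 = pt j (c1, c2) \<and> \<gamma> (E i k) = pt ((\<pi>1 \<circ> w) j) (Z (i + 1) k (E i k))"
          using \<gamma> by blast
      qed
      then have "Q (i + 1) k (\<pi>1 \<circ> w) (E (i + 1) k)"
      proof (rule cross)
        show "E i k < E (i + 1) k" unfolding Ev using 1 pq
          by (auto simp: E_def field_simps simp flip: of_nat_mult of_nat_add of_nat_Suc)
      qed (use E_entry Ev in auto)
      moreover have "(i + 1) * q < (k + 1) * p" "k * p < (i + 1 + 1) * q" using 1 ik by auto
      ultimately have "(i + 1) + k = Suc s \<and> i + 1 < p \<and> k < q \<and> (i + 1) * q < (k + 1) * p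
          \<and> k * p < (i + 1 + 1) * q \<and> Q (i + 1) k (\<pi>1 \<circ> w) (E (i + 1) k)"
        using ik(1,3) i1 by simp
      then show ?thesis by blast
    next
      case 2
      have Ev: "E i k = (k + 1) / q"
        using 2 pq unfolding E_def
        by (intro min_absorb2) (simp add: field_simps flip: of_nat_mult of_nat_add of_nat_Suc)
      have k1: "k + 1 < q"
      proof -
        have "(i + 1) * q \<le> p * q" using ik(2) by (intro mult_le_mono1) simp
        with 2 have "(k + 1) * p < q * p" by (simp only: mult.commute[of p q])
        then show ?thesis by (simp only: mult_less_cancel2)
      qed
      have "Q i (k + 1) (\<pi>2 \<circ> w) (E i k)"
        unfolding Q_def
      proof (intro conjI ballI)
        show "\<pi>2 \<circ> w permutes {1..n}" using wp \<pi> by (simp add: permutes_compose)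
        fix j assume j: "j \<in> {1..n}"
        then obtain \<gamma> where \<gamma>: "straight_on (E i k) ?v \<gamma>" "\<gamma> 0 = pt j (c1, c2)" "\<gamma> (E i k) = pt (w j) (Z i k (E i k))"
          using Q unfolding Q_def by blast
        have "Z i k (E i k) = (fst (Z i k (E i k)), c2 + \<epsilon>2)" "Z i (k + 1) (E i k) = (fst (Z i k (E i k)), c2)"
          using pq by (auto simp: Z_def Ev)
        moreover have "fst (Z i k (E i k)) \<in> {0..1}" using ZE by (auto simp: mem_Times_iff)
        ultimately have "\<gamma> (E i k) = pt ((\<pi>2 \<circ> w) j) (Z i (k + 1) (E i k))"
          using \<gamma>(3) gl2[of "w j" "fst (Z i k (E i k))"] win j by simp
        then show "\<exists>\<gamma>. straight_on (E i k) ?v \<gamma> \<and> \<gamma> 0 = pt j (c1, c2) \<and> \<gamma> (E i k) = pt ((\<pi>2 \<circ> w) j) (Z i (k + 1) (E i k))"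
          using \<gamma> by blast
      qed
      then have "Q i (k + 1) (\<pi>2 \<circ> w) (E i (k + 1))"
      proof (rule cross)
        show "E i k < E i (k + 1)" unfolding Ev using 2 pq
          by (auto simp: E_def field_simps simp flip: of_nat_mult of_nat_add of_nat_Suc)
      qed (use E_entry Ev in auto)
      moreover have "i * q < (k + 1 + 1) * p" "(k + 1) * p < (i + 1) * q" using 2 ik by auto
      ultimately have "i + (k + 1) = Suc s \<and> i < p \<and> k + 1 < q \<and> i * q < (k + 1 + 1) * p
          \<and> (k + 1) * p < (i + 1) * q \<and> Q i (k + 1) (\<pi>2 \<circ> w) (E i (k + 1))"
        using ik(1,2) k1 by simp
      then show ?thesis by blast
    next
      \<comment> \<open>the line leaves through a corner of the cell, which by coprimality is its endpoint\<close>
      case 3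
      then have "p dvd (i + 1) * q" "q dvd (k + 1) * p" by (metis dvd_triv_right)+
      then have "p dvd i + 1" "q dvd k + 1"
        using pq(3) coprime_dvd_mult_left_iff coprime_commute by blast+
      then have "p \<le> i + 1" "q \<le> k + 1" by (simp_all add: dvd_imp_le)
      with ik Suc.prems show ?thesis by linarith
    qed
  qed
  obtain i k w where ik: "i + k = p + q - 2" "i < p" "k < q" "Q i k w (E i k)"
    using stairs[of "p + q - 2"] by auto
  then have "i + 1 = p" "k + 1 = q" by linarith+
  then have "E i k = 1" "Z i k 1 = (c1 + \<epsilon>1, c2 + \<epsilon>2)"
    using pq by (auto simp: E_def Z_def simp flip: of_nat_Suc)
  then show ?thesis using ik(4) by (auto simp: Q_def straight_on_1)
qed

end

context square_tiling begin

text \<open>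
  Axis directions run along a single edge; all others are covered by \<open>staircase\<close>, with \<open>\<sigma>\<close> or \<open>\<tau>\<close>
  inverted according to the signs of the coordinates.
\<close>
lemma primitive_path:
  fixes P Q :: int
  assumes "coprime P Q"
  shows "\<exists>a\<in>{0,1}. \<exists>b\<in>{0,1}. \<exists>a'\<in>{0,1}. \<exists>b'\<in>{0,1}. \<exists>w. w permutes {1..n} \<and>
    (\<forall>j\<in>{1..n}. \<exists>\<gamma>. straight_path n \<sigma> \<tau> (of_int P, of_int Q) \<gamma> \<and> \<gamma> 0 = pt j (a, b) \<and> \<gamma> 1 = pt (w j) (a', b'))"
proof -
  have seg: "\<exists>\<gamma>. straight_path n \<sigma> \<tau> v \<gamma> \<and> \<gamma> 0 = pt j p \<and> \<gamma> 1 = pt j (p + v)"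
    if j: "j \<in> {1..n}" and b: "\<And>s. s \<in> {0..1} \<Longrightarrow> p + s *\<^sub>R v \<in> box" for j p v
  proof -
    obtain \<gamma> where "straight_on 1 v \<gamma>" "\<And>s. s \<in> {0..1} \<Longrightarrow> \<gamma> s = pt j (p + (s - 0) *\<^sub>R v)"
      by (rule straight_on_extend[OF straight_on_0 _ _ j, of 1 p v "\<lambda>_. pt j p"]) (use b in auto)
    then show ?thesis by (intro exI[of _ \<gamma>]) (auto simp: straight_on_1)
  qed
  consider "P = 0" | "Q = 0" | "P \<noteq> 0" "Q \<noteq> 0" by blast
  then show ?thesis
  proof cases
    case 1
    then consider "Q = 1" | "Q = -1" using assms by auto linarith
    then show ?thesis
    proof cases
      case q: 1
      have "\<exists>\<gamma>. straight_path n \<sigma> \<tau> (of_int P, of_int Q) \<gamma> \<and> \<gamma> 0 = pt j (0, 0) \<and> \<gamma> 1 = pt (id j) (0, 1)"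
        if "j \<in> {1..n}" for j using seg[OF that, of "(0, 0)" "(0, 1)"] 1 q by simp
      then show ?thesis using permutes_id[of "{1..n}"] by blast
    next
      case q: 2
      have "\<exists>\<gamma>. straight_path n \<sigma> \<tau> (of_int P, of_int Q) \<gamma> \<and> \<gamma> 0 = pt j (0, 1) \<and> \<gamma> 1 = pt (id j) (0, 0)"
        if "j \<in> {1..n}" for j using seg[OF that, of "(0, 1)" "(0, -1)"] 1 q by simp
      then show ?thesis using permutes_id[of "{1..n}"] by blast
    qed
  next
    case 2
    then consider "P = 1" | "P = -1" using assms by auto linarith
    then show ?thesis
    proof cases
      case p: 1
      have "\<exists>\<gamma>. straight_path n \<sigma> \<tau> (of_int P, of_int Q) \<gamma> \<and> \<gamma> 0 = pt j (0, 0) \<and> \<gamma> 1 = pt (id j) (1, 0)"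
        if "j \<in> {1..n}" for j using seg[OF that, of "(0, 0)" "(1, 0)"] 2 p by simp
      then show ?thesis using permutes_id[of "{1..n}"] by blast
    next
      case p: 2
      have "\<exists>\<gamma>. straight_path n \<sigma> \<tau> (of_int P, of_int Q) \<gamma> \<and> \<gamma> 0 = pt j (1, 0) \<and> \<gamma> 1 = pt (id j) (0, 0)"
        if "j \<in> {1..n}" for j using seg[OF that, of "(1, 0)" "(-1, 0)"] 2 p by simp
      then show ?thesis using permutes_id[of "{1..n}"] by blast
    qed
  next
    case 3
    define c :: "int \<Rightarrow> real" where "c x = (if x > 0 then 0 else 1)" for x
    define \<epsilon> :: "int \<Rightarrow> real" where "\<epsilon> x = (if x > 0 then 1 else -1)" for x
    define \<pi>1 where "\<pi>1 = (if P > 0 then \<sigma> else inv \<sigma>)"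
    define \<pi>2 where "\<pi>2 = (if Q > 0 then \<tau> else inv \<tau>)"
    have inv_in: "inv \<sigma> j \<in> {1..n}" "inv \<tau> j \<in> {1..n}" if "j \<in> {1..n}" for j
      using that permutes_in_image[OF permutes_inv[OF \<sigma>]] permutes_in_image[OF permutes_inv[OF \<tau>]] by auto
    have "\<exists>w. w permutes {1..n} \<and> (\<forall>j\<in>{1..n}. \<exists>\<gamma>. straight_path n \<sigma> \<tau> (\<epsilon> P * real (nat \<bar>P\<bar>), \<epsilon> Q * real (nat \<bar>Q\<bar>)) \<gamma>
      \<and> \<gamma> 0 = pt j (c P, c Q) \<and> \<gamma> 1 = pt (w j) (c P + \<epsilon> P, c Q + \<epsilon> Q))"
    proof (rule staircase)
      show "\<pi>1 permutes {1..n}" "\<pi>2 permutes {1..n}"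
        using \<sigma> \<tau> by (auto simp: \<pi>1_def \<pi>2_def permutes_inv)
      show "pt j (c P + \<epsilon> P, y) = pt (\<pi>1 j) (c P, y)" if "j \<in> {1..n}" "y \<in> {0..1}" for j y
        using glue_right[OF that] glue_right[OF inv_in(1)[OF that(1)] that(2)] permutes_inverses[OF \<sigma>]
        by (auto simp: c_def \<epsilon>_def \<pi>1_def)
      show "pt j (x, c Q + \<epsilon> Q) = pt (\<pi>2 j) (x, c Q)" if "j \<in> {1..n}" "x \<in> {0..1}" for j x
        using glue_top[OF that] glue_top[OF inv_in(2)[OF that(1)] that(2)] permutes_inverses[OF \<tau>]
        by (auto simp: c_def \<epsilon>_def \<pi>2_def)
      show "coprime (nat \<bar>P\<bar>) (nat \<bar>Q\<bar>)" using assms by (simp add: coprime_int_iff[symmetric])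
    qed (use 3 in \<open>auto simp: c_def \<epsilon>_def\<close>)
    moreover have "\<epsilon> P * real (nat \<bar>P\<bar>) = of_int P" "\<epsilon> Q * real (nat \<bar>Q\<bar>) = of_int Q"
      using 3 by (auto simp: \<epsilon>_def)
    moreover have "c P \<in> {0,1}" "c Q \<in> {0,1}" "c P + \<epsilon> P \<in> {0,1}" "c Q + \<epsilon> Q \<in> {0,1}"
      by (auto simp: c_def \<epsilon>_def)
    ultimately show ?thesis by (metis (no_types, lifting))
  qed
qed

section \<open>Vertices and cone points\<close>

definition corner_vertex :: "nat \<Rightarrow> square_pt set" where
  "corner_vertex j = pt j (1, 1)"

text \<open>
  Every vertex contains an upper right corner, and walking there from a corner of another kind
  permutes the labels. Thus counting squares by their corners of any kind is the same as counting
  them by their upper right corners.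
\<close>
lemma corner_eq_corner_vertex:
  assumes "a \<in> {0,1}" "b \<in> {0,1}"
  shows "\<exists>\<rho>. \<rho> permutes {1..n} \<and> (\<forall>j\<in>{1..n}. pt j (a, b) = corner_vertex (\<rho> j))"
proof -
  have inv_in: "inv \<sigma> j \<in> {1..n}" "inv \<tau> j \<in> {1..n}" if "j \<in> {1..n}" for j
    using that permutes_in_image[OF permutes_inv[OF \<sigma>]] permutes_in_image[OF permutes_inv[OF \<tau>]] by auto
  have l: "pt j (0, y) = pt (inv \<sigma> j) (1, y)" if "j \<in> {1..n}" "y \<in> {0..1}" for j y
    using glue_right[OF inv_in(1)[OF that(1)] that(2)] permutes_inverses[OF \<sigma>] by simp
  have b: "pt j (x, 0) = pt (inv \<tau> j) (x, 1)" if "j \<in> {1..n}" "x \<in> {0..1}" for j x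
    using glue_top[OF inv_in(2)[OF that(1)] that(2)] permutes_inverses[OF \<tau>] by simp
  have 1: "pt j (1, 1) = corner_vertex (id j)" "pt j (0, 1) = corner_vertex (inv \<sigma> j)" "pt j (1, 0) = corner_vertex (inv \<tau> j)"
     "pt j (0, 0) = corner_vertex ((inv \<tau> \<circ> inv \<sigma>) j)" if "j \<in> {1..n}" for j
    using l[OF that, of 0] l[OF that, of 1] b[OF that, of 1] b[OF inv_in(1)[OF that], of 1]
    by (simp_all add: corner_vertex_def)
  have 2: "id permutes {1..n}" "inv \<sigma> permutes {1..n}" "inv \<tau> permutes {1..n}"
    "(inv \<tau> \<circ> inv \<sigma>) permutes {1..n}"
    using \<sigma> \<tau> by (auto simp: permutes_id permutes_inv permutes_compose)
  consider "a = 1" "b = 1" | "a = 0" "b = 1" | "a = 1" "b = 0" | "a = 0" "b = 0"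
    using assms by auto
  then show ?thesis
  proof cases
    case 1 then show ?thesis using \<open>\<And>j. j \<in> {1..n} \<Longrightarrow> pt j (1, 1) = corner_vertex (id j)\<close> 2(1) by blast
  next
    case 2 then show ?thesis using 1(2) \<open>inv \<sigma> permutes {1..n}\<close> by blast
  next
    case 3 then show ?thesis using 1(3) \<open>inv \<tau> permutes {1..n}\<close> by blast
  next
    case 4 then show ?thesis using 1(4) \<open>(inv \<tau> \<circ> inv \<sigma>) permutes {1..n}\<close> by blast
  qed
qed

lemma vertices_eq_corner_vertices: "vertices n \<sigma> \<tau> = corner_vertex ` {1..n}"
proof
  show "corner_vertex ` {1..n} \<subseteq> vertices n \<sigma> \<tau>" by (auto simp: corner_vertex_def vertices_def corners_def)
  show "vertices n \<sigma> \<tau> \<subseteq> corner_vertex ` {1..n}"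
  proof
    fix v assume "v \<in> vertices n \<sigma> \<tau>"
    then obtain j a b where "j \<in> {1..n}" "a \<in> {0,1}" "b \<in> {0,1}" "v = pt j (a, b)"
      unfolding vertices_def corners_def by blast
    moreover from corner_eq_corner_vertex[OF this(2,3)] obtain \<rho> where "\<rho> permutes {1..n}" "\<forall>j\<in>{1..n}. pt j (a, b) = corner_vertex (\<rho> j)" by blast
    ultimately show "v \<in> corner_vertex ` {1..n}" using permutes_in_image[of \<rho> "{1..n}" j] by auto
  qed
qed

lemma corner_vertex_corners:
  assumes "j \<in> {1..n}"
  shows "{(j, 1, 1), (\<sigma> j, 0, 1), (\<tau> j, 1, 0), (\<sigma> (\<tau> j), 0, 0), (\<tau> (\<sigma> j), 0, 0)} \<subseteq> corner_vertex j \<inter> corners n"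
proof -
  have j: "\<sigma> j \<in> {1..n}" "\<tau> j \<in> {1..n}" "\<sigma> (\<tau> j) \<in> {1..n}" "\<tau> (\<sigma> j) \<in> {1..n}"
    using assms by (simp_all only: perm_in)
  have "pt (\<sigma> j) (0, 1) = corner_vertex j" "pt (\<tau> j) (1, 0) = corner_vertex j"
    unfolding corner_vertex_def using glue_right[OF assms, of 1] glue_top[OF assms, of 1] by simp_all
  moreover have "pt (\<sigma> (\<tau> j)) (0, 0) = pt (\<tau> j) (1, 0)"
    by (rule glue_right[symmetric]) (use j in auto)
  moreover have "pt (\<tau> (\<sigma> j)) (0, 0) = pt (\<sigma> j) (0, 1)"
    by (rule glue_top[symmetric]) (use j in auto)
  ultimately have "\<forall>p\<in>{(j, 1, 1), (\<sigma> j, 0, 1), (\<tau> j, 1, 0), (\<sigma> (\<tau> j), 0, 0), (\<tau> (\<sigma> j), 0, 0)}. surf_pt n \<sigma> \<tau> p = corner_vertex j"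
    by (simp add: corner_vertex_def)
  then show ?thesis using j assms by (auto simp: corner_vertex_def mem_surf_pt corners_def)
qed

lemma finite_corners: "finite (corners n)" by (simp add: corners_def)

text \<open>
  If \<open>\<sigma>\<close> and \<open>\<tau>\<close> do not commute at \<open>j\<close>, the corners in \<open>corner_vertex_corners\<close> are five distinct
  ones, which exceeds the angle \<open>2 * pi\<close>.
\<close>
lemma cone_point_if_not_commute:
  assumes "j \<in> {1..n}" "\<tau> (\<sigma> j) \<noteq> \<sigma> (\<tau> j)"
  shows "corner_vertex j \<in> cone_points n \<sigma> \<tau>"
proof -
  have "card {(j, 1::real, 1::real), (\<sigma> j, 0, 1), (\<tau> j, 1, 0), (\<sigma> (\<tau> j), 0, 0), (\<tau> (\<sigma> j), 0, 0)} = 5"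
    using assms(2) by auto
  then have "5 \<le> card (corner_vertex j \<inter> corners n)"
    using card_mono[OF _ corner_vertex_corners[OF assms(1)]] finite_corners by simp
  then have "real 5 * (pi / 2) \<le> total_angle n (corner_vertex j)"
    unfolding total_angle_def by (intro mult_right_mono) auto
  moreover have "2 * pi < real 5 * (pi / 2)" by simp
  ultimately have "total_angle n (corner_vertex j) > 2 * pi" by linarith
  then show ?thesis using assms(1) by (simp add: cone_points_def vertices_eq_corner_vertices)
qed

text \<open>
  If they commute at \<open>j\<close>, the four corners are closed under the gluing in both directions.
\<close>
lemma corner_vertex_if_commute:
  assumes "j \<in> {1..n}" "\<tau> (\<sigma> j) = \<sigma> (\<tau> j)"
  shows "corner_vertex j = {(j, 1, 1), (\<sigma> j, 0, 1), (\<tau> j, 1, 0), (\<sigma> (\<tau> j), 0, 0)}" (is "_ = ?Z")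
proof
  show "?Z \<subseteq> corner_vertex j" using corner_vertex_corners[OF assms(1)] by auto
  have inj: "\<sigma> x = \<sigma> y \<longleftrightarrow> x = y" "\<tau> x = \<tau> y \<longleftrightarrow> x = y" for x y
    using permutes_inj[OF \<sigma>] permutes_inj[OF \<tau>] by (auto dest: injD)
  have inv: "p \<in> ?Z \<longleftrightarrow> q \<in> ?Z" if "glued n \<sigma> \<tau> p q" for p q
    using that
  proof cases
    case (right_left i y)
    then show ?thesis by (auto simp: inj assms(2))
  next
    case (top_bottom i x)
    then show ?thesis by (auto simp: inj assms(2)[symmetric])
  qed
  show "corner_vertex j \<subseteq> ?Z"
  proof
    fix p assume "p \<in> corner_vertex j"
    then have "surf_pt n \<sigma> \<tau> p = surf_pt n \<sigma> \<tau> (j, 1, 1)" by (simp add: corner_vertex_def mem_surf_pt)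
    then have "(p \<in> ?Z) = ((j, 1, 1) \<in> ?Z)"
      by (rule surf_pt_invariant[where f = "\<lambda>p. p \<in> ?Z", rotated]) (rule inv)
    then show "p \<in> ?Z" by simp
  qed
qed

lemma not_cone_point_if_commute:
  assumes "j \<in> {1..n}" "\<tau> (\<sigma> j) = \<sigma> (\<tau> j)"
  shows "corner_vertex j \<notin> cone_points n \<sigma> \<tau>"
proof -
  have "card (corner_vertex j \<inter> corners n) \<le> card (corner_vertex j)" by (rule card_mono) (auto simp: corner_vertex_if_commute[OF assms])
  also have "\<dots> = 4" by (simp add: corner_vertex_if_commute[OF assms])
  finally have "total_angle n (corner_vertex j) \<le> real 4 * (pi / 2)"
    unfolding total_angle_def by (intro mult_right_mono) auto
  then show ?thesis by (simp add: cone_points_def)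
qed

end

section \<open>Holonomy and special vertices\<close>

definition primitive :: "(real \<times> real) set" where
  "primitive = {(of_int P, of_int Q) | P Q :: int. coprime P Q}"

context square_tiling begin

lemma cone_sub_vertices: "cone_points n \<sigma> \<tau> \<subseteq> vertices n \<sigma> \<tau>"
  by (auto simp: cone_points_def)

lemma Hol_integral:
  assumes "saddle_connection n \<sigma> \<tau> M v \<gamma>" "M \<subseteq> vertices n \<sigma> \<tau>"
  obtains P Q :: int where "v = (of_int P, of_int Q)" "P \<noteq> 0 \<or> Q \<noteq> 0"
proof -
  have "straight_path n \<sigma> \<tau> v \<gamma>" "\<gamma> 0 \<in> vertices n \<sigma> \<tau>" "\<gamma> 1 \<in> vertices n \<sigma> \<tau>" "v \<noteq> 0"
    using assms cone_sub_vertices unfolding saddle_connection_def by auto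
  then have "1 * fst v \<in> \<int> \<and> 1 * snd v \<in> \<int>" using straight_path_vertex_iff[of v \<gamma> 1] by simp
  then obtain P Q where "fst v = of_int P" "snd v = of_int Q" by (auto elim!: Ints_cases)
  then show ?thesis using that[of P Q] \<open>v \<noteq> 0\<close> by (auto simp: prod_eq_iff)
qed

text \<open>
  If \<open>v\<close> is divisible by \<open>g > 1\<close>, the path is at a vertex at time \<open>1 / g\<close>. This vertex is special, so
  the path is not a saddle connection.
\<close>
lemma Hol_sub_primitive:
  assumes "cone_points n \<sigma> \<tau> \<union> M = vertices n \<sigma> \<tau>"
  shows "Hol n \<sigma> \<tau> M \<subseteq> primitive"
proof
  fix v assume "v \<in> Hol n \<sigma> \<tau> M"
  then obtain \<gamma> where \<gamma>: "saddle_connection n \<sigma> \<tau> M v \<gamma>" by (auto simp: Hol_def)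
  then obtain P Q where PQ: "v = (of_int P, of_int Q)" "P \<noteq> 0 \<or> Q \<noteq> 0"
    by (rule Hol_integral) (use assms in blast)
  have "gcd P Q = 1"
  proof (rule ccontr)
    assume "gcd P Q \<noteq> 1"
    moreover have "gcd P Q > 0" using PQ by (meson gcd_pos_int)
    ultimately have g: "gcd P Q > 1" by linarith
    let ?t = "1 / real_of_int (gcd P Q)"
    have "real_of_int P / real_of_int (gcd P Q) \<in> \<int>" "real_of_int Q / real_of_int (gcd P Q) \<in> \<int>"
      by (simp_all flip: real_of_int_div)
    moreover have "straight_path n \<sigma> \<tau> v \<gamma>" "\<gamma> 0 \<in> vertices n \<sigma> \<tau>"
      using \<gamma> assms by (auto simp: saddle_connection_def)
    moreover have t: "?t \<in> {0<..<1}"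
    proof -
      have "1 / x \<in> {0<..<1}" if "x > 1" for x :: real using that by simp
      moreover have "real_of_int (gcd P Q) > 1" using g by linarith
      ultimately show ?thesis by blast
    qed
    ultimately have "\<gamma> ?t \<in> vertices n \<sigma> \<tau>" using PQ(1) by (subst straight_path_vertex_iff) auto
    then have "\<gamma> ?t \<in> cone_points n \<sigma> \<tau> \<union> M" using assms by simp
    then show False using \<gamma> t unfolding saddle_connection_def by blast
  qed
  then show "v \<in> primitive" using PQ by (auto simp: primitive_def coprime_iff_gcd_eq_1)
qed

text \<open>
  If \<open>x P + y Q = 1\<close>, then \<open>t = x (t P) + y (t Q)\<close>. So \<open>t\<close> is integral whenever the path is at a
  vertex, and the interior contains none.
\<close>
lemma primitive_saddle:
  assumes "coprime P Q" "straight_path n \<sigma> \<tau> (of_int P, of_int Q) \<gamma>" "M \<subseteq> vertices n \<sigma> \<tau>"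
    "\<gamma> 0 \<in> cone_points n \<sigma> \<tau> \<union> M" "\<gamma> 1 \<in> cone_points n \<sigma> \<tau> \<union> M"
  shows "saddle_connection n \<sigma> \<tau> M (of_int P, of_int Q) \<gamma>"
  unfolding saddle_connection_def
proof (intro conjI ballI notI)
  show "False" if "(real_of_int P, real_of_int Q) = 0"
    using that assms(1) by (simp add: zero_prod_def)
  fix t :: real assume t: "t \<in> {0<..<1}" "\<gamma> t \<in> cone_points n \<sigma> \<tau> \<union> M"
  then have "\<gamma> t \<in> vertices n \<sigma> \<tau>" "\<gamma> 0 \<in> vertices n \<sigma> \<tau>" using assms cone_sub_vertices by auto
  then have "t * P \<in> \<int>" "t * Q \<in> \<int>"
    using straight_path_vertex_iff[OF assms(2), of t] t by auto
  moreover obtain x y where "x * P + y * Q = 1" using bezout_int[of P Q] assms(1) by (auto simp: coprime_iff_gcd_eq_1)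
  then have "t = of_int x * (t * P) + of_int y * (t * Q)"
    by (metis (no_types, lifting) distrib_left mult.left_commute mult.right_neutral of_int_1 of_int_add of_int_mult)
  ultimately have "t \<in> \<int>" by (metis Ints_add Ints_mult Ints_of_int)
  then show False using t by (auto elim!: Ints_cases)
qed (use assms in auto)

text \<open>
  In a given direction, the segments that start at a nonspecial vertex and those that end at one are
  both at most as many as the squares whose upper right corner is not special. If these are fewer
  than half of all squares, some segment remains.
\<close>
lemma primitive_sub_Hol:
  assumes M: "M \<subseteq> vertices n \<sigma> \<tau>" and few: "2 * card {j\<in>{1..n}. corner_vertex j \<notin> cone_points n \<sigma> \<tau> \<union> M} < n"
  shows "primitive \<subseteq> Hol n \<sigma> \<tau> M"
proof
  fix v assume "v \<in> primitive"
  then obtain P Q :: int where v: "v = (of_int P, of_int Q)" "coprime P Q" by (auto simp: primitive_def)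
  let ?B = "{j\<in>{1..n}. corner_vertex j \<notin> cone_points n \<sigma> \<tau> \<union> M}"
  obtain a b a' b' w where ab: "a \<in> {0,1}" "b \<in> {0,1}" "a' \<in> {0,1}" "b' \<in> {0,1}" "w permutes {1..n}"
    and path: "\<forall>j\<in>{1..n}. \<exists>\<gamma>. straight_path n \<sigma> \<tau> v \<gamma> \<and> \<gamma> 0 = pt j (a, b) \<and> \<gamma> 1 = pt (w j) (a', b')"
    using primitive_path[OF v(2)] v(1) by blast
  obtain \<rho> where \<rho>: "\<rho> permutes {1..n}" "\<forall>j\<in>{1..n}. pt j (a, b) = corner_vertex (\<rho> j)" using corner_eq_corner_vertex[OF ab(1,2)] by blast
  obtain \<rho>' where \<rho>': "\<rho>' permutes {1..n}" "\<forall>j\<in>{1..n}. pt j (a', b') = corner_vertex (\<rho>' j)" using corner_eq_corner_vertex[OF ab(3,4)] by blast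
  have pre: "card {j\<in>{1..n}. \<pi> j \<in> ?B} \<le> card ?B" if "\<pi> permutes {1..n}" for \<pi>
    by (rule card_inj_on_le[where f = \<pi>]) (use permutes_inj_on[OF that] in auto)
  have "card ({j\<in>{1..n}. \<rho> j \<in> ?B} \<union> {j\<in>{1..n}. (\<rho>' \<circ> w) j \<in> ?B}) \<le> card ?B + card ?B"
    using pre[OF \<rho>(1)] pre[OF permutes_compose[OF ab(5) \<rho>'(1)]]
    by (intro order_trans[OF card_Un_le add_mono])
  also have "\<dots> < card {1..n}" using few by simp
  finally have "\<not> {1..n} \<subseteq> {j\<in>{1..n}. \<rho> j \<in> ?B} \<union> {j\<in>{1..n}. (\<rho>' \<circ> w) j \<in> ?B}"
    using card_mono[of "{j\<in>{1..n}. \<rho> j \<in> ?B} \<union> {j\<in>{1..n}. (\<rho>' \<circ> w) j \<in> ?B}" "{1..n}"]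
    by (auto simp: not_less simp del: card_atLeastAtMost)
  then obtain j where "j \<in> {1..n}" "j \<notin> {j\<in>{1..n}. \<rho> j \<in> ?B} \<union> {j\<in>{1..n}. (\<rho>' \<circ> w) j \<in> ?B}" by blast
  then have j: "j \<in> {1..n}" "\<rho> j \<notin> ?B" "\<rho>' (w j) \<notin> ?B" unfolding o_apply by blast+
  have in_S: "\<rho> j \<in> {1..n}" "w j \<in> {1..n}" "\<rho>' (w j) \<in> {1..n}"
    using j(1) permutes_in_image[OF \<rho>(1)] permutes_in_image[OF \<rho>'(1)] permutes_in_image[OF ab(5)] by auto
  obtain \<gamma> where "straight_path n \<sigma> \<tau> v \<gamma>" "\<gamma> 0 = corner_vertex (\<rho> j)" "\<gamma> 1 = corner_vertex (\<rho>' (w j))"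
    using path j(1) \<rho>(2) \<rho>'(2) in_S by metis
  then have "saddle_connection n \<sigma> \<tau> M v \<gamma>"
    unfolding v(1) using j in_S by (intro primitive_saddle v(2) M) auto
  then show "v \<in> Hol n \<sigma> \<tau> M" by (auto simp: Hol_def)
qed

lemma Hol_all_special:
  assumes "cone_points n \<sigma> \<tau> \<union> M = vertices n \<sigma> \<tau>" "n \<ge> 1"
  shows "Hol n \<sigma> \<tau> M = primitive"
proof
  show "Hol n \<sigma> \<tau> M \<subseteq> primitive" by (rule Hol_sub_primitive[OF assms(1)])
  have none: "{j\<in>{1..n}. corner_vertex j \<notin> cone_points n \<sigma> \<tau> \<union> M} = {}" unfolding assms(1) vertices_eq_corner_vertices by auto
  show "primitive \<subseteq> Hol n \<sigma> \<tau> M"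
  proof (rule primitive_sub_Hol)
    show "M \<subseteq> vertices n \<sigma> \<tau>" using assms(1) by blast
    show "2 * card {j\<in>{1..n}. corner_vertex j \<notin> cone_points n \<sigma> \<tau> \<union> M} < n" unfolding none using assms(2) by simp
  qed
qed

end

lemma Hol_torus_primitive: "Hol_torus = primitive"
proof -
  interpret square_tiling 1 id id by standard (simp_all add: permutes_id)
  have "vertices 1 id id = {surf_pt 1 id id (1, 0, 0)}"
    unfolding vertices_eq_corner_vertices corner_vertex_def using glue_right[of 1 1] glue_top[of 1 0] by simp
  then show ?thesis
    unfolding Hol_torus_def using cone_sub_vertices by (intro Hol_all_special) auto
qed

context square_tiling begin

text \<open>
  Otherwise, continue along the row or column from the special vertex at \<open>j\<close> to the next special
  vertex, which exists since \<open>\<pi>\<close> has finite order. This is a saddle connection of length at least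
  2 along a coordinate axis.
\<close>
lemma special_along_edges:
  assumes e: "e = (1, 0) \<or> e = (0, 1)"
    and perm: "\<pi> permutes {1..n}" and glue: "\<And>j. j \<in> {1..n} \<Longrightarrow> pt j e = pt (\<pi> j) 0"
    and M: "M \<subseteq> vertices n \<sigma> \<tau>" and Hol: "Hol n \<sigma> \<tau> M \<subseteq> primitive"
    and j: "j \<in> {1..n}" "pt j 0 \<in> cone_points n \<sigma> \<tau> \<union> M"
  shows "pt (\<pi> j) 0 \<in> cone_points n \<sigma> \<tau> \<union> M"
proof (rule ccontr)
  assume ns: "pt (\<pi> j) 0 \<notin> cone_points n \<sigma> \<tau> \<union> M"
  let ?sp = "\<lambda>k. pt ((\<pi> ^^ k) j) 0 \<in> cone_points n \<sigma> \<tau> \<union> M"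
  have in_range: "\<And>j. j \<in> {1..n} \<Longrightarrow> \<pi> j \<in> {1..n}" using permutes_in_image[OF perm] by blast
  have "permutation \<pi>" using perm permutation_permutes by blast
  then obtain r where "r > 0" "\<pi> ^^ r = id" using permutation_is_nilpotent by blast
  then have ex: "\<exists>k. k > 0 \<and> ?sp k" using j by (intro exI[of _ r]) auto
  define k where "k = (LEAST k. k > 0 \<and> ?sp k)"
  have k: "k > 0" "?sp k" using LeastI_ex[OF ex] by (auto simp: k_def)
  have least: "\<not> ?sp i" if "0 < i" "i < k" for i using not_less_Least[of i "\<lambda>k. k > 0 \<and> ?sp k"] that by (auto simp: k_def)
  have "k \<noteq> 1" using ns k(2) by (intro notI) simp
  then have k2: "k \<ge> 2" using k(1) by simp
  obtain \<gamma> where \<gamma>: "straight_path n \<sigma> \<tau> (real k *\<^sub>R e) \<gamma>" "\<forall>i\<le>k. \<gamma> (i / k) = pt ((\<pi> ^^ i) j) 0"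
    using edge_path[OF e, of \<pi> j k] in_range glue j k by auto
  have \<gamma>0: "\<gamma> 0 \<in> cone_points n \<sigma> \<tau> \<union> M" using \<gamma>(2)[rule_format, of 0] j by simp
  have "saddle_connection n \<sigma> \<tau> M (real k *\<^sub>R e) \<gamma>"
    unfolding saddle_connection_def
  proof (intro conjI ballI notI)
    show False if "real k *\<^sub>R e = 0" using that e k by (auto simp: zero_prod_def)
    show "\<gamma> 1 \<in> cone_points n \<sigma> \<tau> \<union> M" using \<gamma>(2)[rule_format, of k] k by simp
    fix t :: real assume t: "t \<in> {0<..<1}" "\<gamma> t \<in> cone_points n \<sigma> \<tau> \<union> M"
    then have "\<gamma> t \<in> vertices n \<sigma> \<tau>" "\<gamma> 0 \<in> vertices n \<sigma> \<tau>" using \<gamma>0 M cone_sub_vertices by auto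
    then have "t * k \<in> \<int>" using straight_path_vertex_iff[OF \<gamma>(1), of t] t e by auto
    then obtain z :: int where z: "t * k = z" by (auto elim: Ints_cases)
    have "0 < t * k" "t * k < 1 * k" using t k by (auto intro!: mult_strict_right_mono)
    then have "0 < z" "z < int k" using z by auto
    then have "t = real (nat z) / k" "0 < nat z" "nat z < k" using z k by (auto simp: field_simps)
    then show False using least[of "nat z"] \<gamma>(2)[rule_format, of "nat z"] t(2) by auto
  qed (use \<gamma> \<gamma>0 in auto)
  then have "real k *\<^sub>R e \<in> primitive" using Hol by (auto simp: Hol_def)
  then obtain P Q :: int where PQ: "coprime P Q" "real k *\<^sub>R e = (of_int P, of_int Q)" by (auto simp: primitive_def)
  then have "(P = int k \<and> Q = 0) \<or> (P = 0 \<and> Q = int k)" using e by auto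
  then show False using PQ(1) k2 by auto
qed

text \<open>
  The gluing never leads out of a set of labels invariant under \<open>\<sigma>\<close> and \<open>\<tau>\<close>, and labels are a
  discrete coordinate.
\<close>
lemma openin_label_set:
  assumes inv: "\<And>j. j \<in> {1..n} \<Longrightarrow> \<sigma> j \<in> L \<longleftrightarrow> j \<in> L" "\<And>j. j \<in> {1..n} \<Longrightarrow> \<tau> j \<in> L \<longleftrightarrow> j \<in> L"
  shows "openin (sts n \<sigma> \<tau>) (surf_pt n \<sigma> \<tau> ` {p\<in>squares n. fst p \<in> L})"
    and "\<And>p. surf_pt n \<sigma> \<tau> p \<in> surf_pt n \<sigma> \<tau> ` {p\<in>squares n. fst p \<in> L} \<Longrightarrow> fst p \<in> L"
proof -
  have same: "fst p \<in> L \<longleftrightarrow> fst q \<in> L" if "surf_pt n \<sigma> \<tau> p = surf_pt n \<sigma> \<tau> q" for p q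
    by (rule surf_pt_invariant[where f = "\<lambda>p. fst p \<in> L", OF _ that]) (auto simp: inv elim!: glued.cases)
  show label: "fst p \<in> L" if "surf_pt n \<sigma> \<tau> p \<in> surf_pt n \<sigma> \<tau> ` {p\<in>squares n. fst p \<in> L}" for p
  proof -
    from that obtain q where "q \<in> squares n" "fst q \<in> L" "surf_pt n \<sigma> \<tau> p = surf_pt n \<sigma> \<tau> q"
      by blast
    then show ?thesis using same[of p q] by blast
  qed
  have "{p \<in> squares n. surf_pt n \<sigma> \<tau> p \<in> surf_pt n \<sigma> \<tau> ` {p\<in>squares n. fst p \<in> L}} = squares n \<inter> (L \<times> UNIV)"
  proof (intro set_eqI iffI)
    fix p assume "p \<in> {p \<in> squares n. surf_pt n \<sigma> \<tau> p \<in> surf_pt n \<sigma> \<tau> ` {p\<in>squares n. fst p \<in> L}}"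
    then have "p \<in> squares n" "fst p \<in> L" using label by blast+
    then show "p \<in> squares n \<inter> (L \<times> UNIV)" by (simp add: mem_Times_iff)
  next
    fix p assume "p \<in> squares n \<inter> (L \<times> UNIV)"
    then have "p \<in> squares n" "fst p \<in> L" by (simp_all add: mem_Times_iff)
    then show "p \<in> {p \<in> squares n. surf_pt n \<sigma> \<tau> p \<in> surf_pt n \<sigma> \<tau> ` {p\<in>squares n. fst p \<in> L}}" by blast
  qed
  moreover have "open (L \<times> (UNIV :: (real \<times> real) set))" by (intro open_Times Topological_Spaces.open_discrete open_UNIV)
  ultimately show "openin (sts n \<sigma> \<tau>) (surf_pt n \<sigma> \<tau> ` {p\<in>squares n. fst p \<in> L})"
    unfolding openin_sts by (auto simp: surface_def intro: openin_open_Int)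
qed

text \<open>
  The part of the surface over an invariant set of labels is open, and so is the part over the
  complementary labels. A connected component lies in one of the two.
\<close>
lemma label_set_component:
  assumes inv: "\<And>j. j \<in> {1..n} \<Longrightarrow> \<sigma> j \<in> L \<longleftrightarrow> j \<in> L" "\<And>j. j \<in> {1..n} \<Longrightarrow> \<tau> j \<in> L \<longleftrightarrow> j \<in> L"
    and C: "C \<in> connected_components_of (sts n \<sigma> \<tau>)"
    and p: "p \<in> squares n" "q \<in> squares n" "surf_pt n \<sigma> \<tau> p \<in> C" "surf_pt n \<sigma> \<tau> q \<in> C" "fst p \<in> L"
  shows "fst q \<in> L"
proof -
  let ?U = "\<lambda>L. surf_pt n \<sigma> \<tau> ` {p\<in>squares n. fst p \<in> L}"
  have o: "openin (sts n \<sigma> \<tau>) (?U L)" "openin (sts n \<sigma> \<tau>) (?U (- L))"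
    by (rule openin_label_set; use inv in auto)+
  have "surface n \<sigma> \<tau> - ?U L = ?U (- L)"
  proof
    show "surface n \<sigma> \<tau> - ?U L \<subseteq> ?U (- L)" by (auto simp: surface_def)
    show "?U (- L) \<subseteq> surface n \<sigma> \<tau> - ?U L"
    proof
      fix x assume "x \<in> ?U (- L)"
      then obtain r where r: "r \<in> squares n" "fst r \<notin> L" "x = surf_pt n \<sigma> \<tau> r" by blast
      then have "x \<notin> ?U L" using openin_label_set(2)[OF inv] by blast
      then show "x \<in> surface n \<sigma> \<tau> - ?U L" using r by (simp add: surface_def)
    qed
  qed
  then have "closedin (sts n \<sigma> \<tau>) (?U L)"
    using o openin_subset[OF o(1)] by (simp add: closedin_def topspace_sts)
  then have "C \<subseteq> ?U L \<or> disjnt C (?U L)"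
    using connectedin_clopen_cases[OF connectedin_connected_components_of[OF C]] o by blast
  moreover have "surf_pt n \<sigma> \<tau> p \<in> ?U L" using p by auto
  ultimately have "surf_pt n \<sigma> \<tau> q \<in> ?U L" using p by (auto simp: disjnt_def)
  then show ?thesis by (rule openin_label_set(2)[rotated 2]) (use inv in auto)
qed

lemma square_connected: "j \<in> {1..n} \<Longrightarrow> connectedin (sts n \<sigma> \<tau>) (pt j ` box)"
proof -
  assume j: "j \<in> {1..n}"
  have "connected ({j} \<times> box)"
    by (intro connected_Times) auto
  moreover have "{j} \<times> box \<subseteq> squares n" using j by (auto simp: squares_def)
  ultimately have "connectedin (top_of_set (squares n)) ({j} \<times> box)"
    by (simp add: connectedin_subtopology)
  then have "connectedin (sts n \<sigma> \<tau>) (surf_pt n \<sigma> \<tau> ` ({j} \<times> box))"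
    by (rule connectedin_continuous_map_image[OF quotient_imp_continuous_map[OF quotient_map_sts]])
  also have "surf_pt n \<sigma> \<tau> ` ({j} \<times> box) = pt j ` box" by (auto simp: image_iff)
  finally show ?thesis .
qed

end

locale marked_square_tiling = square_tiling +
  fixes M
  assumes n1: "n \<ge> 1" and marking: "marking n \<sigma> \<tau> M"
begin

lemma M_sub: "M \<subseteq> vertices n \<sigma> \<tau>" using marking by (simp add: marking_def)

abbreviation special where "special \<equiv> cone_points n \<sigma> \<tau> \<union> M"

lemma component_of_vertex:
  assumes "v \<in> vertices n \<sigma> \<tau>"
  obtains C where "C \<in> connected_components_of (sts n \<sigma> \<tau>)" "v \<in> C"
proof -
  have "v \<in> surface n \<sigma> \<tau>"
    using assms by (auto simp: vertices_def surface_def corners_def squares_def)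
  then have "v \<in> \<Union> (connected_components_of (sts n \<sigma> \<tau>))"
    by (simp add: Union_connected_components_of topspace_sts)
  then show ?thesis using that by blast
qed

lemma vertex_origin:
  assumes "v \<in> vertices n \<sigma> \<tau>" obtains j where "j \<in> {1..n}" "v = pt j 0"
proof -
  obtain i where i: "i \<in> {1..n}" "v = pt i (1, 1)" using assms by (auto simp: vertices_eq_corner_vertices corner_vertex_def)
  then have "v = pt (\<tau> (\<sigma> i)) 0"
    using glue_right[OF i(1), of 1] glue_top[of "\<sigma> i" 0] i(1) perm_in(1)[of i] by (simp add: zero_prod_def)
  moreover have "\<tau> (\<sigma> i) \<in> {1..n}" using i(1) by (simp only: perm_in)
  ultimately show ?thesis using that by blast
qed

text \<open>
  By \<open>special_along_edges\<close> the squares whose lower left corner is special form an invariant set of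
  labels, hence a union of components. As each component contains a special vertex, this set
  consists of all squares.
\<close>
lemma all_special_if_primitive:
  assumes "Hol n \<sigma> \<tau> M \<subseteq> primitive"
  shows "special = vertices n \<sigma> \<tau>"
proof (rule ccontr)
  assume "special \<noteq> vertices n \<sigma> \<tau>"
  then obtain v where v: "v \<in> vertices n \<sigma> \<tau>" "v \<notin> special" using cone_sub_vertices M_sub by blast
  define L where "L = {j\<in>{1..n}. pt j 0 \<in> special}"
  have inv: "\<pi> j \<in> L \<longleftrightarrow> j \<in> L"
    if "e = (1, 0) \<or> e = (0, 1)" "\<pi> permutes {1..n}" "\<And>j. j \<in> {1..n} \<Longrightarrow> pt j e = pt (\<pi> j) 0" for \<pi> e j
  proof -
    have "\<pi> ` L \<subseteq> L"
      using special_along_edges[OF that(1,2,3) M_sub assms] permutes_in_image[OF that(2)] by (auto simp: L_def)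
    moreover have "finite L" by (simp add: L_def)
    ultimately have "\<pi> ` L = L"
      using endo_inj_surj permutes_inj_on[OF that(2)] by blast
    then show ?thesis using permutes_inj[OF that(2)] by (metis imageI image_iff injD)
  qed
  have inv1: "\<sigma> j \<in> L \<longleftrightarrow> j \<in> L" for j
    by (rule inv[of "(1, 0)"]) (use \<sigma> glue_right[of _ 0] in \<open>auto simp: zero_prod_def\<close>)
  have inv2: "\<tau> j \<in> L \<longleftrightarrow> j \<in> L" for j
    by (rule inv[of "(0, 1)"]) (use \<tau> glue_top[of _ 0] in \<open>auto simp: zero_prod_def\<close>)
  obtain C where C: "C \<in> connected_components_of (sts n \<sigma> \<tau>)" "v \<in> C" using component_of_vertex[OF v(1)] .
  have "\<exists>s. s \<in> C \<and> s \<in> special"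
  proof (cases "C \<inter> cone_points n \<sigma> \<tau> = {}")
    case True
    then have "card (M \<inter> C) = 1" using marking C(1) by (auto simp: marking_def)
    then have "M \<inter> C \<noteq> {}" by (intro notI) simp
    then show ?thesis by blast
  qed blast
  then obtain s where s: "s \<in> C" "s \<in> special" by blast
  then have "s \<in> vertices n \<sigma> \<tau>" using cone_sub_vertices M_sub by blast
  then obtain i where i: "i \<in> {1..n}" "s = pt i 0" using vertex_origin by blast
  obtain j where j: "j \<in> {1..n}" "v = pt j 0" using vertex_origin[OF v(1)] by blast
  have "fst (j, 0 :: real \<times> real) \<in> L"
    by (rule label_set_component[of L C "(i, 0)"])
       (use inv1 inv2 C i j s in \<open>auto simp: L_def squares_def zero_prod_def\<close>)
  then show False using v j by (simp add: L_def)
qed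

text \<open>
  The upper right vertex of square \<open>j\<close> has angle \<open>2 * pi\<close> and must be marked. Its component then has no cone points and
  only one marked vertex, hence only one vertex altogether, so that the four corners of square \<open>j\<close>
  are the four corners at this vertex.
\<close>
lemma fixed_square_if_all_special:
  assumes all: "special = vertices n \<sigma> \<tau>" and j: "j \<in> {1..n}" "\<tau> (\<sigma> j) = \<sigma> (\<tau> j)"
  shows "\<sigma> j = j \<and> \<tau> j = j"
proof -
  have v: "corner_vertex j \<in> vertices n \<sigma> \<tau>" using j by (simp add: vertices_eq_corner_vertices)
  then have vM: "corner_vertex j \<in> M" using all not_cone_point_if_commute[OF j] by blast
  obtain C where C: "C \<in> connected_components_of (sts n \<sigma> \<tau>)" "corner_vertex j \<in> C" using component_of_vertex[OF v] .
  have C0: "C \<inter> cone_points n \<sigma> \<tau> = {}" "card (M \<inter> C) = 1"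
    using marking C vM unfolding marking_def by (auto split: if_splits)
  have "(1, 1) \<in> box" by simp
  then have "corner_vertex j \<in> pt j ` box" unfolding corner_vertex_def by (rule imageI)
  then have sub: "pt j ` box \<subseteq> C"
    using connected_components_of_maximal[OF C(1) square_connected[OF j(1)]] C(2) by (auto simp: disjnt_def)
  have "pt j (a, b) = corner_vertex j" if "a \<in> {0,1}" "b \<in> {0,1}" for a b
  proof -
    have "(a, b) \<in> box" using that by auto
    then have "pt j (a, b) \<in> C" using sub by blast
    moreover have "pt j (a, b) \<in> vertices n \<sigma> \<tau>" using that j(1) by (auto simp: vertices_def corners_def)
    ultimately have "pt j (a, b) \<in> M \<inter> C" using all C0(1) by blast
    moreover have "corner_vertex j \<in> M \<inter> C" using vM C by blast
    ultimately show ?thesis using C0(2) by (metis card_1_singletonE singletonD)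
  qed
  then have "(j, a, b) \<in> corner_vertex j" if "a \<in> {0,1}" "b \<in> {0,1}" for a b
    using that surf_pt_self[of "(j, a, b)"] by metis
  from this[of 0 1] this[of 1 0] show ?thesis by (auto simp: corner_vertex_if_commute[OF j])
qed

theorem holonomy_torus_if_none_commute:
  assumes "\<And>j. j \<in> {1..n} \<Longrightarrow> \<tau> (\<sigma> j) \<noteq> \<sigma> (\<tau> j)"
  shows "holonomy_torus n \<sigma> \<tau> M"
proof -
  have "special = vertices n \<sigma> \<tau>"
    using assms cone_point_if_not_commute M_sub cone_sub_vertices unfolding vertices_eq_corner_vertices by blast
  then show ?thesis unfolding holonomy_torus_def Hol_torus_primitive using n1 by (rule Hol_all_special)
qed

theorem fixed_if_holonomy_torus:
  assumes "holonomy_torus n \<sigma> \<tau> M" "j \<in> {1..n}" "\<tau> (\<sigma> j) = \<sigma> (\<tau> j)"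
  shows "\<sigma> j = j \<and> \<tau> j = j"
  using fixed_square_if_all_special[OF all_special_if_primitive] assms
  by (simp add: holonomy_torus_def Hol_torus_primitive)

theorem visibility_if_few_commute:
  assumes "2 * card {j\<in>{1..n}. \<tau> (\<sigma> j) = \<sigma> (\<tau> j)} < n"
  shows "visibility_sts n \<sigma> \<tau> M"
  unfolding visibility_sts_def Hol_torus_primitive
proof (rule primitive_sub_Hol[OF M_sub])
  have "card {j\<in>{1..n}. corner_vertex j \<notin> special} \<le> card {j\<in>{1..n}. \<tau> (\<sigma> j) = \<sigma> (\<tau> j)}"
    using cone_point_if_not_commute by (intro card_mono) auto
  with assms show "2 * card {j\<in>{1..n}. corner_vertex j \<notin> special} < n" by linarith
qed

end

section \<open>Averaging over a conjugacy class\<close>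

text \<open>
  Needed because the uniform distribution on the conjugacy class is meaningful only if the class is
  nonempty. Each new part of size \<open>k\<close> is realised by a cyclic rotation of \<open>k\<close> fresh points.
\<close>
lemma exists_perm_of_cycle_type:
  "is_partition \<mu> n \<Longrightarrow> \<exists>\<sigma>. \<sigma> permutes {1..n} \<and> cycle_type n \<sigma> = \<mu>"
proof (induction \<mu> arbitrary: n)
  case empty
  then show ?case by (intro exI[of _ id]) (auto simp: is_partition_def cycle_type_def permutes_id)
next
  case (add k \<mu>)
  define m where "m = sum_mset \<mu>"
  have k: "k > 0" and n: "n = m + k" and "is_partition \<mu> m"
    using add.prems by (auto simp: is_partition_def m_def)
  then obtain \<sigma> where \<sigma>: "\<sigma> permutes {1..m}" "cycle_type m \<sigma> = \<mu>" using add.IH by blast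
  define B where "B = {m+1..m+k}"
  define rot where "rot x = (if x \<in> B then if x = m + k then m + 1 else x + 1 else x)" for x
  have rotB: "rot x \<in> B" if "x \<in> B" for x using that k by (auto simp: rot_def B_def)
  have "inj_on rot B" by (auto simp: inj_on_def rot_def B_def split: if_splits)
  moreover from this have "rot ` B = B" by (intro endo_inj_surj) (use rotB in \<open>auto simp: B_def\<close>)
  ultimately have "bij_betw rot B B" by (simp add: bij_betw_def)
  then have rot: "rot permutes B" by (rule bij_imp_permutes) (simp add: rot_def)
  define \<sigma>' where "\<sigma>' = \<sigma> \<circ> rot"
  have "\<sigma> permutes {1..n}" "rot permutes {1..n}"
    using permutes_subset[OF \<sigma>(1)] permutes_subset[OF rot] n by (auto simp: B_def)
  then have perm: "\<sigma>' permutes {1..n}" unfolding \<sigma>'_def by (rule permutes_compose[rotated])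
  then have permutation: "permutation \<sigma>'" using permutation_permutes by blast
  have lo: "\<sigma>' x = \<sigma> x" "\<sigma> x \<in> {1..m}" if "x \<in> {1..m}" for x
    using that permutes_in_image[OF \<sigma>(1)] by (auto simp: \<sigma>'_def rot_def B_def)
  have hi: "\<sigma>' x = rot x" if "x \<in> B" for x
    using rotB[OF that] permutes_not_in[OF \<sigma>(1)] by (auto simp: \<sigma>'_def B_def)
  have orbit_lo: "orbit \<sigma>' x = orbit \<sigma> x" if x: "x \<in> {1..m}" for x
  proof
    have "y \<in> orbit \<sigma> x \<and> y \<in> {1..m}" if "y \<in> orbit \<sigma>' x" for y
      using that by induction (use x lo in \<open>auto simp del: atLeastAtMost_iff intro: orbit.intros\<close>)
    then show "orbit \<sigma>' x \<subseteq> orbit \<sigma> x" by blast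
    have "y \<in> orbit \<sigma>' x \<and> y \<in> {1..m}" if "y \<in> orbit \<sigma> x" for y
      using that
    proof induction
      case base
      show ?case using lo[OF x] orbit.base[of \<sigma>' x] by simp
    next
      case (step y)
      then show ?case using lo[of y] orbit.step[of y \<sigma>' x] by simp
    qed
    then show "orbit \<sigma> x \<subseteq> orbit \<sigma>' x" by blast
  qed
  have orbit_hi: "orbit \<sigma>' x = B" if x: "x \<in> B" for x
  proof -
    have sub: "orbit \<sigma>' y \<subseteq> B" if y: "y \<in> B" for y
    proof
      fix z assume "z \<in> orbit \<sigma>' y"
      then show "z \<in> B" by induction (use y hi rotB in auto)
    qed
    have "m + Suc i \<in> orbit \<sigma>' (m + 1)" if "i < k" for i
      using that
    proof (induction i)
      case 0
      then show ?case using permutation_self_in_orbit[OF permutation, of "m + 1"] by simp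
    next
      case (Suc i)
      then have "\<sigma>' (m + Suc i) = m + Suc (Suc i)" by (subst hi) (auto simp: B_def rot_def)
      then show ?case using Suc orbit.step[of "m + Suc i" \<sigma>' "m + 1"] by simp
    qed
    then have all: "y \<in> orbit \<sigma>' (m + 1)" if "y \<in> B" for y
    proof -
      have "y = m + Suc (y - m - 1)" "y - m - 1 < k" using that by (auto simp: B_def)
      then show ?thesis using \<open>\<And>i. i < k \<Longrightarrow> m + Suc i \<in> orbit \<sigma>' (m + 1)\<close> by metis
    qed
    have "orbit \<sigma>' x = orbit \<sigma>' (m + 1)"
      using all[OF x] permutation_self_in_orbit[OF permutation] by (metis orbit_cyclic_eq3 cyclic_on_def orbit_subset orbit_swap subset_antisym)
    then show ?thesis using all sub[of "m + 1"] k by (auto simp: B_def)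
  qed
  have "{1..n} = {1..m} \<union> B" using n by (auto simp: B_def)
  then have "orbit \<sigma>' ` {1..n} = orbit \<sigma>' ` {1..m} \<union> orbit \<sigma>' ` B" by (simp only: image_Un)
  also have "orbit \<sigma>' ` {1..m} = orbit \<sigma> ` {1..m}" using orbit_lo by (intro image_cong refl)
  also have "orbit \<sigma>' ` B = {B}" proof -
    have "B \<noteq> {}" using k by (auto simp: B_def)
    then show ?thesis using orbit_hi by auto
  qed
  finally have orbits: "orbit \<sigma>' ` {1..n} = insert B (orbit \<sigma> ` {1..m})" by simp
  have "B \<notin> orbit \<sigma> ` {1..m}"
  proof
    assume "B \<in> orbit \<sigma> ` {1..m}"
    then obtain x where "x \<in> {1..m}" "B = orbit \<sigma> x" by auto
    then have "\<sigma> x \<in> B" using orbit.base[of \<sigma> x] by simp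
    then show False using lo[OF \<open>x \<in> {1..m}\<close>] by (auto simp: B_def)
  qed
  then have "cycle_type n \<sigma>' = add_mset (card B) (cycle_type m \<sigma>)"
    unfolding cycle_type_def orbits by simp
  then have "cycle_type n \<sigma>' = add_mset k \<mu>" using \<sigma>(2) by (simp add: B_def)
  then show ?case using perm by blast
qed

lemma conj_class_props:
  assumes "is_partition \<mu> n"
  shows "conj_class n \<mu> \<noteq> {}" "finite (conj_class n \<mu>)" "finite (sym_perms n)" "card (sym_perms n) = fact n"
    "sym_perms n \<noteq> {}"
proof -
  show "conj_class n \<mu> \<noteq> {}"
    using exists_perm_of_cycle_type[OF assms] by (auto simp: conj_class_def sym_perms_def)
  show f: "finite (sym_perms n)" "card (sym_perms n) = fact n"
    by (simp_all add: sym_perms_def finite_permutations card_permutations)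
  show "finite (conj_class n \<mu>)" by (rule finite_subset[OF _ f(1)]) (auto simp: conj_class_def)
  show "sym_perms n \<noteq> {}" using permutes_id[of "{1..n}"] unfolding sym_perms_def by blast
qed

lemma size_cycle_type: "size (cycle_type n \<sigma>) = card (orbit \<sigma> ` {1..n})"
  by (simp add: cycle_type_def)

lemma prob_random_pair:
  assumes "is_partition \<mu> n"
    and "\<And>\<sigma>. \<sigma> \<in> conj_class n \<mu> \<Longrightarrow> \<bar>real (card {\<tau>\<in>sym_perms n. E \<sigma> \<tau>}) / fact n - l\<bar> \<le> B"
  shows "\<bar>measure_pmf.prob (random_pair n \<mu>) {(\<sigma>, \<tau>). E \<sigma> \<tau>} - l\<bar> \<le> B"
proof -
  note cp = conj_class_props[OF assms(1)]
  let ?C = "conj_class n \<mu>"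
  have pos: "real (card ?C) > 0" using cp by (simp add: card_gt_0_iff)
  have "(?C \<times> sym_perms n) \<inter> {(\<sigma>, \<tau>). E \<sigma> \<tau>} = Sigma ?C (\<lambda>\<sigma>. {\<tau>\<in>sym_perms n. E \<sigma> \<tau>})" by auto
  then have "measure_pmf.prob (random_pair n \<mu>) {(\<sigma>, \<tau>). E \<sigma> \<tau>}
      = real (\<Sum>\<sigma>\<in>?C. card {\<tau>\<in>sym_perms n. E \<sigma> \<tau>}) / (real (card ?C) * fact n)"
    unfolding random_pair_def using cp
    by (subst measure_pmf_of_set) (auto simp: card_cartesian_product)
  also have "\<dots> = (\<Sum>\<sigma>\<in>?C. real (card {\<tau>\<in>sym_perms n. E \<sigma> \<tau>}) / fact n) / card ?C"
    by (simp add: sum_divide_distrib[symmetric] field_simps)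
  finally have eq: "measure_pmf.prob (random_pair n \<mu>) {(\<sigma>, \<tau>). E \<sigma> \<tau>} - l
      = (\<Sum>\<sigma>\<in>?C. real (card {\<tau>\<in>sym_perms n. E \<sigma> \<tau>}) / fact n - l) / card ?C"
    using pos by (simp add: sum_subtractf diff_divide_distrib)
  have "\<bar>\<Sum>\<sigma>\<in>?C. real (card {\<tau>\<in>sym_perms n. E \<sigma> \<tau>}) / fact n - l\<bar> \<le> (\<Sum>\<sigma>\<in>?C. B)"
    using assms(2) by (intro order_trans[OF sum_abs] sum_mono)
  then show ?thesis unfolding eq using pos by (simp add: pos_divide_le_eq mult.commute)
qed

section \<open>Asymptotics\<close>

text \<open>
  The event lies between \<open>num_commuting \<tau> = 0\<close> and the union of this event with the existence of a
  common fixed point of \<open>\<sigma>\<close> and \<open>\<tau>\<close>, which adds at most \<open>card Fix / n\<close> to the probability.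
\<close>
lemma holonomy_estimate:
  fixes n :: nat
  assumes n: "n \<ge> 3" and \<sigma>: "\<sigma> permutes {1..n}" and c: "c = card (orbit \<sigma> ` {1..n})" "c\<^sup>2 \<le> n"
    and M: "\<And>\<tau>. \<tau> permutes {1..n} \<Longrightarrow> marking n \<sigma> \<tau> (M \<tau>)"
  shows "\<bar>real (card {\<tau>\<in>sym_perms n. holonomy_torus n \<sigma> \<tau> (M \<tau>)}) / fact n - 1 / exp 1\<bar> \<le> 94 * real c ^ 2 / n"
proof -
  interpret finite_perm "{1..n}" \<sigma> by standard (use \<sigma> in auto)
  let ?f = "card Fix"
  have f: "?f \<le> c" "card Fix2 \<le> 2 * c" using card_Fix_le_orbits card_Fix2_le c by simp_all
  have "?f\<^sup>2 \<le> c\<^sup>2" "(card Fix2)\<^sup>2 \<le> (2 * c)\<^sup>2" using f by (intro power_mono; simp)+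
  moreover have "(2 * c)\<^sup>2 = 4 * c\<^sup>2" "card {1..n} = n" by (simp_all add: power_mult_distrib)
  ultimately have F: "3 \<le> card {1..n}" "?f\<^sup>2 \<le> card {1..n}" "(card Fix2)\<^sup>2 \<le> 4 * card {1..n}"
    using n c(2) by linarith+
  interpret few_fixed_points "{1..n}" \<sigma> by unfold_locales (rule F)+
  have c1: "c \<ge> 1" using n c(1) by (simp add: Suc_le_eq card_gt_0_iff)
  let ?D = "{\<tau>\<in>perms. num_commuting \<tau> = 0}" and ?H = "{\<tau>\<in>sym_perms n. holonomy_torus n \<sigma> \<tau> (M \<tau>)}"
  let ?R = "\<Union>j\<in>Fix. {\<tau>\<in>perms. \<tau> j \<in> {j}}"
  have sq: "marked_square_tiling n \<sigma> \<tau> (M \<tau>)" if "\<tau> permutes {1..n}" for \<tau>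
    using that \<sigma> M n by unfold_locales auto
  have "?D \<subseteq> ?H"
  proof
    fix \<tau> assume "\<tau> \<in> ?D"
    then have "\<tau> permutes {1..n}" "card (commuting \<tau>) = 0" by (simp_all only: num_commuting_def mem_Collect_eq)
    moreover from this have "commuting \<tau> = {}" by (simp only: card_0_eq finite_sets)
    ultimately have t: "\<tau> permutes {1..n}" "\<And>j. j \<in> {1..n} \<Longrightarrow> \<tau> (\<sigma> j) \<noteq> \<sigma> (\<tau> j)"
      unfolding commuting_def commutes_at_def by blast+
    then show "\<tau> \<in> ?H"
      using marked_square_tiling.holonomy_torus_if_none_commute[OF sq[OF t(1)]] by (simp add: sym_perms_def)
  qed
  moreover have finH: "finite ?H" by (rule finite_subset[OF _ finite_perms]) (auto simp: sym_perms_def)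
  ultimately have lower: "card ?D \<le> card ?H" by (intro card_mono)
  have "?H \<subseteq> ?D \<union> ?R"
  proof
    fix \<tau> assume "\<tau> \<in> ?H"
    then have t: "\<tau> permutes {1..n}" "holonomy_torus n \<sigma> \<tau> (M \<tau>)" by (auto simp: sym_perms_def)
    show "\<tau> \<in> ?D \<union> ?R"
    proof (cases "num_commuting \<tau> = 0")
      case False
      then have "commuting \<tau> \<noteq> {}" unfolding num_commuting_def by (metis card.empty)
      then obtain j where j: "j \<in> {1..n}" "\<tau> (\<sigma> j) = \<sigma> (\<tau> j)"
        unfolding commuting_def commutes_at_def by blast
      then have fixed: "\<sigma> j = j \<and> \<tau> j = j"
        using marked_square_tiling.fixed_if_holonomy_torus[OF sq[OF t(1)] t(2)] by blast
      then have "j \<in> Fix" unfolding Fix_def using j by blast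
      then show ?thesis using t fixed by blast
    qed (use t in simp)
  qed
  then have "card ?H \<le> card (?D \<union> ?R)"
    by (rule card_mono[rotated]) (rule finite_subset[OF _ finite_perms], blast)
  also have "\<dots> \<le> card ?D + card ?R" by (rule card_Un_le)
  also have "card ?R \<le> (\<Sum>j\<in>Fix. card {\<tau>\<in>perms. \<tau> j \<in> {j}})" by (rule card_UN_le[OF finite_sets(1)])
  also have "\<dots> \<le> (\<Sum>j\<in>Fix. card {j} * fact (n - 1))"
  proof (rule sum_mono)
    fix j assume "j \<in> Fix"
    then show "card {\<tau>\<in>perms. \<tau> j \<in> {j}} \<le> card {j} * fact (n - 1)"
      using card_image_in[of j "{j}"] Fix_sub by auto
  qed
  also have "\<dots> = ?f * fact (n - 1)" by simp
  finally have "card ?H \<le> card ?D + ?f * fact (n - 1)" by simp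
  then have "real (card ?H) \<le> real (card ?D + ?f * fact (n - 1))" by (simp only: of_nat_le_iff)
  then have "real (card ?H) \<le> real (card ?D) + ?f * fact (n - 1)"
    by (simp only: of_nat_add of_nat_mult of_nat_fact)
  then have "real (card ?H) / fact n \<le> (real (card ?D) + ?f * fact (n - 1)) / fact n"
    by (rule divide_right_mono) simp
  also have "\<dots> = real (card ?D) / fact n + ?f / n"
    using fact_n(1) by (simp add: add_divide_distrib)
  finally have upper: "real (card ?H) / fact n \<le> real (card ?D) / fact n + ?f / n" .
  have "real (card ?D) / fact n \<le> real (card ?H) / fact n"
    using lower by (intro divide_right_mono) auto
  then have "\<bar>real (card ?H) / fact n - 1 / exp 1\<bar> \<le> \<bar>real (card ?D) / fact n - 1 / exp 1\<bar> + ?f / n"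
    using upper by linarith
  also have "\<dots> \<le> ((2 * ?f + 44) / (n - 1) + ?f\<^sup>2 / n) + ?f / n"
    using prob_no_commuting_estimate by simp
  \<comment> \<open>\<open>2 f + 44 \<le> 46 c\<^sup>2\<close> because \<open>f \<le> c \<le> c\<^sup>2\<close>, and \<open>1 / (n - 1) \<le> 2 / n\<close>\<close>
  also have "\<dots> \<le> (46 * c\<^sup>2 * 2 / n + c\<^sup>2 / n) + c\<^sup>2 / n"
  proof (intro add_mono)
    have cc: "c \<le> c\<^sup>2" using c1 by (simp add: power2_eq_square)
    have "1 \<le> c\<^sup>2" using c1 by simp
    then have "2 * ?f + 44 \<le> 46 * c\<^sup>2" using f(1) cc by linarith
    then have "(2 * ?f + 44) / (n - 1) \<le> (46 * c\<^sup>2) / (n - 1)"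
      by (intro divide_right_mono) (simp_all only: of_nat_le_iff of_nat_0_le_iff)
    also have "\<dots> \<le> 46 * c\<^sup>2 * 2 / n"
    proof -
      have "1 / real (n - 1) \<le> 2 / n" using n by (simp add: field_simps of_nat_diff)
      then have "(46 * c\<^sup>2) * (1 / real (n - 1)) \<le> (46 * c\<^sup>2) * (2 / n)" by (intro mult_left_mono) auto
      then show ?thesis by simp
    qed
    finally show "(2 * ?f + 44) / (n - 1) \<le> 46 * c\<^sup>2 * 2 / n" .
    show "?f\<^sup>2 / n \<le> c\<^sup>2 / n" using f(1) by (intro divide_right_mono) (auto intro: power_mono)
    show "?f / n \<le> c\<^sup>2 / n" using f(1) cc by (intro divide_right_mono) auto
  qed
  also have "\<dots> = 94 * real c ^ 2 / n" by (simp add: add_divide_distrib[symmetric])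
  finally show ?thesis .
qed

text \<open>
  A single term of the exponential series is at most its sum.
\<close>
lemma exp_fact_bound: "real n ^ n / exp n \<le> fact n"
proof -
  have "(\<lambda>k. real n ^ k /\<^sub>R fact k) sums exp (real n)" by (rule exp_converges)
  then have "(\<Sum>k\<in>{n}. real n ^ k /\<^sub>R fact k) \<le> exp (real n)"
    using sum_le_suminf[of "\<lambda>k. real n ^ k /\<^sub>R fact k" "{n}"] by (auto simp: sums_iff)
  then show ?thesis by (simp add: field_simps)
qed

text \<open>
  By \<open>visibility_if_few_commute\<close>, failure requires that \<open>\<tau>\<close> commutes with \<open>\<sigma>\<close> at half of the points
  or more.
\<close>
lemma visibility_estimate:
  fixes n :: nat
  assumes n: "n \<ge> 1" and \<sigma>: "\<sigma> permutes {1..n}" and c: "card (orbit \<sigma> ` {1..n}) \<le> sqrt n"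
    and M: "\<And>\<tau>. \<tau> permutes {1..n} \<Longrightarrow> marking n \<sigma> \<tau> (M \<tau>)"
  shows "\<bar>real (card {\<tau>\<in>sym_perms n. visibility_sts n \<sigma> \<tau> (M \<tau>)}) / fact n - 1\<bar>
    \<le> 2 ^ n * real n powr (real n / 2 + sqrt (real n)) * exp (real n) / real n ^ n"
proof -
  interpret finite_perm "{1..n}" \<sigma> by standard (use \<sigma> in auto)
  let ?V = "{\<tau>\<in>sym_perms n. visibility_sts n \<sigma> \<tau> (M \<tau>)}" and ?B = "{\<tau>\<in>perms. n \<le> 2 * num_commuting \<tau>}"
  have fV: "finite ?V" "finite ?B" by (rule finite_subset[OF _ finite_perms]; auto simp: sym_perms_def)+
  have "perms \<subseteq> ?V \<union> ?B"
  proof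
    fix \<tau> assume t: "\<tau> \<in> perms"
    then interpret marked_square_tiling n \<sigma> \<tau> "M \<tau>" using \<sigma> M n by unfold_locales auto
    have "num_commuting \<tau> = card {j\<in>{1..n}. \<tau> (\<sigma> j) = \<sigma> (\<tau> j)}"
      by (simp only: num_commuting_def commuting_def commutes_at_def)
    then have "visibility_sts n \<sigma> \<tau> (M \<tau>)" if "\<not> n \<le> 2 * num_commuting \<tau>"
      using visibility_if_few_commute that by linarith
    then show "\<tau> \<in> ?V \<union> ?B" using t by (auto simp: sym_perms_def)
  qed
  then have "card perms \<le> card (?V \<union> ?B)" using fV by (intro card_mono) auto
  also have "\<dots> \<le> card ?V + card ?B" by (rule card_Un_le)
  finally have "real (card perms) \<le> real (card ?V + card ?B)" by (simp only: of_nat_le_iff)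
  moreover have cp: "real (card perms) = fact n" unfolding card_perms by simp
  ultimately have "fact n \<le> real (card ?V) + real (card ?B)" by (simp only: of_nat_add)
  then have low: "fact n - real (card ?V) \<le> real (card ?B)" by simp
  have "card ?V \<le> card perms" by (rule card_mono[OF finite_perms]) (auto simp: sym_perms_def)
  then have "real (card ?V) \<le> fact n" unfolding cp[symmetric] by (simp only: of_nat_le_iff)
  then have "\<bar>real (card ?V) / fact n - 1\<bar> = (fact n - real (card ?V)) / fact n"
    by (simp add: abs_if field_simps)
  also have "\<dots> \<le> real (card ?B) / fact n" using low by (intro divide_right_mono) auto
  also have "\<dots> \<le> (2 ^ n * n powr (n / 2 + sqrt n)) / (real n ^ n / exp n)"
  proof (rule frac_le)
    have "real (card ?B) \<le> 2 ^ n * n powr (n / 2 + card (orbit \<sigma> ` {1..n}))"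
      using card_many_commuting n by simp
    also have "\<dots> \<le> 2 ^ n * n powr (n / 2 + sqrt n)"
      using c n by (intro mult_left_mono powr_mono) auto
    finally show "real (card ?B) \<le> 2 ^ n * n powr (n / 2 + sqrt n)" .
  qed (use n exp_fact_bound in auto)
  finally show ?thesis by simp
qed

theorem theorem1p7:
  fixes \<alpha> :: real
    and \<mu> :: "nat \<Rightarrow> nat multiset"
    and M :: "nat \<Rightarrow> (nat \<Rightarrow> nat) \<Rightarrow> (nat \<Rightarrow> nat) \<Rightarrow> square_pt set set"
  assumes "0 \<le> \<alpha>" and "\<alpha> < 1 / 2"
    and "\<And>n. n \<ge> 1 \<Longrightarrow> is_partition (\<mu> n) n"
    and "\<And>n. n \<ge> 1 \<Longrightarrow> real (size (\<mu> n)) \<le> real n powr \<alpha>"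
    and "\<And>n \<sigma> \<tau>. n \<ge> 1 \<Longrightarrow> \<sigma> \<in> sym_perms n \<Longrightarrow> \<tau> \<in> sym_perms n \<Longrightarrow> marking n \<sigma> \<tau> (M n \<sigma> \<tau>)"
  shows "((\<lambda>n. prob_holonomy_torus n (\<mu> n) (M n)) \<longlonglongrightarrow> 1 / exp 1) \<and>
    (\<forall>\<epsilon>>0. \<alpha> + \<epsilon> < 1 / 2 \<longrightarrow>
      (\<lambda>n. \<bar>prob_holonomy_torus n (\<mu> n) (M n) - 1 / exp 1\<bar>)
        \<in> O(\<lambda>n. 1 / real n powr (1 - 2 * \<alpha> - 2 * \<epsilon>))) \<and>
    ((\<lambda>n. prob_visibility n (\<mu> n) (M n)) \<longlonglongrightarrow> 1) \<and>
    (\<lambda>n. 1 - prob_visibility n (\<mu> n) (M n)) \<in> O(\<lambda>n. real n ^ 2 / 2 powr (real n / 2))"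
proof -
  let ?h = "\<lambda>n. \<bar>prob_holonomy_torus n (\<mu> n) (M n) - 1 / exp 1\<bar>"
  let ?v = "\<lambda>n. \<bar>prob_visibility n (\<mu> n) (M n) - 1\<bar>"
  let ?b = "\<lambda>n. real n powr (2 * \<alpha> - 1)"
  let ?g = "\<lambda>n::nat. 2 ^ n * real n powr (real n / 2 + sqrt (real n)) * exp (real n) / real n ^ n"
  have orbits: "real (card (orbit \<sigma> ` {1..n})) \<le> real n powr \<alpha>" "\<sigma> permutes {1..n}"
    if "n \<ge> 1" "\<sigma> \<in> conj_class n (\<mu> n)" for n \<sigma>
    using that assms(4)[of n] size_cycle_type[of n \<sigma>] by (auto simp: conj_class_def sym_perms_def)
  have mark: "marking n \<sigma> \<tau> (M n \<sigma> \<tau>)" if "n \<ge> 1" "\<sigma> permutes {1..n}" "\<tau> permutes {1..n}" for n \<sigma> \<tau>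
    using that assms(5) by (simp add: sym_perms_def)
  have sq: "(real n powr \<alpha>)\<^sup>2 = real n powr (2 * \<alpha>)" for n
    by (simp add: power2_eq_square flip: powr_add)
  have h: "?h n \<le> 94 * ?b n" if n: "n \<ge> 3" for n
    unfolding prob_holonomy_torus_def
  proof (rule prob_random_pair)
    show "is_partition (\<mu> n) n" using n assms(3) by simp
    fix \<sigma> assume s: "\<sigma> \<in> conj_class n (\<mu> n)"
    define c where "c = card (orbit \<sigma> ` {1..n})"
    have cn: "real c \<le> real n powr \<alpha>" and perm: "\<sigma> permutes {1..n}"
      using orbits[OF _ s] n by (auto simp: c_def)
    then have c2: "real c ^ 2 \<le> real n powr (2 * \<alpha>)" unfolding sq[symmetric] by (intro power_mono) auto
    also have "\<dots> \<le> real n powr 1" using n assms(2) by (intro powr_mono) auto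
    finally have "real (c\<^sup>2) \<le> real n" using n by simp
    then have "c\<^sup>2 \<le> n" by (simp only: of_nat_le_iff)
    then have "\<bar>real (card {\<tau>\<in>sym_perms n. holonomy_torus n \<sigma> \<tau> (M n \<sigma> \<tau>)}) / fact n - 1 / exp 1\<bar> \<le> 94 * real c ^ 2 / n"
      using n perm mark by (intro holonomy_estimate) (auto simp: c_def)
    also have "\<dots> \<le> 94 * real n powr (2 * \<alpha>) / n"
      using c2 by (intro divide_right_mono mult_left_mono) auto
    also have "\<dots> = 94 * ?b n" using n by (simp add: powr_diff)
    finally show "\<bar>real (card {\<tau>\<in>sym_perms n. holonomy_torus n \<sigma> \<tau> (M n \<sigma> \<tau>)}) / fact n - 1 / exp 1\<bar> \<le> 94 * ?b n" .
  qed
  have v: "?v n \<le> ?g n" if n: "n \<ge> 1" for n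
    unfolding prob_visibility_def
  proof (rule prob_random_pair)
    show "is_partition (\<mu> n) n" using n assms(3) by simp
    fix \<sigma> assume s: "\<sigma> \<in> conj_class n (\<mu> n)"
    have "real n powr \<alpha> \<le> real n powr (1/2)" using n assms(2) by (intro powr_mono) auto
    then have "real (card (orbit \<sigma> ` {1..n})) \<le> sqrt n"
      using orbits(1)[OF n s] by (simp add: powr_half_sqrt)
    then show "\<bar>real (card {\<tau>\<in>sym_perms n. visibility_sts n \<sigma> \<tau> (M n \<sigma> \<tau>)}) / fact n - 1\<bar> \<le> ?g n"
      using n orbits(2)[OF n s] mark by (intro visibility_estimate) auto
  qed
  have hO: "?h \<in> O(?b)"
    by (rule bigoI[of _ 94]) (use h in \<open>auto intro!: eventually_sequentiallyI[of 3]\<close>)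
  have vO: "?v \<in> O(?g)"
    by (rule bigoI[of _ 1]) (use v in \<open>auto intro!: eventually_sequentiallyI[of 1]\<close>)
  have g0: "?g \<longlonglongrightarrow> 0" by real_asymp
  have gO: "?g \<in> O(\<lambda>n. real n ^ 2 / 2 powr (real n / 2))" by real_asymp
  have h0: "(\<lambda>n. 94 * ?b n) \<longlonglongrightarrow> 0" using assms(2) by real_asymp
  have "?h \<longlonglongrightarrow> 0"
    by (rule Lim_null_comparison[OF _ h0]) (use h in \<open>auto intro!: eventually_sequentiallyI[of 3]\<close>)
  then have 1: "(\<lambda>n. prob_holonomy_torus n (\<mu> n) (M n)) \<longlonglongrightarrow> 1 / exp 1"
    by (simp add: LIM_zero_iff tendsto_rabs_zero_iff)
  have "?v \<longlonglongrightarrow> 0"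
    by (rule Lim_null_comparison[OF _ g0]) (use v in \<open>auto intro!: eventually_sequentiallyI[of 1]\<close>)
  then have 3: "(\<lambda>n. prob_visibility n (\<mu> n) (M n)) \<longlonglongrightarrow> 1"
    by (simp add: LIM_zero_iff tendsto_rabs_zero_iff)
  have 2: "?h \<in> O(\<lambda>n. 1 / real n powr (1 - 2 * \<alpha> - 2 * \<epsilon>))" if "\<epsilon> > 0" for \<epsilon>
  proof (rule landau_o.big_trans[OF hO])
    show "?b \<in> O(\<lambda>n. 1 / real n powr (1 - 2 * \<alpha> - 2 * \<epsilon>))" using that by real_asymp
  qed
  have "(\<lambda>n. 1 - prob_visibility n (\<mu> n) (M n)) \<in> O(?v)" by (intro bigoI[of _ 1]) (simp add: abs_minus_commute)
  then have 4: "(\<lambda>n. 1 - prob_visibility n (\<mu> n) (M n)) \<in> O(\<lambda>n. real n ^ 2 / 2 powr (real n / 2))"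
    by (rule landau_o.big_trans[OF _ landau_o.big_trans[OF vO gO]])
  show ?thesis using 1 2 3 4 by blast
qed

end
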